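(* Let $(\Omega,\mathcal{F},P)$ be a probability space, $\mathfrak{X}$ a Banach space, $m\ge1$ a real number, $[\alpha,\beta]\subset(0,1]$, and $Y\in\mathcal{L}_1(\Omega,\mathcal{F},P)$. Consider the problem $$\min\ \varphi(x)\quad\text{subject to}\quad H^{(-2)}_{G(x)}(p)\ge H^{(-2)}_Y(p)\ \ \forall p\in[\alpha,\beta],\qquad x\in\mathcal{Y}, \tag{P}$$ under the following assumptions: (i) $\varphi:\mathfrak{X}\to\mathbb{R}$ is convex and continuous; (ii) $G:\mathfrak{X}\to\mathcal{L}_m(\Omega,\mathcal{F},P)$ is norm-to-norm continuous and $[G(x)](\omega)=g(x,\omega)$, where $g:\mathfrak{X}\times\Omega\to\mathbb{R}$ is a Carathéodory function and $g(\cdot,\omega)$ is concave for all $\omega\in\Omega$; (iii) $\mathcal{Y}\subset\mathfrak{X}$ is closed and convex; (iv) (uniform inverse dominance condition) there exists $\tilde{x}\in\mathcal{Y}$ with $\inf_{p\in[\alpha,\beta]}\big[H^{(-2)}_{G(\tilde{x})}(p)-H^{(-2)}_Y(p)\big]>0$. If $\hat{x}$ is an optimal solution of (P), then there exist a subgradient $S\in\partial[G(\hat{x})]$, a probability measure $\hat{\mu}$ supported on $[\alpha,\beta]$, and a constant $\kappa\ge0$ such that $$0\in\partial\varphi(\hat{x})+\kappa S^*\int_\alpha^\beta\partial\mathrm{AVaR}^-_p(G(\hat{x}))\,\hat{\mu}(dp)+\mathcal{N}_{\mathcal{Y}}(\hat{x}), \tag{1}$$ and $$\kappa\int_\alpha^\beta\mathrm{AVaR}^-_p(G(\hat{x}))\,\hat{\mu}(dp)=\kappa\int_\alpha^\beta\mathrm{AVaR}^-_p(Y)\,\hat{\mu}(dp).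 \tag{2}$$ Conversely, if for some probability measure $\hat{\mu}$ on $[0,1]$ and some $\kappa\ge0$ the inclusion (1) is satisfied with a subgradient $S\in\partial[G(\hat{x})]$, and (2) as well as the constraint $H^{(-2)}_{G(\hat{x})}(p)\ge H^{(-2)}_Y(p)$ hold, all with $[\alpha,\beta]$ replaced by $[0,1]$, then $\hat{x}$ is an optimal solution of (P) with $[\alpha,\beta]$ replaced by $[0,1]$.
   Context: For an integrable random variable $Z$ with distribution function $H_Z(\eta)=P[Z\le\eta]$, let $H_Z^{(-1)}(p)=\inf\{\eta:H_Z(\eta)\ge p\}$ for $0<p<1$, and let $H_Z^{(-2)}(p)=\int_0^pH_Z^{(-1)}(t)\,dt$ for $0<p\le1$, $H_Z^{(-2)}(0)=0$. Average Value-at-Risk (for $Z$ representing profits): $\mathrm{AVaR}^-_p(Z)=-\frac1pH_Z^{(-2)}(p)$ for $p\in(0,1]$; for $p=0$, $\mathrm{AVaR}^-_0(Z)=-\operatorname{ess\,inf}Z$. These are convex functionals; $\partial\mathrm{AVaR}^-_p(Z)$ is the usual convex subdifferential of $\mathrm{AVaR}^-_p$ on $\mathcal{L}_m(\Omega,\mathcal{F},P)$, a subset of $\mathcal{L}_{m^*}(\Omega,\mathcal{F},P)$ with $1/m+1/m^*=1$. The set $\int_\alpha^\beta\partial\mathrm{AVaR}^-_p(Z)\,\hat{\mu}(dp)$ consists of all elements $\int_\alpha^\beta\zeta(p,\cdot)\,\hat{\mu}(dp)$ of $\mathcal{L}_{m^*}(\Omega,\mathcal{F},P)$, where $\zeta$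 is measurable with $\zeta(p,\cdot)\in\partial\mathrm{AVaR}^-_p(Z)$. $\partial\varphi(\hat{x})\subset\mathfrak{X}^*$ is the usual convex subdifferential. $\partial[G(\hat{x})]$ is the concave operator subdifferential: the set of continuous linear operators $S:\mathfrak{X}\to\mathcal{L}_m(\Omega,\mathcal{F},P)$ with $Sd\ge G(\hat{x}+d)-G(\hat{x})$ a.s. for every $d\in\mathfrak{X}$; $S^*$ is the adjoint of $S$. The normal cone at $x\in\mathcal{Y}$ is $\mathcal{N}_{\mathcal{Y}}(x)=\{d\in\mathfrak{X}^*:\langle d,y-x\rangle\le0\ \forall y\in\mathcal{Y}\}$. *)

theory Defs
  imports "HOL-Probability.Probability"
begin

section \<open>Distribution functions, their inverses, and Average Value-at-Risk\<close>

definition quantile :: "'w measure \<Rightarrow> ('w \<Rightarrow> real) \<Rightarrow> real \<Rightarrow> real" where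
  "quantile M Z p = Inf {\<eta>. cdf (distr M borel Z) \<eta> \<ge> p}"

text \<open>The open interval is used because the infimum defining the quantile is meaningful for
  \<open>0 < t < 1\<close> only.\<close>

definition int_quantile :: "'w measure \<Rightarrow> ('w \<Rightarrow> real) \<Rightarrow> real \<Rightarrow> real" where
  "int_quantile M Z p = (if p = 0 then 0 else (LINT t:{0<..<p}|lborel. quantile M Z t))"

definition essinf :: "'w measure \<Rightarrow> ('w \<Rightarrow> real) \<Rightarrow> ereal" where
  "essinf M Z = - esssup M (\<lambda>\<omega>. - ereal (Z \<omega>))"

text \<open>Average Value-at-Risk of profits. It is extended real valued, since the value at
  \<open>p = 0\<close> is \<open>\<infinity>\<close> if \<open>Z\<close> is not essentially bounded from below.\<close>

definition AVaR :: "'w measure \<Rightarrow> real \<Rightarrow> ('w \<Rightarrow> real) \<Rightarrow> ereal" where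
  "AVaR M p Z = (if p = 0 then - essinf M Z else ereal (- (1 / p) * int_quantile M Z p))"


section \<open>The spaces \<open>L\<^sub>q\<close>\<close>

text \<open>Elements of \<open>L\<^sub>q\<close> are given by representatives; equality in \<open>L\<^sub>q\<close> is equality almost
  everywhere. The exponent is extended real in order to include \<open>q = \<infinity>\<close>.\<close>

definition Lp_space :: "'w measure \<Rightarrow> ereal \<Rightarrow> ('w \<Rightarrow> real) set" where
  "Lp_space M q = {f \<in> borel_measurable M.
     if q = \<infinity> then \<exists>C. AE \<omega> in M. \<bar>f \<omega>\<bar> \<le> C
     else integrable M (\<lambda>\<omega>. \<bar>f \<omega>\<bar> powr real_of_ereal q)}"

definition Lp_norm :: "'w measure \<Rightarrow> real \<Rightarrow> ('w \<Rightarrow> real) \<Rightarrow> real" where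
  "Lp_norm M m f = (LINT \<omega>|M. \<bar>f \<omega>\<bar> powr m) powr (1 / m)"

text \<open>The solution \<open>m\<^sup>*\<close> of \<open>1 / m + 1 / m\<^sup>* = 1\<close>.\<close>

definition conj_exponent :: "real \<Rightarrow> ereal" where
  "conj_exponent m = (if m = 1 then \<infinity> else ereal (m / (m - 1)))"

text \<open>Continuous linear operators into \<open>L\<^sub>m\<close>; linearity holds in \<open>L\<^sub>m\<close>, that is, almost surely
  for each fixed choice of the arguments.\<close>

definition cont_linear_op ::
    "'w measure \<Rightarrow> real \<Rightarrow> ('x::real_normed_vector \<Rightarrow> 'w \<Rightarrow> real) \<Rightarrow> bool" where
  "cont_linear_op M m S \<longleftrightarrow>
     (\<forall>d. S d \<in> Lp_space M (ereal m)) \<and>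
     (\<forall>d e. AE \<omega> in M. S (d + e) \<omega> = S d \<omega> + S e \<omega>) \<and>
     (\<forall>c d. AE \<omega> in M. S (c *\<^sub>R d) \<omega> = c * S d \<omega>) \<and>
     (\<exists>K. \<forall>d. Lp_norm M m (S d) \<le> K * norm d)"

text \<open>The adjoint \<open>S\<^sup>* \<zeta>\<close>, with the dual of \<open>L\<^sub>m\<close> represented by \<open>L\<^sub>m\<^sub>*\<close>. The lemma
  \<open>op_adjoint_apply\<close> below shows that the functional is indeed bounded and linear.\<close>

definition op_adjoint ::
    "'w measure \<Rightarrow> ('x::real_normed_vector \<Rightarrow> 'w \<Rightarrow> real) \<Rightarrow> ('w \<Rightarrow> real) \<Rightarrow> ('x \<Rightarrow>\<^sub>L real)" where
  "op_adjoint M S \<zeta> = Blinfun (\<lambda>d. LINT \<omega>|M. \<zeta> \<omega> * S d \<omega>)"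


section \<open>Subdifferentials and the normal cone\<close>

definition subdifferential ::
    "('x::real_normed_vector \<Rightarrow> real) \<Rightarrow> 'x \<Rightarrow> ('x \<Rightarrow>\<^sub>L real) set" where
  "subdifferential \<phi> x = {f. \<forall>y. \<phi> y \<ge> \<phi> x + blinfun_apply f (y - x)}"

definition normal_cone ::
    "('x::real_normed_vector) set \<Rightarrow> 'x \<Rightarrow> ('x \<Rightarrow>\<^sub>L real) set" where
  "normal_cone C x = {d. \<forall>y\<in>C. blinfun_apply d (y - x) \<le> 0}"

text \<open>The concave subdifferential at \<open>x\<close> of the operator \<open>x \<mapsto> g x\<close> with values in \<open>L\<^sub>m\<close>.\<close>

definition concave_op_subdifferential ::
    "'w measure \<Rightarrow> real \<Rightarrow> ('x::real_normed_vector \<Rightarrow> 'w \<Rightarrow> real) \<Rightarrow> 'x \<Rightarrow>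
     ('x \<Rightarrow> 'w \<Rightarrow> real) set" where
  "concave_op_subdifferential M m g x = {S. cont_linear_op M m S \<and>
     (\<forall>d. AE \<omega> in M. S d \<omega> \<ge> g (x + d) \<omega> - g x \<omega>)}"

definition AVaR_subdifferential ::
    "'w measure \<Rightarrow> real \<Rightarrow> real \<Rightarrow> ('w \<Rightarrow> real) \<Rightarrow> ('w \<Rightarrow> real) set" where
  "AVaR_subdifferential M m p Z = {\<zeta> \<in> Lp_space M (conj_exponent m).
     \<forall>W\<in>Lp_space M (ereal m).
       AVaR M p W \<ge> AVaR M p Z + ereal (LINT \<omega>|M. \<zeta> \<omega> * (W \<omega> - Z \<omega>))}"

text \<open>The set \<open>\<integral>\<^sub>\<alpha>\<^sup>\<beta> \<partial>AVaR\<^sub>p(Z) \<mu>(dp)\<close> of integrals of jointly measurable selections.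
  The values of \<open>\<zeta>\<close> for \<open>p\<close> outside \<open>[\<alpha>, \<beta>]\<close> are irrelevant.\<close>

definition AVaR_subdifferential_integral ::
    "'w measure \<Rightarrow> real \<Rightarrow> real measure \<Rightarrow> real \<Rightarrow> real \<Rightarrow> ('w \<Rightarrow> real) \<Rightarrow> ('w \<Rightarrow> real) set" where
  "AVaR_subdifferential_integral M m \<mu> \<alpha> \<beta> Z = {\<xi> \<in> Lp_space M (conj_exponent m).
     \<exists>\<zeta> :: real \<Rightarrow> 'w \<Rightarrow> real.
       (\<lambda>(p, \<omega>). \<zeta> p \<omega>) \<in> borel_measurable (borel \<Otimes>\<^sub>M M) \<and>
       (\<forall>p\<in>{\<alpha>..\<beta>}. \<zeta> p \<in> AVaR_subdifferential M m p Z) \<and>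
       (AE \<omega> in M. set_integrable \<mu> {\<alpha>..\<beta>} (\<lambda>p. \<zeta> p \<omega>) \<and>
                   \<xi> \<omega> = (LINT p:{\<alpha>..\<beta>}|\<mu>. \<zeta> p \<omega>))}"

text \<open>The integral of an extended real valued function, as the difference of the integrals of
  its positive and negative parts (\<open>e2ennreal\<close> sends negative numbers to \<open>0\<close>). For an
  integrable \<open>Z\<close>, \<open>AVaR M p Z\<close> is bounded from below by \<open>- E[Z]\<close>, so that the negative part
  has a finite integral if \<open>\<mu>\<close> is a probability measure.\<close>

definition ext_integral :: "real measure \<Rightarrow> real set \<Rightarrow> (real \<Rightarrow> ereal) \<Rightarrow> ereal" where
  "ext_integral \<mu> A f =
     enn2ereal (\<integral>\<^sup>+p\<in>A. e2ennreal (f p) \<partial>\<mu>) - enn2ereal (\<integral>\<^sup>+p\<in>A. e2ennreal (- f p) \<partial>\<mu>)"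

definition prob_measure_on :: "real \<Rightarrow> real \<Rightarrow> real measure \<Rightarrow> bool" where
  "prob_measure_on \<alpha> \<beta> \<mu> \<longleftrightarrow> prob_space \<mu> \<and> sets \<mu> = sets borel \<and> measure \<mu> {\<alpha>..\<beta>} = 1"


section \<open>The optimization problem\<close>

definition Caratheodory :: "'w measure \<Rightarrow> ('x::topological_space \<Rightarrow> 'w \<Rightarrow> real) \<Rightarrow> bool" where
  "Caratheodory M g \<longleftrightarrow>
     (\<forall>\<omega>\<in>space M. continuous_on UNIV (\<lambda>x. g x \<omega>)) \<and> (\<forall>x. g x \<in> borel_measurable M)"

definition norm_continuous ::
    "'w measure \<Rightarrow> real \<Rightarrow> ('x::real_normed_vector \<Rightarrow> 'w \<Rightarrow> real) \<Rightarrow> bool" where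
  "norm_continuous M m g \<longleftrightarrow>
     (\<forall>x. ((\<lambda>y. Lp_norm M m (\<lambda>\<omega>. g y \<omega> - g x \<omega>)) \<longlongrightarrow> 0) (at x))"

definition feasible_set ::
    "'w measure \<Rightarrow> ('x \<Rightarrow> 'w \<Rightarrow> real) \<Rightarrow> ('w \<Rightarrow> real) \<Rightarrow> 'x set \<Rightarrow> real \<Rightarrow> real \<Rightarrow> 'x set" where
  "feasible_set M g Y C \<alpha> \<beta> =
     {x \<in> C. \<forall>p\<in>{\<alpha>..\<beta>}. int_quantile M (g x) p \<ge> int_quantile M Y p}"

definition optimal_solution ::
    "'w measure \<Rightarrow> ('x \<Rightarrow> real) \<Rightarrow> ('x \<Rightarrow> 'w \<Rightarrow> real) \<Rightarrow> ('w \<Rightarrow> real) \<Rightarrow> 'x set \<Rightarrow> real \<Rightarrow> real \<Rightarrow> 'x \<Rightarrow>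
     bool" where
  "optimal_solution M \<phi> g Y C \<alpha> \<beta> x \<longleftrightarrow>
     x \<in> feasible_set M g Y C \<alpha> \<beta> \<and> (\<forall>y\<in>feasible_set M g Y C \<alpha> \<beta>. \<phi> x \<le> \<phi> y)"

text \<open>The two optimality conditions. The sum of sets is the Minkowski sum.\<close>

definition stationarity ::
    "'w measure \<Rightarrow> real \<Rightarrow> ('x::real_normed_vector \<Rightarrow> real) \<Rightarrow> ('x \<Rightarrow> 'w \<Rightarrow> real) \<Rightarrow> 'x set \<Rightarrow>
     real \<Rightarrow> real \<Rightarrow> 'x \<Rightarrow> ('x \<Rightarrow> 'w \<Rightarrow> real) \<Rightarrow> real measure \<Rightarrow> real \<Rightarrow> bool" where
  "stationarity M m \<phi> g C \<alpha> \<beta> x S \<mu> \<kappa> \<longleftrightarrow>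
     0 \<in> subdifferential \<phi> x
         + (\<lambda>\<xi>. \<kappa> *\<^sub>R op_adjoint M S \<xi>) ` AVaR_subdifferential_integral M m \<mu> \<alpha> \<beta> (g x)
         + normal_cone C x"

definition complementarity ::
    "'w measure \<Rightarrow> ('x \<Rightarrow> 'w \<Rightarrow> real) \<Rightarrow> ('w \<Rightarrow> real) \<Rightarrow> real \<Rightarrow> real \<Rightarrow> 'x \<Rightarrow>
     real measure \<Rightarrow> real \<Rightarrow> bool" where
  "complementarity M g Y \<alpha> \<beta> x \<mu> \<kappa> \<longleftrightarrow>
     ereal \<kappa> * ext_integral \<mu> {\<alpha>..\<beta>} (\<lambda>p. AVaR M p (g x)) =
     ereal \<kappa> * ext_integral \<mu> {\<alpha>..\<beta>} (\<lambda>p. AVaR M p Y)"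


section \<open>Well-definedness of the adjoint\<close>

lemma Lp_dual_pairing:
  assumes m: "1 \<le> m" and z: "\<zeta> \<in> Lp_space M (conj_exponent m)"
  obtains B where "\<And>f K. f \<in> Lp_space M (ereal m) \<Longrightarrow> Lp_norm M m f \<le> K \<Longrightarrow> 
     integrable M (\<lambda>\<omega>. \<zeta> \<omega> * f \<omega>) \<and> \<bar>LINT \<omega>|M. \<zeta> \<omega> * f \<omega>\<bar> \<le> B K"
proof (cases "m = 1")
  case True
  from z obtain C0 where zm: "\<zeta> \<in> borel_measurable M" and "AE \<omega> in M. \<bar>\<zeta> \<omega>\<bar> \<le> C0"
    unfolding Lp_space_def conj_exponent_def using True by auto
  then have C: "AE \<omega> in M. \<bar>\<zeta> \<omega>\<bar> \<le> max C0 0"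
    by (auto elim: eventually_mono)
  show thesis
  proof (rule that)
    fix f K assume f: "f \<in> Lp_space M (ereal m)" and n: "Lp_norm M m f \<le> K"
    have fm: "f \<in> borel_measurable M" and fi: "integrable M (\<lambda>\<omega>. \<bar>f \<omega>\<bar>)"
      using f True unfolding Lp_space_def by auto
    have fn: "(LINT \<omega>|M. \<bar>f \<omega>\<bar>) \<le> K"
      using n True unfolding Lp_norm_def by simp
    have b: "AE \<omega> in M. norm (\<zeta> \<omega> * f \<omega>) \<le> max C0 0 * \<bar>f \<omega>\<bar>"
      using C by eventually_elim (auto simp: abs_mult intro!: mult_right_mono)
    have bi: "integrable M (\<lambda>\<omega>. max C0 0 * \<bar>f \<omega>\<bar>)" using fi by simp
    have i: "integrable M (\<lambda>\<omega>. \<zeta> \<omega> * f \<omega>)"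
      by (rule Bochner_Integration.integrable_bound[OF bi])
        (use b zm fm in \<open>auto elim: eventually_mono\<close>)
    have "\<bar>LINT \<omega>|M. \<zeta> \<omega> * f \<omega>\<bar> \<le> (LINT \<omega>|M. \<bar>\<zeta> \<omega> * f \<omega>\<bar>)"
      by (rule integral_abs_bound)
    also have "\<dots> \<le> (LINT \<omega>|M. max C0 0 * \<bar>f \<omega>\<bar>)"
      by (rule integral_mono_AE) (use i bi b in auto)
    also have "\<dots> \<le> max C0 0 * K"
      using fn by (simp add: mult_left_mono)
    finally show "integrable M (\<lambda>\<omega>. \<zeta> \<omega> * f \<omega>) \<and> \<bar>LINT \<omega>|M. \<zeta> \<omega> * f \<omega>\<bar> \<le> (\<lambda>K. max C0 0 * K) K"
      using i by simp
  qed
next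
  case False
  define q where "q = m / (m - 1)"
  have m1: "m > 1" and q1: "q > 1" using m False by (auto simp: q_def field_simps)
  have pq: "1 / q + 1 / m = 1" using m1 by (simp add: q_def field_simps)
  have zm: "\<zeta> \<in> borel_measurable M" and zi: "integrable M (\<lambda>\<omega>. \<bar>\<zeta> \<omega>\<bar> powr q)"
    using z False unfolding Lp_space_def conj_exponent_def q_def by auto
  show thesis
  proof (rule that)
    fix f K assume f: "f \<in> Lp_space M (ereal m)" and n: "Lp_norm M m f \<le> K"
    have fm: "f \<in> borel_measurable M" and fi: "integrable M (\<lambda>\<omega>. \<bar>f \<omega>\<bar> powr m)"
      using f unfolding Lp_space_def by auto
    have nn: "(LINT \<omega>|M. \<bar>f \<omega>\<bar> powr m) \<ge> 0" by simp
    have "(LINT \<omega>|M. \<bar>f \<omega>\<bar> powr m) = Lp_norm M m f powr m"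
      unfolding Lp_norm_def using m1 nn by (simp add: powr_powr)
    also have "\<dots> \<le> K powr m"
      using n m1 by (intro powr_mono2) (auto simp: Lp_norm_def)
    finally have fn: "(LINT \<omega>|M. \<bar>f \<omega>\<bar> powr m) \<le> K powr m" .
    let ?h = "\<lambda>\<omega>. \<bar>\<zeta> \<omega>\<bar> powr q / q + \<bar>f \<omega>\<bar> powr m / m"
    have hi: "integrable M ?h" using zi fi by simp
    have b: "norm (\<zeta> \<omega> * f \<omega>) \<le> ?h \<omega>" for \<omega>
      using Youngs_inequality[OF q1 m1 pq, of "\<bar>\<zeta> \<omega>\<bar>" "\<bar>f \<omega>\<bar>"] by (simp add: abs_mult)
    have i: "integrable M (\<lambda>\<omega>. \<zeta> \<omega> * f \<omega>)"
    proof (rule Bochner_Integration.integrable_bound[OF hi])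
      show "(\<lambda>\<omega>. \<zeta> \<omega> * f \<omega>) \<in> borel_measurable M" using zm fm by simp
      show "AE \<omega> in M. norm (\<zeta> \<omega> * f \<omega>) \<le> norm (?h \<omega>)"
        by (rule AE_I2) (rule order_trans[OF b], simp)
    qed
    have "\<bar>LINT \<omega>|M. \<zeta> \<omega> * f \<omega>\<bar> \<le> (LINT \<omega>|M. \<bar>\<zeta> \<omega> * f \<omega>\<bar>)"
      by (rule integral_abs_bound)
    also have "\<dots> \<le> integral\<^sup>L M ?h"
      by (rule integral_mono_AE) (use i hi b in auto)
    also have "\<dots> = (LINT \<omega>|M. \<bar>\<zeta> \<omega>\<bar> powr q) / q + (LINT \<omega>|M. \<bar>f \<omega>\<bar> powr m) / m"
      using zi fi by simp
    also have "\<dots> \<le> (LINT \<omega>|M. \<bar>\<zeta> \<omega>\<bar> powr q) / q + K powr m / m"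
      using fn m1 by (simp add: divide_right_mono)
    finally show "integrable M (\<lambda>\<omega>. \<zeta> \<omega> * f \<omega>) \<and> \<bar>LINT \<omega>|M. \<zeta> \<omega> * f \<omega>\<bar>
        \<le> (\<lambda>K. (LINT \<omega>|M. \<bar>\<zeta> \<omega>\<bar> powr q) / q + K powr m / m) K"
      using i by simp
  qed
qed

lemma op_adjoint_apply:
  assumes m: "1 \<le> m" and z: "\<zeta> \<in> Lp_space M (conj_exponent m)" and S: "cont_linear_op M m S"
  shows "bounded_linear (\<lambda>d. LINT \<omega>|M. \<zeta> \<omega> * S d \<omega>)"
    and "blinfun_apply (op_adjoint M S \<zeta>) d = (LINT \<omega>|M. \<zeta> \<omega> * S d \<omega>)"
proof -
  let ?L = "\<lambda>d. LINT \<omega>|M. \<zeta> \<omega> * S d \<omega>"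
  obtain B where B: "\<And>f K. f \<in> Lp_space M (ereal m) \<Longrightarrow> Lp_norm M m f \<le> K \<Longrightarrow> 
     integrable M (\<lambda>\<omega>. \<zeta> \<omega> * f \<omega>) \<and> \<bar>LINT \<omega>|M. \<zeta> \<omega> * f \<omega>\<bar> \<le> B K"
    using Lp_dual_pairing[OF m z] by blast
  have Sm: "S d \<in> Lp_space M (ereal m)" for d using S unfolding cont_linear_op_def by blast
  have [measurable]: "S d \<in> borel_measurable M" "\<zeta> \<in> borel_measurable M" for d
    using Sm z unfolding Lp_space_def by auto
  have i: "integrable M (\<lambda>\<omega>. \<zeta> \<omega> * S d \<omega>)" for d using B[OF Sm order_refl] by blast
  obtain K where K: "\<And>d. Lp_norm M m (S d) \<le> K * norm d"
    using S unfolding cont_linear_op_def by blast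
  have add: "?L (d + e) = ?L d + ?L e" for d e
  proof -
    have ae: "AE \<omega> in M. S (d + e) \<omega> = S d \<omega> + S e \<omega>"
      using S unfolding cont_linear_op_def by blast
    have "?L (d + e) = (LINT \<omega>|M. \<zeta> \<omega> * S d \<omega> + \<zeta> \<omega> * S e \<omega>)"
      by (rule integral_cong_AE) (use ae in \<open>auto simp: algebra_simps elim: eventually_mono\<close>)
    then show ?thesis using i by simp
  qed
  have scale: "?L (c *\<^sub>R d) = c *\<^sub>R ?L d" for c d
  proof -
    have ae: "AE \<omega> in M. S (c *\<^sub>R d) \<omega> = c * S d \<omega>"
      using S unfolding cont_linear_op_def by blast
    have "?L (c *\<^sub>R d) = (LINT \<omega>|M. c * (\<zeta> \<omega> * S d \<omega>))"
      by (rule integral_cong_AE) (use ae in \<open>auto simp: algebra_simps elim: eventually_mono\<close>)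
    then show ?thesis by simp
  qed
  show bl: "bounded_linear ?L"
  proof (rule bounded_linear_intro[OF add scale, where K = "B K"])
    fix d
    show "norm (?L d) \<le> norm d * B K"
    proof (cases "d = 0")
      case True
      then show ?thesis using scale[of 0 0] by simp
    next
      case False
      have "Lp_norm M m (S ((1 / norm d) *\<^sub>R d)) \<le> K" using K[of "(1 / norm d) *\<^sub>R d"] False by simp
      then have "\<bar>?L ((1 / norm d) *\<^sub>R d)\<bar> \<le> B K" using B[OF Sm] by blast
      then show ?thesis using False unfolding scale by (simp add: field_simps abs_mult)
    qed
  qed
  show "blinfun_apply (op_adjoint M S \<zeta>) d = ?L d"
    unfolding op_adjoint_def by (simp add: bounded_linear_Blinfun_apply[OF bl])
qed

end

theory Submission
  imports Defs "HOL-Library.Function_Algebras"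
begin

text \<open>Necessity. Three applications of the Hahn--Banach theorem to convex perturbation functions are
  combined. The first perturbs the argument of \<open>\<phi>\<close>, the argument of \<open>g\<close> and the right hand side of the
  constraint (with a continuous function of \<open>p\<close>); it yields a subgradient of \<open>\<phi>\<close>, a functional \<open>T\<close>
  on the Banach space, and, by the Riesz representation theorem, the measure \<open>\<kappa> \<mu>\<close>. The second
  perturbs \<open>g\<close> by integrable functions of \<open>(p, \<omega>)\<close>, so that the subgradients
  \<open>\<zeta>(p, \<omega>)\<close> of AVaR appear as a density with respect to \<open>\<mu> \<Otimes> P\<close>. The third
  represents \<open>T\<close> in the form \<open>\<kappa> S\<^sup>* \<xi>\<close> with \<open>\<xi> = \<integral> \<zeta>(p, \<cdot>) \<mu>(dp)\<close>. Throughout,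
  the quantile integral is used in the form \<open>sup\<^sub>\<eta> (\<eta> p - E (\<eta> - Z)\<^sup>+)\<close>.

  Sufficiency. Subgradients of AVaR are nonpositive, hence \<open>E \<xi> S(y - x) \<le> E \<xi> (g y - g x)\<close>,
  which by Fubini's theorem and the subgradient inequality is at most the difference of the
  integrals of AVaR. This is nonpositive by feasibility and complementarity.\<close>

section \<open>The Hahn--Banach theorem\<close>

text \<open>The conclusion asks for functions rather than functionals: one operator \<open>S\<close>
  for all directions, and one jointly measurable \<open>\<zeta>\<close> that is a subgradient for
  every p. Instead of selecting measurably from set-valued subdifferentials, each of them is read
  off as a Radon-Nikodym density from a linear functional on a space of functions, and measurability
  comes with the density. The Hahn-Banach theorem is used in purely algebraic form: some positive
  multiple of every direction must lie in the domain of the convex function, and boundedness of the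
  functional is recovered afterwards from the function that dominates it. The assumption \<alpha> >
  0 acts through the factor 1 / p, which stays below 1 / \<alpha>; it makes AVaR continuous in p and
  \<open>\<zeta>\<close> bounded. The converse admits p = 0, where AVaR may be infinite, and
  \<open>\<zeta>\<close> may be unbounded. There the existence of a subgradient forces AVaR of
  \<open>g xh\<close> to be finite, and the sign of \<open>\<zeta>\<close> supplies the
  integrability that Fubini's theorem requires.\<close>

instantiation "fun" :: (type, real_vector) real_vector
begin

definition scaleR_fun :: "real \<Rightarrow> ('a \<Rightarrow> 'b) \<Rightarrow> 'a \<Rightarrow> 'b" where
  "scaleR_fun c f = (\<lambda>x. c *\<^sub>R f x)"

instance
  by standard (auto simp: scaleR_fun_def fun_eq_iff scaleR_add_right scaleR_add_left)

end

lemma scaleR_fun_apply [simp]: "(c *\<^sub>R f) x = c *\<^sub>R f x"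
  by (simp add: scaleR_fun_def)

definition sublinear :: "('a::real_vector \<Rightarrow> real) \<Rightarrow> bool" where
  "sublinear p \<longleftrightarrow> (\<forall>x y. p (x + y) \<le> p x + p y) \<and> (\<forall>c x. 0 \<le> c \<longrightarrow> p (c *\<^sub>R x) = c * p x)"

lemma sublinear_add: "sublinear p \<Longrightarrow> p (x + y) \<le> p x + p y"
  and sublinear_scale: "sublinear p \<Longrightarrow> 0 \<le> c \<Longrightarrow> p (c *\<^sub>R x) = c * p x"
  by (auto simp: sublinear_def)

lemma sublinear_zero: "sublinear p \<Longrightarrow> p 0 = 0"
  using sublinear_scale[of p 0 0] by simp

lemma sublinear_neg: "sublinear p \<Longrightarrow> - p (- x) \<le> p x"
  using sublinear_add[of p x "- x"] sublinear_zero[of p] by simp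

text \<open>One inequality of positive homogeneity is enough: applied to \<open>inverse c\<close>
  and the scaled vector it yields the other one.\<close>

lemma sublinearI:
  assumes add: "\<And>x y. p (x + y) \<le> p x + p y" and zero: "p 0 = 0"
    and scale: "\<And>c x. 0 < c \<Longrightarrow> c * p x \<le> p (c *\<^sub>R x)"
  shows "sublinear p"
  unfolding sublinear_def
proof (intro conjI allI impI add)
  fix c :: real and x assume "0 \<le> c"
  then consider "c = 0" | "c > 0" by linarith
  then show "p (c *\<^sub>R x) = c * p x"
  proof cases
    case 2
    then have "p (c *\<^sub>R x) \<le> c * p x"
      using scale[of "inverse c" "c *\<^sub>R x"] by (simp add: field_simps)
    with scale[OF 2, of x] show ?thesis by simp
  qed (simp add: zero)
qed

text \<open>The bound \<open>- p (- x)\<close>, common to all members, keeps the infimum finite.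
  Subadditivity uses the chain condition: of any two members the smaller one serves for both
  arguments.\<close>

lemma sublinear_Inf_chain:
  fixes Q :: "('a::real_vector \<Rightarrow> real) set"
  assumes ne: "Q \<noteq> {}" and sl: "\<And>q. q \<in> Q \<Longrightarrow> sublinear q"
    and le: "\<And>q x. q \<in> Q \<Longrightarrow> q x \<le> p x"
    and ch: "\<And>q r. q \<in> Q \<Longrightarrow> r \<in> Q \<Longrightarrow> q \<le> r \<or> r \<le> q"
  shows "sublinear (\<lambda>x. INF q\<in>Q. q x)" and "\<And>q x. q \<in> Q \<Longrightarrow> (INF q\<in>Q. q x) \<le> q x"
proof -
  have lb: "- p (- x) \<le> q x" if "q \<in> Q" for q x
    using sublinear_neg[OF sl[OF that], of x] le[OF that, of "- x"] by simp
  have bdd: "bdd_below ((\<lambda>q. q x) ` Q)" for x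
    using lb by (auto intro!: bdd_belowI)
  show low: "(INF q\<in>Q. q x) \<le> q x" if "q \<in> Q" for q x
    using that bdd by (rule cINF_lower[rotated])
  show "sublinear (\<lambda>x. INF q\<in>Q. q x)"
  proof (rule sublinearI)
    fix x y
    have "(INF q\<in>Q. q (x + y)) - q x \<le> r y" if qr: "q \<in> Q" "r \<in> Q" for q r
    proof -
      obtain s where s: "s \<in> Q" "s \<le> q" "s \<le> r"
        using ch[OF qr] qr by blast
      have "(INF q\<in>Q. q (x + y)) \<le> s x + s y"
        using low[OF s(1), of "x + y"] sublinear_add[OF sl[OF s(1)], of x y] by simp
      also have "\<dots> \<le> q x + r y"
        using s by (intro add_mono) (auto simp: le_fun_def)
      finally show ?thesis by simp
    qed
    then have "(INF q\<in>Q. q (x + y)) - q x \<le> (INF r\<in>Q. r y)" if "q \<in> Q" for q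
      using that ne by (intro cINF_greatest) auto
    then have "(INF q\<in>Q. q (x + y)) - (INF r\<in>Q. r y) \<le> (INF q\<in>Q. q x)"
      using ne by (intro cINF_greatest) (auto simp: algebra_simps)
    then show "(INF q\<in>Q. q (x + y)) \<le> (INF q\<in>Q. q x) + (INF q\<in>Q. q y)" by simp
  next
    have "(\<lambda>q. q 0) ` Q = {0}" using ne sublinear_zero[OF sl] by force
    then show "(INF q\<in>Q. q 0) = 0" by simp
  next
    fix c :: real and x :: 'a assume c: "0 < c"
    show "c * (INF q\<in>Q. q x) \<le> (INF q\<in>Q. q (c *\<^sub>R x))"
    proof (rule cINF_greatest[OF ne])
      fix q assume q: "q \<in> Q"
      show "c * (INF q\<in>Q. q x) \<le> q (c *\<^sub>R x)"
        using sublinear_scale[OF sl[OF q], of c x] c low[OF q, of x] by simp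
    qed
  qed
qed

text \<open>A pointwise minimal sublinear functional \<open>q\<close> is linear: for fixed \<open>y\<close>, the functional
  \<open>x \<mapsto> inf\<^sub>t\<^sub>\<ge>\<^sub>0 (q (x + t y) - t q y)\<close> is sublinear and below \<open>q\<close>, hence equal to \<open>q\<close>.\<close>

lemma minimal_sublinear_imp_linear:
  fixes q :: "'a::real_vector \<Rightarrow> real"
  assumes q: "sublinear q" and min: "\<And>r. sublinear r \<Longrightarrow> r \<le> q \<Longrightarrow> r = q"
  shows "linear q"
proof -
  have add: "q x + q y \<le> q (x + y)" for x y
  proof -
    define S where "S x = (\<lambda>t. q (x + t *\<^sub>R y) - t * q y) ` {0..}" for x
    define r where "r x = Inf (S x)" for x
    have lb: "- q (- x) \<le> q (x + t *\<^sub>R y) - t * q y" if "t \<ge> 0" for x t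
    proof -
      have "q (t *\<^sub>R y) \<le> q (x + t *\<^sub>R y) + q (- x)"
        using sublinear_add[OF q, of "x + t *\<^sub>R y" "- x"] by simp
      then show ?thesis using sublinear_scale[OF q that, of y] by simp
    qed
    have bdd: "bdd_below (S x)" for x
      using lb by (auto simp: S_def intro!: bdd_belowI)
    have low: "r x \<le> q (x + t *\<^sub>R y) - t * q y" if "t \<ge> 0" for x t
      unfolding r_def by (rule cInf_lower[OF _ bdd]) (use that in \<open>auto simp: S_def\<close>)
    have great: "z \<le> r x" if "\<And>t. t \<ge> 0 \<Longrightarrow> z \<le> q (x + t *\<^sub>R y) - t * q y" for z x
      unfolding r_def by (rule cInf_greatest) (use that in \<open>auto simp: S_def\<close>)
    have "sublinear r"
    proof (rule sublinearI)
      fix a b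
      have "r (a + b) - (q (a + t *\<^sub>R y) - t * q y) \<le> r b" if t: "t \<ge> 0" for t
      proof (rule great)
        fix s :: real assume s: "s \<ge> 0"
        have "r (a + b) \<le> q (a + b + (t + s) *\<^sub>R y) - (t + s) * q y"
          using s t by (intro low) simp
        also have "a + b + (t + s) *\<^sub>R y = (a + t *\<^sub>R y) + (b + s *\<^sub>R y)"
          by (simp add: algebra_simps)
        also have "q \<dots> \<le> q (a + t *\<^sub>R y) + q (b + s *\<^sub>R y)" by (rule sublinear_add[OF q])
        finally show "r (a + b) - (q (a + t *\<^sub>R y) - t * q y) \<le> q (b + s *\<^sub>R y) - s * q y"
          by (simp add: algebra_simps)
      qed
      then have "r (a + b) - r b \<le> r a"
        by (intro great) (simp add: algebra_simps)
      then show "r (a + b) \<le> r a + r b" by simp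
    next
      show "r 0 = 0"
      proof (rule antisym)
        show "r 0 \<le> 0" using low[of 0 0] sublinear_zero[OF q] by simp
        show "0 \<le> r 0" using lb[of _ 0] sublinear_zero[OF q] by (intro great) simp
      qed
    next
      fix d :: real and z assume d: "0 < d"
      show "d * r z \<le> r (d *\<^sub>R z)"
      proof (rule great)
        fix t :: real assume t: "t \<ge> 0"
        have "d * r z \<le> d * (q (z + (t / d) *\<^sub>R y) - (t / d) * q y)"
          using d t by (intro mult_left_mono low) auto
        also have "\<dots> = q (d *\<^sub>R (z + (t / d) *\<^sub>R y)) - t * q y"
          using d sublinear_scale[OF q, of d] by (simp add: right_diff_distrib del: scaleR_add_right)
        also have "d *\<^sub>R (z + (t / d) *\<^sub>R y) = d *\<^sub>R z + t *\<^sub>R y"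
          using d by (simp add: algebra_simps)
        finally show "d * r z \<le> q (d *\<^sub>R z + t *\<^sub>R y) - t * q y" .
      qed
    qed
    moreover have "r \<le> q" using low[of 0] by (simp add: le_fun_def)
    ultimately have "r = q" by (rule min)
    \<comment> \<open>The value t = 1 in the infimum that defines \<open>r\<close>; this is the
      superadditivity that separates linear from sublinear functionals.\<close>
    then have "q x \<le> q (x + y) - q y" using low[of 1 x] by simp
    then show ?thesis by simp
  qed
  have add_eq: "q (x + y) = q x + q y" for x y
    using add[of x y] sublinear_add[OF q, of x y] by simp
  have neg: "q (- x) = - q x" for x
    using add_eq[of x "- x"] sublinear_zero[OF q] by simp
  show ?thesis
  proof (rule linearI)
    show "q (x + y) = q x + q y" for x y by (rule add_eq)
    show "q (c *\<^sub>R x) = c *\<^sub>R q x" for c x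
    proof (cases "c \<ge> 0")
      case True
      then show ?thesis using sublinear_scale[OF q] by simp
    next
      case False
      then have "q (- (c *\<^sub>R x)) = (- c) * q x" using sublinear_scale[OF q, of "- c" x] by simp
      then show ?thesis using neg by simp
    qed
  qed
qed

text \<open>Zorn's lemma is applied to the sublinear functionals below \<open>p\<close>, with the
  pointwise order reversed by \<open>P\<close>, so that maximal elements are pointwise minimal and
  hence linear. Extension from subspaces one dimension at a time is thereby avoided.\<close>

theorem sublinear_dominates_linear:
  fixes p :: "'a::real_vector \<Rightarrow> real"
  assumes p: "sublinear p"
  shows "\<exists>F. linear F \<and> (\<forall>x. F x \<le> p x)"
proof -
  define P where "P = (\<lambda>q r :: 'a \<Rightarrow> real. r \<le> q)"
  define A where "A = {q. sublinear q \<and> q \<le> p}"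
  have "\<exists>m\<in>A. \<forall>a\<in>A. P m a \<longrightarrow> a = m"
  proof (rule predicate_Zorn)
    show "partial_order_on A (relation_of P A)"
      by (rule partial_order_on_relation_ofI) (auto simp: P_def)
  next
    fix Q assume Q: "Q \<in> Chains (relation_of P A)"
    have QA: "Q \<subseteq> A" and ch: "\<And>q r. q \<in> Q \<Longrightarrow> r \<in> Q \<Longrightarrow> q \<le> r \<or> r \<le> q"
      using Q unfolding Chains_def relation_of_def P_def by auto
    show "\<exists>u\<in>A. \<forall>a\<in>Q. P a u"
    proof (cases "Q = {}")
      case True
      then show ?thesis using p by (auto simp: A_def)
    next
      case False
      have sl: "\<And>q. q \<in> Q \<Longrightarrow> sublinear q" and le: "\<And>q x. q \<in> Q \<Longrightarrow> q x \<le> p x"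
        using QA by (auto simp: A_def le_fun_def)
      have I: "sublinear (\<lambda>x. INF q\<in>Q. q x)" "\<And>q x. q \<in> Q \<Longrightarrow> (INF q\<in>Q. q x) \<le> q x"
        using sublinear_Inf_chain[of Q p] False sl le ch by blast+
      obtain q where q: "q \<in> Q" using False by auto
      have "(INF q\<in>Q. q x) \<le> p x" for x
        using I(2)[OF q, of x] le[OF q, of x] by simp
      then have "(\<lambda>x. INF q\<in>Q. q x) \<in> A" using I(1) by (simp add: A_def le_fun_def)
      moreover have "\<forall>a\<in>Q. P a (\<lambda>x. INF q\<in>Q. q x)"
        using I(2) by (auto simp: P_def le_fun_def)
      ultimately show ?thesis by blast
    qed
  qed
  then obtain m where m: "sublinear m" "m \<le> p"
    and min: "\<And>a. sublinear a \<Longrightarrow> a \<le> p \<Longrightarrow> a \<le> m \<Longrightarrow> a = m"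
    by (auto simp: A_def P_def)
  have "linear m"
    by (rule minimal_sublinear_imp_linear[OF m(1)]) (use min m(2) in \<open>blast intro: order_trans\<close>)
  then show ?thesis using m(2) by (auto simp: le_fun_def)
qed

text \<open>A linear left inverse of the identity on \<open>U\<close>. It may be discontinuous,
  which is harmless because the Hahn-Banach argument is algebraic.\<close>

lemma subspace_projection:
  fixes U :: "'a::real_vector set"
  assumes "subspace U"
  obtains R where "linear R" "\<And>x. R x \<in> U" "\<And>x. x \<in> U \<Longrightarrow> R x = x"
proof -
  have "linear (\<lambda>x::'a. x)" by (rule linear_id[unfolded id_def])
  from linear_exists_left_inverse_on[OF this assms inj_on_id2]
  show thesis using that by (metis rangeI subsetD)
qed

text \<open>The Hahn--Banach theorem with \<open>A\<close> regarded as the epigraph of a convex function on \<open>U\<close>. In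
  the proof, \<open>R\<close> reduces to the case that \<open>U\<close> is the whole space, and \<open>p\<close> is the directional
  derivative at \<open>0\<close>.\<close>

theorem linear_minorant_of_convex_set:
  fixes A :: "('a::real_vector \<times> real) set"
  assumes A: "convex A" and U: "subspace U" and AU: "\<And>h r. (h, r) \<in> A \<Longrightarrow> h \<in> U"
    and zero: "\<And>r. (0, r) \<in> A \<Longrightarrow> 0 \<le> r"
    and core: "\<And>h. h \<in> U \<Longrightarrow> \<exists>t>0. \<exists>r. (t *\<^sub>R h, r) \<in> A"
  shows "\<exists>F. linear F \<and> (\<forall>(h, r)\<in>A. F h \<le> r)"
proof -
  obtain R where R: "linear R" "\<And>x. R x \<in> U" "\<And>x. x \<in> U \<Longrightarrow> R x = x"
    using subspace_projection[OF U] by metis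
  define B where "B = {(h, r). (R h, r) \<in> A}"
  have B: "convex B"
  proof (rule convexI)
    fix a b and s t :: real
    assume "a \<in> B" "b \<in> B" "0 \<le> s" "0 \<le> t" "s + t = 1"
    then show "s *\<^sub>R a + t *\<^sub>R b \<in> B"
      using convexD[OF A, of "(R (fst a), snd a)" "(R (fst b), snd b)" s t]
      by (auto simp: B_def linear_add[OF R(1)] linear_scale[OF R(1)])
  qed
  have zeroB: "0 \<le> r" if "(0, r) \<in> B" for r
    using that zero by (simp add: B_def linear_0[OF R(1)])
  have coreB: "\<exists>t>0. \<exists>r. (t *\<^sub>R h, r) \<in> B" for h
    using core[OF R(2)[of h]] by (simp add: B_def linear_scale[OF R(1)])
  \<comment> \<open>Difference quotients at 0 of the convex function with epigraph \<open>B\<close>;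
    its nonnegative value at 0 is replaced by 0.\<close>
  define S where "S h = {r / t | r t. t > 0 \<and> (t *\<^sub>R h, r) \<in> B}" for h
  define p where "p h = Inf (S h)" for h
  have SI: "r / t \<in> S h" if "t > 0" "(t *\<^sub>R h, r) \<in> B" for h r t
    using that by (auto simp: S_def)
  have ne: "S h \<noteq> {}" for h
    using coreB[of h] by (auto simp: S_def)
  have comb: "x + y \<in> S (h + k)" if "x \<in> S h" "y \<in> S k" for x y h k
  proof -
    obtain r t where t: "t > 0" "(t *\<^sub>R h, r) \<in> B" "x = r / t" using \<open>x \<in> S h\<close> by (auto simp: S_def)
    obtain r' s where s: "s > 0" "(s *\<^sub>R k, r') \<in> B" "y = r' / s" using \<open>y \<in> S k\<close> by (auto simp: S_def)
    \<comment> \<open>The weights are chosen so that \<open>h\<close> and \<open>k\<close> receive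
      the same factor s t / (s + t).\<close>
    have "(s / (s + t)) *\<^sub>R (t *\<^sub>R h, r) + (t / (s + t)) *\<^sub>R (s *\<^sub>R k, r') \<in> B"
      by (rule convexD[OF B t(2) s(2)]) (use t s in \<open>auto simp: add_divide_distrib[symmetric] add.commute\<close>)
    also have "(s / (s + t)) *\<^sub>R (t *\<^sub>R h, r) + (t / (s + t)) *\<^sub>R (s *\<^sub>R k, r') =
        ((s * t / (s + t)) *\<^sub>R (h + k), (s * r + t * r') / (s + t))"
      by (simp add: scaleR_add_right add_divide_distrib mult.commute)
    finally have "((s * r + t * r') / (s + t)) / (s * t / (s + t)) \<in> S (h + k)"
      by (intro SI) (use s t in auto)
    also have "((s * r + t * r') / (s + t)) / (s * t / (s + t)) = (s * r + t * r') / (s * t)"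
      by (rule divide_divide_times_eq[THEN trans]) (use s t in simp)
    also have "\<dots> = x + y" using s t by (simp add: field_simps)
    finally show ?thesis .
  qed
  have S0: "0 \<le> x" if "x \<in> S 0" for x
    using that zeroB by (auto simp: S_def)
  have bdd: "bdd_below (S h)" for h
  proof -
    obtain y where y: "y \<in> S (- h)" using ne by blast
    have "- y \<le> x" if "x \<in> S h" for x
      using S0[of "x + y"] comb[OF that y] by simp
    then show ?thesis by (rule bdd_belowI)
  qed
  have low: "p h \<le> x" if "x \<in> S h" for x h
    unfolding p_def by (rule cInf_lower[OF that bdd])
  have great: "c \<le> p h" if "\<And>x. x \<in> S h \<Longrightarrow> c \<le> x" for c h
    unfolding p_def by (rule cInf_greatest[OF ne that])
  have scl: "c * x \<in> S (c *\<^sub>R h)" if "x \<in> S h" "c > 0" for x h c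
  proof -
    obtain r t where t: "t > 0" "(t *\<^sub>R h, r) \<in> B" "x = r / t" using \<open>x \<in> S h\<close> by (auto simp: S_def)
    have "r / (t / c) \<in> S (c *\<^sub>R h)" using t \<open>c > 0\<close> by (intro SI) auto
    then show ?thesis using t by (simp add: mult.commute)
  qed
  have "sublinear p"
  proof (rule sublinearI)
    fix h k
    have "p (h + k) - x \<le> p k" if "x \<in> S h" for x
      by (rule great) (use low[OF comb[OF that]] in \<open>force simp: algebra_simps\<close>)
    then have "p (h + k) - p k \<le> p h" by (intro great) (force simp: algebra_simps)
    then show "p (h + k) \<le> p h + p k" by simp
  next
    \<comment> \<open>Halving an element of \<open>S 0\<close> stays in \<open>S 0\<close>, whence 2
      p(0) \<le> p(0) and so p(0) \<le> 0.\<close>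
    have "p 0 / (1/2) \<le> y" if "y \<in> S 0" for y
      using low[OF scl[OF that, of "1/2"]] by simp
    then have "p 0 / (1/2) \<le> p 0" by (rule great)
    moreover have "p 0 \<ge> 0" by (rule great) (rule S0)
    ultimately show "p 0 = 0" by simp
  next
    fix c :: real and h assume c: "0 < c"
    show "c * p h \<le> p (c *\<^sub>R h)"
    proof (rule great)
      fix x assume "x \<in> S (c *\<^sub>R h)"
      from low[OF scl[OF this, of "inverse c"]] c show "c * p h \<le> x" by (simp add: field_simps)
    qed
  qed
  then obtain F where F: "linear F" "\<And>x. F x \<le> p x"
    using sublinear_dominates_linear[of p] by auto
  have "F h \<le> r" if hr: "(h, r) \<in> A" for h r
  proof -
    have "(1 *\<^sub>R h, r) \<in> B" using hr R(3)[OF AU[OF hr]] by (simp add: B_def)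
    then have "p h \<le> r" using low[OF SI[of 1 h r]] by simp
    then show ?thesis using F(2)[of h] by simp
  qed
  then show ?thesis using F(1) by auto
qed

section \<open>Densities and the dual of \<open>L\<^sub>1\<close>\<close>

lemma integrable_imp_set_integrable:
  fixes f :: "'a \<Rightarrow> real"
  shows "integrable M f \<Longrightarrow> A \<in> sets M \<Longrightarrow> set_integrable M A f"
  unfolding set_integrable_def by (rule integrable_mult_indicator)

text \<open>Domination by the integral of \<open>k\<close> serves twice: it gives continuity at the
  empty set, which upgrades finite to countable additivity, and absolute continuity, so that the
  Radon-Nikodym theorem applies.\<close>

lemma finite_measure_eq_density_of_dominated:
  fixes \<nu> :: "'a set \<Rightarrow> real" and k :: "'a \<Rightarrow> real"
  assumes "sigma_finite_measure M" and k: "integrable M k"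
    and pos: "\<And>A. A \<in> sets M \<Longrightarrow> 0 \<le> \<nu> A"
    and add: "\<And>A B. A \<in> sets M \<Longrightarrow> B \<in> sets M \<Longrightarrow> A \<inter> B = {} \<Longrightarrow> \<nu> (A \<union> B) = \<nu> A + \<nu> B"
    and dom: "\<And>A. A \<in> sets M \<Longrightarrow> \<nu> A \<le> (LINT x:A|M. k x)"
  shows "\<exists>f. integrable M f \<and> (\<forall>A\<in>sets M. \<nu> A = (LINT x:A|M. f x))"
proof -
  interpret sigma_finite_measure M by fact
  have n0: "\<nu> {} = 0" using add[of "{}" "{}"] by simp
  define N where "N = measure_of (space M) (sets M) (\<lambda>A. ennreal (\<nu> A))"
  have posi: "positive (sets M) (\<lambda>A. ennreal (\<nu> A))" by (simp add: positive_def n0)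
  have addi: "Measure_Space.additive (sets M) (\<lambda>A. ennreal (\<nu> A))"
    by (auto simp: Measure_Space.additive_def add pos ennreal_plus[symmetric] simp del: ennreal_plus)
  have ca: "countably_additive (sets M) (\<lambda>A. ennreal (\<nu> A))"
  proof (rule sets.empty_continuous_imp_countably_additive[OF posi addi])
    show "\<forall>A\<in>sets M. ennreal (\<nu> A) \<noteq> \<infinity>" by simp
    fix A :: "nat \<Rightarrow> _ set" assume A: "range A \<subseteq> sets M" "decseq A" "(\<Inter>i. A i) = {}"
    have "(\<lambda>i. LINT x:A i|M. k x) \<longlonglongrightarrow> (LINT x:{}|M. k x)"
      unfolding set_lebesgue_integral_def
    proof (rule integral_dominated_convergence[where w="\<lambda>x. \<bar>k x\<bar>"])
      show "AE x in M. (\<lambda>i. indicat_real (A i) x *\<^sub>R k x) \<longlonglongrightarrow> indicat_real {} x *\<^sub>R k x"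
      proof (rule AE_I2)
        fix x
        have "(\<lambda>i. indicat_real (A i) x) \<longlonglongrightarrow> indicat_real {} x"
          using LIMSEQ_indicator_decseq[OF A(2), of x] A(3) by simp
        then show "(\<lambda>i. indicat_real (A i) x *\<^sub>R k x) \<longlonglongrightarrow> indicat_real {} x *\<^sub>R k x"
          by (intro tendsto_intros)
      qed
    qed (use k A(1) in \<open>auto simp: indicator_def intro!: borel_measurable_scaleR borel_measurable_indicator\<close>)
    then have lim: "(\<lambda>i. LINT x:A i|M. k x) \<longlonglongrightarrow> 0" by (simp add: set_lebesgue_integral_def)
    have "(\<lambda>i. \<nu> (A i)) \<longlonglongrightarrow> 0"
      by (rule tendsto_sandwich[OF _ _ tendsto_const lim]) (use A(1) pos dom in \<open>auto intro!: always_eventually\<close>)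
    then show "(\<lambda>i. ennreal (\<nu> (A i))) \<longlonglongrightarrow> 0"
      using tendsto_ennrealI by fastforce
  qed
  have sN: "sets N = sets M" "space N = space M" by (auto simp: N_def)
  have eN: "emeasure N A = ennreal (\<nu> A)" if "A \<in> sets M" for A
    unfolding N_def by (rule emeasure_measure_of_sigma)
      (use posi ca that in \<open>auto simp: sets.sigma_algebra_axioms\<close>)
  have "finite_measure N" by (rule finite_measureI) (simp add: sN eN)
  moreover have "absolutely_continuous M N"
    unfolding absolutely_continuous_def
  proof
    fix A assume A: "A \<in> null_sets M"
    then have "(LINT x:A|M. k x) = 0"
      unfolding set_lebesgue_integral_def
      by (intro integral_eq_zero_AE) (auto dest: AE_not_in elim: eventually_mono)
    with A pos[of A] dom[of A] have "\<nu> A = 0" by auto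
    then show "A \<in> null_sets N" using A by (auto simp: null_sets_def eN sN)
  qed
  ultimately obtain f where f: "f \<in> borel_measurable M" "density M f = N"
    using Radon_Nikodym[of N] sN(1) by auto
  have ef: "(\<integral>\<^sup>+x\<in>A. f x \<partial>M) = ennreal (\<nu> A)" if "A \<in> sets M" for A
    using that f eN[OF that] by (metis emeasure_density)
  have "(\<integral>\<^sup>+x. f x \<partial>M) = ennreal (\<nu> (space M))"
    using ef[of "space M"] by (simp add: nn_integral_cong[of M "\<lambda>x. f x * indicator (space M) x" f])
  then have fin: "(\<integral>\<^sup>+x. f x \<partial>M) < \<infinity>" by simp
  have ff: "AE x in M. f x = ennreal (enn2real (f x))"
    using nn_integral_PInf_AE[OF f(1)] fin by (auto elim!: eventually_mono simp: less_top)
  have int: "integrable M (\<lambda>x. enn2real (f x))"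
  proof (rule integrableI_nonneg)
    have "(\<integral>\<^sup>+x. ennreal (enn2real (f x)) \<partial>M) = (\<integral>\<^sup>+x. f x \<partial>M)"
      by (rule nn_integral_cong_AE) (use ff in \<open>auto elim: eventually_mono\<close>)
    then show "(\<integral>\<^sup>+x. ennreal (enn2real (f x)) \<partial>M) < \<infinity>" using fin by simp
  qed (use f in auto)
  have "\<nu> A = (LINT x:A|M. enn2real (f x))" if A: "A \<in> sets M" for A
  proof -
    have "ennreal (LINT x:A|M. enn2real (f x)) = (\<integral>\<^sup>+x. ennreal (indicat_real A x *\<^sub>R enn2real (f x)) \<partial>M)"
      unfolding set_lebesgue_integral_def using int A
      by (intro nn_integral_eq_integral[symmetric] integrable_mult_indicator) auto
    also have "\<dots> = (\<integral>\<^sup>+x\<in>A. f x \<partial>M)"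
      by (rule nn_integral_cong_AE) (use ff in \<open>auto simp: indicator_def elim: eventually_mono\<close>)
    finally have "ennreal (LINT x:A|M. enn2real (f x)) = ennreal (\<nu> A)" using ef[OF A] by simp
    moreover have "(LINT x:A|M. enn2real (f x)) \<ge> 0"
      unfolding set_lebesgue_integral_def by (rule integral_nonneg_AE) auto
    ultimately show ?thesis using pos[OF A] by simp
  qed
  then show ?thesis using int by blast
qed

text \<open>Adding the integral of \<open>k\<close> makes the set function nonnegative and at most
  the integral of 2 k; subtracting \<open>k\<close> from the resulting density undoes the
  shift.\<close>

theorem dominated_additive_has_density:
  fixes \<nu> :: "'a set \<Rightarrow> real" and k :: "'a \<Rightarrow> real"
  assumes M: "sigma_finite_measure M" and k: "integrable M k"
    and add: "\<And>A B. A \<in> sets M \<Longrightarrow> B \<in> sets M \<Longrightarrow> A \<inter> B = {} \<Longrightarrow> \<nu> (A \<union> B) = \<nu> A + \<nu> B"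
    and dom: "\<And>A. A \<in> sets M \<Longrightarrow> \<bar>\<nu> A\<bar> \<le> (LINT x:A|M. k x)"
  shows "\<exists>f. integrable M f \<and> (\<forall>A\<in>sets M. \<nu> A = (LINT x:A|M. f x))"
proof -
  let ?K = "\<lambda>A. LINT x:A|M. k x"
  have ki: "set_integrable M A k" if "A \<in> sets M" for A
    using k that by (rule integrable_imp_set_integrable)
  have Kadd: "?K (A \<union> B) = ?K A + ?K B" if "A \<in> sets M" "B \<in> sets M" "A \<inter> B = {}" for A B
    using that ki by (intro set_integral_Un) auto
  have "\<exists>f. integrable M f \<and> (\<forall>A\<in>sets M. \<nu> A + ?K A = (LINT x:A|M. f x))"
  proof (rule finite_measure_eq_density_of_dominated[OF M, where k="\<lambda>x. 2 * k x"])
    show "integrable M (\<lambda>x. 2 * k x)" using k by simp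
    show "0 \<le> \<nu> A + ?K A" "\<nu> A + ?K A \<le> (LINT x:A|M. 2 * k x)" if "A \<in> sets M" for A
      using dom[OF that] by auto
    show "\<nu> (A \<union> B) + ?K (A \<union> B) = (\<nu> A + ?K A) + (\<nu> B + ?K B)"
      if "A \<in> sets M" "B \<in> sets M" "A \<inter> B = {}" for A B
      using add[OF that] Kadd[OF that] by simp
  qed
  then obtain f where f: "integrable M f" "\<And>A. A \<in> sets M \<Longrightarrow> \<nu> A + ?K A = (LINT x:A|M. f x)"
    by blast
  have fi: "set_integrable M A f" if "A \<in> sets M" for A
    using f(1) that by (rule integrable_imp_set_integrable)
  have "\<nu> A = (LINT x:A|M. f x - k x)" if "A \<in> sets M" for A
    using f(2)[OF that] ki[OF that] fi[OF that] by simp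
  then show ?thesis using f(1) k by (intro exI[of _ "\<lambda>x. f x - k x"]) auto
qed

lemma AE_le_if_set_integral_le:
  fixes f h :: "'a \<Rightarrow> real"
  assumes "sigma_finite_measure M" and f: "integrable M f" and h: "integrable M h"
    and le: "\<And>A. A \<in> sets M \<Longrightarrow> (LINT x:A|M. f x) \<le> (LINT x:A|M. h x)"
  shows "AE x in M. f x \<le> h x"
proof -
  interpret sigma_finite_measure M by fact
  have "AE x in M. h x - f x \<ge> 0"
  proof (rule density_nonneg)
    show "0 \<le> (LINT x:A|M. h x - f x)" if "A \<in> sets M" for A
      using le[OF that] f h that
      by (subst set_integral_diff) (auto intro: integrable_imp_set_integrable)
  qed (use f h in simp)
  then show ?thesis by simp
qed

text \<open>The values on indicators form a set function dominated by a multiple of the measure,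
  whose density represents \<open>F\<close> on simple functions; the bound on \<open>F\<close>
  carries this to limits in L1.\<close>

theorem L1_functional_has_density:
  fixes F :: "('a \<Rightarrow> real) \<Rightarrow> real"
  assumes "finite_measure M"
    and add: "\<And>u v. integrable M u \<Longrightarrow> integrable M v \<Longrightarrow> F (\<lambda>x. u x + v x) = F u + F v"
    and scale: "\<And>c u. integrable M u \<Longrightarrow> F (\<lambda>x. c * u x) = c * F u"
    and bound: "\<And>u. integrable M u \<Longrightarrow> \<bar>F u\<bar> \<le> K * (LINT x|M. \<bar>u x\<bar>)"
  shows "\<exists>f. f \<in> borel_measurable M \<and> (\<forall>x. \<bar>f x\<bar> \<le> \<bar>K\<bar>) \<and>
    (\<forall>u. integrable M u \<longrightarrow> F u = (LINT x|M. f x * u x))"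
proof -
  interpret finite_measure M by fact
  define \<nu> where "\<nu> A = F (indicat_real A)" for A
  have ind: "integrable M (indicat_real A)" if "A \<in> sets M" for A
    using that by (auto intro!: finite_measure.integrable_const_bound[where B=1] simp: finite_measure_axioms)
  have "\<exists>f. integrable M f \<and> (\<forall>A\<in>sets M. \<nu> A = (LINT x:A|M. f x))"
  proof (rule dominated_additive_has_density[where k="\<lambda>x. K"])
    show "\<nu> (A \<union> B) = \<nu> A + \<nu> B" if "A \<in> sets M" "B \<in> sets M" "A \<inter> B = {}" for A B
    proof -
      have "indicat_real (A \<union> B) = (\<lambda>x. indicat_real A x + indicat_real B x)"
        using that by (auto simp: fun_eq_iff indicator_def)
      then show ?thesis using add[OF ind ind, of A B] that by (simp add: \<nu>_def)
    qed
    show "\<bar>\<nu> A\<bar> \<le> (LINT x:A|M. K)" if "A \<in> sets M" for A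
      using bound[OF ind[OF that]] that by (simp add: \<nu>_def set_lebesgue_integral_def mult.commute)
  qed (auto simp: sigma_finite_measure_axioms)
  then obtain f where f: "integrable M f" "\<And>A. A \<in> sets M \<Longrightarrow> \<nu> A = (LINT x:A|M. f x)"
    by blast
  have fi: "set_integrable M A f" if "A \<in> sets M" for A
    using f(1) that by (rule integrable_imp_set_integrable)
  have dom: "\<bar>LINT x:A|M. f x\<bar> \<le> (LINT x:A|M. \<bar>K\<bar>)" if "A \<in> sets M" for A
  proof -
    have "\<bar>\<nu> A\<bar> \<le> K * measure M A"
      using bound[OF ind[OF that]] that by (simp add: \<nu>_def)
    also have "\<dots> \<le> \<bar>K\<bar> * measure M A" by (intro mult_right_mono) auto
    finally show ?thesis using f(2)[OF that] that by (simp add: set_integral_const mult.commute)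
  qed
  have up: "AE x in M. f x \<le> \<bar>K\<bar>"
    using f(1) dom by (intro AE_le_if_set_integral_le) (auto simp: abs_le_iff sigma_finite_measure_axioms)
  have lo: "AE x in M. - \<bar>K\<bar> \<le> f x"
    using f(1) dom by (intro AE_le_if_set_integral_le)
      (force simp: abs_le_iff sigma_finite_measure_axioms set_lebesgue_integral_def)+
  \<comment> \<open>The bound holds almost everywhere for \<open>f\<close>; truncation makes it hold
    everywhere.\<close>
  define f' where "f' x = max (- \<bar>K\<bar>) (min \<bar>K\<bar> (f x))" for x
  have f'm: "f' \<in> borel_measurable M" using f(1) unfolding f'_def by measurable
  have f'b: "\<bar>f' x\<bar> \<le> \<bar>K\<bar>" for x by (auto simp: f'_def)
  have ff': "AE x in M. f x = f' x" using up lo by eventually_elim (auto simp: f'_def)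
  have f'i: "integrable M (\<lambda>x. f' x * u x)" if "integrable M u" for u
    by (rule Bochner_Integration.integrable_bound[where f="\<lambda>x. \<bar>K\<bar> * u x"])
      (use that f'm f'b in \<open>auto simp: abs_mult intro!: mult_right_mono\<close>)
  have "F u = (LINT x|M. f' x * u x)" if "integrable M u" for u
    using that
  proof (induct u rule: integrable_induct)
    case (base A c)
    have "F (\<lambda>x. c * indicat_real A x) = c * \<nu> A"
      unfolding \<nu>_def by (rule scale) (use base ind in auto)
    also have "\<dots> = c * (LINT x:A|M. f' x)"
      using f(2)[OF base(1)] ff' f(1) f'm base
      by (auto simp: set_lebesgue_integral_def intro!: integral_cong_AE elim: eventually_mono)
    also have "\<dots> = (LINT x|M. f' x * (c * indicat_real A x))"
      by (simp add: set_lebesgue_integral_def mult_ac flip: integral_mult_right_zero)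
    finally show ?case by (simp add: mult.commute)
  next
    case (add u v)
    then show ?case using f'i by (simp add: assms(2) distrib_left)
  next
    case (lim u s)
    have li: "integrable M (\<lambda>x. s i x - u x)" for i using lim by auto
    \<comment> \<open>The approximating functions satisfy \<bar>s i\<bar> \<le> 2 \<bar>u\<bar>,
      which explains the majorant 3 \<bar>u\<bar>.\<close>
    have conv0: "(\<lambda>i. LINT x|M. \<bar>s i x - u x\<bar>) \<longlonglongrightarrow> (LINT x|M. 0)"
    proof (rule integral_dominated_convergence[where w="\<lambda>x. 3 * \<bar>u x\<bar>"])
      show "AE x in M. (\<lambda>i. \<bar>s i x - u x\<bar>) \<longlonglongrightarrow> 0"
        using lim(3) by (auto intro!: AE_I2 tendsto_rabs_zero LIM_zero)
      show "AE x in M. norm \<bar>s i x - u x\<bar> \<le> 3 * \<bar>u x\<bar>" for i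
        using lim(4)[of _ i] by (intro AE_I2) (fastforce simp: abs_le_iff)
    qed (use lim in auto)
    have sm: "F (s i) - F u = F (\<lambda>x. s i x - u x)" for i
      using assms(2)[OF li[of i] lim(5)] by simp
    have "(\<lambda>i. F (s i) - F u) \<longlonglongrightarrow> 0"
    proof (rule Lim_null_comparison)
      show "\<forall>\<^sub>F i in sequentially. norm (F (s i) - F u) \<le> K * (LINT x|M. \<bar>s i x - u x\<bar>)"
        using sm bound[OF li] by simp
      show "(\<lambda>i. K * (LINT x|M. \<bar>s i x - u x\<bar>)) \<longlonglongrightarrow> 0"
        using tendsto_mult_left[OF conv0, of K] by simp
    qed
    then have 1: "(\<lambda>i. F (s i)) \<longlonglongrightarrow> F u" by (rule LIM_zero_cancel)
    have 2: "(\<lambda>i. LINT x|M. f' x * s i x) \<longlonglongrightarrow> (LINT x|M. f' x * u x)"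
    proof (rule integral_dominated_convergence[where w="\<lambda>x. \<bar>K\<bar> * (2 * \<bar>u x\<bar>)"])
      show "AE x in M. (\<lambda>i. f' x * s i x) \<longlonglongrightarrow> f' x * u x"
        using lim(3) by (auto intro!: AE_I2 tendsto_mult_left)
      show "AE x in M. norm (f' x * s i x) \<le> \<bar>K\<bar> * (2 * \<bar>u x\<bar>)" for i
        using lim(4)[of _ i] f'b by (intro AE_I2) (auto simp: abs_mult intro!: mult_mono)
    qed (use lim f'm in auto)
    show ?case using LIMSEQ_unique[OF 1] 2 lim(2) by simp
  qed
  then show ?thesis using f'm f'b by blast
qed

section \<open>Positive functionals on a compact interval\<close>

lemma continuous_on_interval_bounded:
  fixes f :: "real \<Rightarrow> real"
  assumes "continuous_on {a..b} f"
  obtains B where "\<And>x. x \<in> {a..b} \<Longrightarrow> \<bar>f x\<bar> \<le> B"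
proof -
  have "compact (f ` {a..b})" using assms by (intro compact_continuous_image) auto
  then show ?thesis using that by (force simp: bounded_iff dest: compact_imp_bounded)
qed

lemma prob_measure_onD:
  assumes "prob_measure_on a b \<mu>"
  shows "prob_space \<mu>" and "sets \<mu> = sets borel" and "AE p in \<mu>. p \<in> {a..b}"
  using assms by (auto simp: prob_measure_on_def prob_space.prob_eq_1)

text \<open>The functional \<open>L\<close> is evaluated on Bernstein polynomials, which gives
  discrete measures \<open>\<mu>\<^sub>n\<close> with \<open>\<integral> f d\<mu>\<^sub>n = L (B\<^sub>n f)\<close>; a weak limit of them
  represents \<open>L\<close>.\<close>

theorem Riesz_representation_interval:
  fixes L :: "(real \<Rightarrow> real) \<Rightarrow> real" and a b :: real
  assumes ab: "a \<le> b"
    and add: "\<And>f h. continuous_on UNIV f \<Longrightarrow> continuous_on UNIV h \<Longrightarrow> L (\<lambda>x. f x + h x) = L f + L h"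
    and scale: "\<And>c f. continuous_on UNIV f \<Longrightarrow> L (\<lambda>x. c * f x) = c * L f"
    and pos: "\<And>f. continuous_on UNIV f \<Longrightarrow> (\<And>x. x \<in> {a..b} \<Longrightarrow> 0 \<le> f x) \<Longrightarrow> 0 \<le> L f"
    and one: "L (\<lambda>x. 1) = 1"
  shows "\<exists>\<mu>. prob_measure_on a b \<mu> \<and> (\<forall>f. continuous_on UNIV f \<longrightarrow> L f = (LINT x|\<mu>. f x))"
proof -
  have diff: "L (\<lambda>x. f x - h x) = L f - L h" if "continuous_on UNIV f" "continuous_on UNIV h" for f h
    using add[OF that(1), of "\<lambda>x. -1 * h x"] scale[OF that(2), of "-1"] that
    by (auto simp: continuous_on_minus)
  have mono: "L f \<le> L h" if "continuous_on UNIV f" "continuous_on UNIV h" "\<And>x. x \<in> {a..b} \<Longrightarrow> f x \<le> h x" for f h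
    using diff[OF that(2,1)] pos[of "\<lambda>x. h x - f x"] that by (auto intro!: continuous_intros)
  have cong: "L f = L h" if "continuous_on UNIV f" "continuous_on UNIV h" "\<And>x. x \<in> {a..b} \<Longrightarrow> f x = h x" for f h
    by (rule antisym) (use that in \<open>auto intro: mono\<close>)
  have const: "L (\<lambda>x. c) = c" for c
    using scale[of "\<lambda>x. 1" c] one by simp
  have bound: "\<bar>L f\<bar> \<le> e" if "continuous_on UNIV f" "\<And>x. x \<in> {a..b} \<Longrightarrow> \<bar>f x\<bar> \<le> e" for f e
  proof -
    have "L f \<le> L (\<lambda>x. e)" "L (\<lambda>x. - e) \<le> L f"
      by (rule mono; use that in \<open>force simp: abs_le_iff\<close>)+
    then show ?thesis using const[of e] const[of "- e"] by simp
  qed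
  have sum: "L (\<lambda>x. \<Sum>k\<in>I. c k * f k x) = (\<Sum>k\<in>I. c k * L (f k))"
    if "finite I" "\<And>k. k \<in> I \<Longrightarrow> continuous_on UNIV (f k)" for I :: "nat set" and c f
    using that
  proof (induct I)
    case empty
    then show ?case using const[of 0] by simp
  next
    case (insert i I)
    then have "L (\<lambda>x. c i * f i x + (\<Sum>k\<in>I. c k * f k x)) = c i * L (f i) + (\<Sum>k\<in>I. c k * L (f k))"
      by (subst add) (auto intro!: continuous_intros simp: scale)
    then show ?case using insert by simp
  qed
  \<comment> \<open>The affine map of the interval onto [0, 1], clamped outside. If a = b, division
    by zero makes it constantly 0.\<close>
  define t where "t x = max 0 (min 1 ((x - a) / (b - a)))" for x
  have t_cont: "continuous_on UNIV t"
  proof (cases "a = b")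
    case True
    then show ?thesis by (simp add: t_def[abs_def])
  next
    case False
    then show ?thesis unfolding t_def[abs_def] by (intro continuous_intros) auto
  qed
  have t01: "t x \<in> {0..1}" for x by (auto simp: t_def)
  have t_inv: "a + (b - a) * t x = x" if "x \<in> {a..b}" for x
    using that ab by (cases "a = b") (auto simp: t_def field_simps min_def max_def)
  \<comment> \<open>Positivity of \<open>L\<close> and the partition of unity by Bernstein
    polynomials make these the weights of a probability measure.\<close>
  define w where "w n k = L (\<lambda>x. Bernstein n k (t x))" for n k
  have Bc: "continuous_on UNIV (\<lambda>x. Bernstein n k (t x))" for n k
    unfolding Bernstein_def by (intro continuous_intros t_cont)
  have w0: "w n k \<ge> 0" for n k
    unfolding w_def using t01 by (intro pos Bc) (auto intro: Bernstein_nonneg)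
  have w1: "(\<Sum>k\<le>n. w n k) = 1" for n
    using sum[of "{..n}" "\<lambda>k x. Bernstein n k (t x)" "\<lambda>k. 1"] Bc one by (simp add: w_def)
  define y where "y n k = a + (b - a) * (real k / real n)" for n k :: nat
  define PM where "PM n = point_measure {..n} (\<lambda>k. ennreal (w n k))" for n :: nat
  define \<mu> where "\<mu> n = distr (PM n) borel (y n)" for n
  have PMm: "f \<in> measurable (PM n) borel" for f :: "nat \<Rightarrow> real" and n
    by (simp add: PM_def measurable_def space_point_measure sets_point_measure)
  have PMp: "prob_space (PM n)" for n
    by (rule prob_spaceI) (simp add: PM_def space_point_measure emeasure_point_measure_finite w0 w1)
  have \<mu>p: "real_distribution (\<mu> n)" for n
    unfolding \<mu>_def real_distribution_def real_distribution_axioms_def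
    using prob_space.prob_space_distr[OF PMp PMm] by simp
  have \<mu>int: "(LINT x|\<mu> n. f x) = (\<Sum>k\<le>n. w n k * f (y n k))" if "continuous_on UNIV f" for f n
  proof -
    have "(LINT x|\<mu> n. f x) = (LINT k|PM n. f (y n k))"
      unfolding \<mu>_def by (rule integral_distr[OF PMm]) (use that in \<open>rule borel_measurable_continuous_onI\<close>)
    then show ?thesis
      unfolding PM_def by (subst (asm) lebesgue_integral_point_measure_finite) (auto simp: w0)
  qed
  have conv: "(\<lambda>n. LINT x|\<mu> n. f x) \<longlonglongrightarrow> L f" if f: "continuous_on UNIV f" for f
  proof (rule LIMSEQ_I)
    fix e :: real assume e: "0 < e"
    have "continuous_on {0..1} (\<lambda>u. f (a + (b - a) * u))"
      by (rule continuous_on_compose2[OF f]) (auto intro!: continuous_intros)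
    from Bernstein_Weierstrass[OF this, of "e/2"] e obtain N where
      N: "\<And>n x. N \<le> n \<Longrightarrow> x \<in> {0..1} \<Longrightarrow>
        \<bar>f (a + (b - a) * x) - (\<Sum>k\<le>n. f (a + (b - a) * (k / n)) * Bernstein n k x)\<bar> < e/2"
      by auto
    have "norm ((LINT x|\<mu> n. f x) - L f) < e" if n: "N \<le> n" for n
    proof -
      let ?P = "\<lambda>x. \<Sum>k\<le>n. f (y n k) * Bernstein n k (t x)"
      have Pc: "continuous_on UNIV ?P" using Bc by (intro continuous_intros)
      have "L ?P = (LINT x|\<mu> n. f x)"
        unfolding \<mu>int[OF f] by (subst sum) (auto simp: Bc w_def mult.commute)
      moreover have "\<bar>L (\<lambda>x. ?P x - f x)\<bar> \<le> e/2"
      proof (rule bound)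
        fix x assume x: "x \<in> {a..b}"
        show "\<bar>?P x - f x\<bar> \<le> e/2"
          using N[OF n t01[of x]] unfolding t_inv[OF x] y_def by (simp add: abs_minus_commute)
      qed (intro continuous_intros Pc f)
      ultimately show ?thesis using diff[OF Pc f] e by simp
    qed
    then show "\<exists>N. \<forall>n\<ge>N. norm ((LINT x|\<mu> n. f x) - L f) < e" by blast
  qed
  have yab: "y n k \<in> {a..b}" if "k \<le> n" for n k
  proof -
    have u: "real k / real n \<le> 1" "0 \<le> real k / real n" using that by (auto simp: divide_le_eq)
    have "(b - a) * (real k / real n) \<le> (b - a) * 1" using u ab by (intro mult_left_mono) auto
    then show ?thesis using u ab by (auto simp: y_def)
  qed
  have "tight \<mu>"
    unfolding tight_def
  proof (intro conjI allI impI \<mu>p)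
    fix e :: real assume "e > 0"
    \<comment> \<open>All atoms lie in [a, b]; tightness is phrased with half-open intervals, hence
      the left end a - 1.\<close>
    have "measure (\<mu> n) {a-1<..b} = 1" for n
    proof -
      have "measure (\<mu> n) {a-1<..b} = measure (PM n) (y n -` {a-1<..b} \<inter> space (PM n))"
        unfolding \<mu>_def by (rule measure_distr[OF PMm]) simp
      also have "y n -` {a-1<..b} \<inter> space (PM n) = space (PM n)"
        using yab by (force simp: PM_def space_point_measure)
      finally show ?thesis using prob_space.prob_space[OF PMp] by simp
    qed
    then show "\<exists>a b. a < b \<and> (\<forall>n. 1 - e < measure (\<mu> n) {a<..b})"
      using ab \<open>e > 0\<close> by (intro exI[of _ "a - 1"] exI[of _ b]) auto
  qed
  from tight_imp_convergent_subsubsequence[OF this strict_mono_id]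
  obtain r \<nu> where r: "strict_mono r" and \<nu>: "real_distribution \<nu>" and wc: "weak_conv_m (\<mu> \<circ> r) \<nu>"
    by auto
  interpret \<nu>: real_distribution \<nu> by (rule \<nu>)
  have rep: "L f = (LINT x|\<nu>. f x)" if f: "continuous_on UNIV f" and B: "\<And>x. \<bar>f x\<bar> \<le> B" for f B
  proof -
    have "(\<lambda>n. LINT x|(\<mu> \<circ> r) n. f x) \<longlonglongrightarrow> (LINT x|\<nu>. f x)"
      by (rule weak_conv_imp_integral_bdd_continuous_conv[OF _ \<nu> wc, where B=B])
        (use f B \<mu>p in \<open>auto simp: continuous_on_eq_continuous_at\<close>)
    moreover have "(\<lambda>n. LINT x|(\<mu> \<circ> r) n. f x) \<longlonglongrightarrow> L f"
      using LIMSEQ_subseq_LIMSEQ[OF conv[OF f] r] by (simp add: o_def)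
    ultimately show ?thesis using LIMSEQ_unique by blast
  qed
  let ?c = "\<lambda>x. max a (min b x)"
  have ae: "AE x in \<nu>. x \<in> {a..b}"
  proof -
    \<comment> \<open>The distance to [a, b], cut off at 1 because \<open>rep\<close> is so far
      available for bounded functions only. It vanishes on [a, b], so \<open>L\<close> annihilates
      it and the limit measure lives on [a, b].\<close>
    let ?d = "\<lambda>x. min 1 \<bar>x - ?c x\<bar>"
    have dc: "continuous_on UNIV ?d" by (intro continuous_intros)
    have "L ?d = L (\<lambda>x. 0)" by (rule cong[OF dc]) auto
    then have "(LINT x|\<nu>. ?d x) = 0" using rep[OF dc, of 1] const[of 0] by auto
    moreover have "integrable \<nu> ?d"
      using borel_measurable_continuous_onI[OF dc] by (intro \<nu>.integrable_const_bound[where B=1]) auto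
    ultimately have "AE x in \<nu>. ?d x = 0"
      by (subst (asm) integral_nonneg_eq_0_iff_AE) auto
    then show ?thesis by eventually_elim (use ab in \<open>auto simp: min_def max_def split: if_splits\<close>)
  qed
  have "prob_measure_on a b \<nu>"
    unfolding prob_measure_on_def using \<nu>.prob_space_axioms ae ab by (simp add: \<nu>.prob_eq_1)
  moreover have "L f = (LINT x|\<nu>. f x)" if f: "continuous_on UNIV f" for f
  proof -
    \<comment> \<open>A continuous function on the line may be unbounded; clamping its argument to
      [a, b] makes it bounded and changes neither side.\<close>
    have fc: "continuous_on UNIV (\<lambda>x. f (?c x))"
      by (rule continuous_on_compose2[OF f]) (auto intro!: continuous_intros)
    obtain B where "\<And>x. x \<in> {a..b} \<Longrightarrow> \<bar>f x\<bar> \<le> B"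
      using continuous_on_interval_bounded[OF continuous_on_subset[OF f subset_UNIV]] by blast
    then have B: "\<bar>f (?c x)\<bar> \<le> B" for x using ab by auto
    have "L f = L (\<lambda>x. f (?c x))" by (rule cong[OF f fc]) auto
    also have "\<dots> = (LINT x|\<nu>. f (?c x))" by (rule rep[OF fc B])
    also have "\<dots> = (LINT x|\<nu>. f x)"
      by (rule integral_cong_AE)
        (use ae borel_measurable_continuous_onI[OF f] borel_measurable_continuous_onI[OF fc] in
          \<open>auto elim: eventually_mono\<close>)
    finally show ?thesis .
  qed
  ultimately show ?thesis by blast
qed

section \<open>The integrated quantile function\<close>

context prob_space
begin

text \<open>Under Lebesgue measure on (0, 1) the quantile function has the same distribution as
  \<open>Z\<close>.\<close>

lemma quantile_transform:
  fixes f :: "real \<Rightarrow> real"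
  assumes Z: "Z \<in> borel_measurable M" and f: "f \<in> borel_measurable borel"
    and i: "integrable M (\<lambda>w. f (Z w))"
  shows "set_integrable lborel {0<..<1} (\<lambda>t. f (quantile M Z t))"
    and "(LINT w|M. f (Z w)) = (LINT t:{0<..<1}|lborel. f (quantile M Z t))"
proof -
  interpret D: cdf_distribution "distr M borel Z"
    unfolding cdf_distribution_def using Z by simp
  have q: "quantile M Z = D.I" by (rule ext) (simp only: quantile_def)
  have qm: "D.I \<in> measurable (restrict_space lborel {0<..<1}) borel"
    using D.measurable_CI by (simp cong: measurable_cong_sets sets_restrict_space_cong)
  have "integrable (distr M borel Z) f"
    using i f Z by (simp add: integrable_distr_eq)
  then have "integrable (distr (restrict_space lborel {0<..<1}) borel D.I) f"
    by (simp add: D.distr_I_eq_M)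
  then have "integrable (restrict_space lborel {0<..<1}) (\<lambda>t. f (D.I t))"
    by (rule integrable_distr[OF qm])
  then show "set_integrable lborel {0<..<1} (\<lambda>t. f (quantile M Z t))"
    unfolding set_integrable_def q by (simp add: integrable_restrict_space)
  have "(LINT w|M. f (Z w)) = integral\<^sup>L (distr M borel Z) f"
    by (rule integral_distr[symmetric]) (use f Z in auto)
  also have "\<dots> = integral\<^sup>L (distr (restrict_space lborel {0<..<1}) borel D.I) f"
    by (simp add: D.distr_I_eq_M)
  also have "\<dots> = (LINT t|restrict_space lborel {0<..<1}. f (D.I t))"
    by (rule integral_distr) (use qm f in auto)
  also have "\<dots> = (LINT t:{0<..<1}|lborel. f (quantile M Z t))"
    unfolding set_lebesgue_integral_def q by (simp add: integral_restrict_space)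
  finally show "(LINT w|M. f (Z w)) = (LINT t:{0<..<1}|lborel. f (quantile M Z t))" .
qed

lemma quantile_mono:
  assumes Z: "Z \<in> borel_measurable M" and "0 < s" "s \<le> t" "t < 1"
  shows "quantile M Z s \<le> quantile M Z t"
proof -
  interpret D: cdf_distribution "distr M borel Z"
    unfolding cdf_distribution_def using Z by simp
  have q: "quantile M Z = D.I" by (rule ext) (simp only: quantile_def)
  show ?thesis unfolding q by (rule mono_onD[OF D.mono_I]) (use assms(2-4) in simp_all)
qed

lemma set_integrable_quantile:
  assumes "integrable M Z"
  shows "set_integrable lborel {0<..<1} (quantile M Z)"
  by (rule quantile_transform(1)[where f="\<lambda>x. x"]) (use assms in auto)

lemma set_integrable_quantile':
  assumes "integrable M Z" "p \<le> 1"
  shows "set_integrable lborel {0<..<p} (quantile M Z)"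
  by (rule set_integrable_subset[OF set_integrable_quantile]) (use assms in auto)

lemma integrable_shortfall:
  fixes Z :: "'a \<Rightarrow> real"
  shows "integrable M Z \<Longrightarrow> integrable M (\<lambda>w. max 0 (\<eta> - Z w))"
  by (rule Bochner_Integration.integrable_bound[of M "\<lambda>w. \<bar>\<eta>\<bar> + \<bar>Z w\<bar>"]) auto

text \<open>In terms of the quantile function q, the difference \<eta> p - \<integral> q over (0, p)
  is the integral of \<eta> - q there, and replacing the integrand by its positive part on all of
  (0, 1) only increases it.\<close>

lemma int_quantile_ge:
  assumes Z: "integrable M Z" and p: "0 \<le> p" "p \<le> 1"
  shows "\<eta> * p - (LINT w|M. max 0 (\<eta> - Z w)) \<le> int_quantile M Z p"
proof (cases "p = 0")
  case True
  then show ?thesis by (simp add: int_quantile_def)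
next
  case False
  let ?q = "quantile M Z"
  have c: "set_integrable lborel {0<..<p} (\<lambda>t. \<eta>)" using p by (simp add: set_integrable_def)
  have qi: "set_integrable lborel {0<..<p} ?q" by (rule set_integrable_quantile') (use assms in auto)
  have m: "set_integrable lborel {0<..<1} (\<lambda>t. max 0 (\<eta> - ?q t))"
    and e: "(LINT w|M. max 0 (\<eta> - Z w)) = (LINT t:{0<..<1}|lborel. max 0 (\<eta> - ?q t))"
    by (rule quantile_transform[where f="\<lambda>x. max 0 (\<eta> - x)"]; use Z integrable_shortfall[OF Z] in auto)+
  have "\<eta> * p - int_quantile M Z p = (LINT t:{0<..<p}|lborel. \<eta> - ?q t)"
    using False p c qi by (simp add: int_quantile_def set_integral_diff set_integral_const)
  also have "\<dots> \<le> (LINT t:{0<..<p}|lborel. max 0 (\<eta> - ?q t))"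
    by (rule set_integral_mono)
      (use c qi p in \<open>auto intro: set_integrable_subset[OF m]\<close>)
  also have "\<dots> \<le> (LINT t:{0<..<1}|lborel. max 0 (\<eta> - ?q t))"
  proof -
    have sub: "set_integrable lborel {0<..<p} (\<lambda>t. max 0 (\<eta> - ?q t))"
      by (rule set_integrable_subset[OF m]) (use p in auto)
    show ?thesis
      unfolding set_lebesgue_integral_def
      by (rule integral_mono) (use p m sub in \<open>auto simp: set_integrable_def indicator_def\<close>)
  qed
  finally show ?thesis using e by simp
qed

lemma int_quantile_1:
  assumes "integrable M Z"
  shows "int_quantile M Z 1 = (LINT w|M. Z w)"
proof -
  have "(LINT w|M. Z w) = (LINT t:{0<..<1}|lborel. quantile M Z t)"
    by (rule quantile_transform(2)[where f="\<lambda>x. x"]) (use assms in auto)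
  then show ?thesis by (simp add: int_quantile_def)
qed

text \<open>For p < 1 the quantile at p is an exact maximizer. For p = 1 the expression equals E
  min(\<eta>, Z), whose supremum is not attained if \<open>Z\<close> is unbounded above; hence the
  \<epsilon>, with \<eta> a large integer.\<close>

lemma int_quantile_le_approx:
  assumes Z: "integrable M Z" and p: "0 < p" "p \<le> 1" and e: "0 < \<epsilon>"
  shows "\<exists>\<eta>. int_quantile M Z p \<le> \<eta> * p - (LINT w|M. max 0 (\<eta> - Z w)) + \<epsilon>"
proof (cases "p < 1")
  case True
  let ?q = "quantile M Z"
  define \<eta> where "\<eta> = ?q p"
  have c: "set_integrable lborel {0<..<p} (\<lambda>t. \<eta>)" using p by (simp add: set_integrable_def)
  have qi: "set_integrable lborel {0<..<p} ?q" by (rule set_integrable_quantile') (use assms in auto)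
  have "(LINT w|M. max 0 (\<eta> - Z w)) = (LINT t:{0<..<1}|lborel. max 0 (\<eta> - ?q t))"
    by (rule quantile_transform(2)[where f="\<lambda>x. max 0 (\<eta> - x)"]) (use Z integrable_shortfall[OF Z] in auto)
  also have "\<dots> = (LINT t:{0<..<p}|lborel. \<eta> - ?q t)"
    unfolding set_lebesgue_integral_def
  proof (rule Bochner_Integration.integral_cong)
    fix t
    have "?q t \<le> \<eta>" if "0 < t" "t < p" using quantile_mono[of Z t p] that Z True by (simp add: \<eta>_def)
    moreover have "\<eta> \<le> ?q t" if "p \<le> t" "t < 1" using quantile_mono[of Z p t] that Z p by (simp add: \<eta>_def)
    ultimately show "indicat_real {0<..<1} t *\<^sub>R max 0 (\<eta> - ?q t) = indicat_real {0<..<p} t *\<^sub>R (\<eta> - ?q t)"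
      using p True by (cases "t < p") (simp_all add: indicator_def)
  qed simp
  also have "\<dots> = \<eta> * p - int_quantile M Z p"
    using p c qi by (simp add: int_quantile_def set_integral_diff set_integral_const)
  finally show ?thesis using e by (intro exI[of _ \<eta>]) simp
next
  case False
  with p have p1: "p = 1" by simp
  note q1 = int_quantile_1[OF Z]
  have lim: "(\<lambda>n. LINT w|M. min (real n) (Z w)) \<longlonglongrightarrow> (LINT w|M. Z w)"
  proof (rule integral_dominated_convergence[where w="\<lambda>w. \<bar>Z w\<bar>"])
    show "AE w in M. (\<lambda>n. min (real n) (Z w)) \<longlonglongrightarrow> Z w"
    proof (rule AE_I2)
      fix w
      have "eventually (\<lambda>n. min (real n) (Z w) = Z w) sequentially"
        using eventually_ge_at_top[of "nat \<lceil>Z w\<rceil>"] by eventually_elim linarith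
      then show "(\<lambda>n. min (real n) (Z w)) \<longlonglongrightarrow> Z w" by (rule tendsto_eventually)
    qed
  qed (use Z in auto)
  from order_tendstoD(1)[OF lim, of "(LINT w|M. Z w) - \<epsilon>"] e
  obtain n where n: "(LINT w|M. Z w) - \<epsilon> < (LINT w|M. min (real n) (Z w))"
    by (auto dest: eventually_happens)
  have "(LINT w|M. min (real n) (Z w)) = (LINT w|M. real n - max 0 (real n - Z w))"
    by (rule Bochner_Integration.integral_cong) auto
  also have "\<dots> = real n - (LINT w|M. max 0 (real n - Z w))"
    using integrable_shortfall[OF Z] by (simp add: prob_space)
  finally show ?thesis using n q1 p1 by (intro exI[of _ "real n"]) simp
qed

text \<open>The variational formula as a criterion: upper bounds on \<open>int_quantile\<close> turn
  into inequalities between expectations in which no quantile occurs.\<close>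

lemma int_quantile_le_iff:
  assumes Z: "integrable M Z" and p: "0 < p" "p \<le> 1"
  shows "int_quantile M Z p \<le> c \<longleftrightarrow> (\<forall>\<eta>. \<eta> * p - (LINT w|M. max 0 (\<eta> - Z w)) \<le> c)"
proof
  assume "\<forall>\<eta>. \<eta> * p - (LINT w|M. max 0 (\<eta> - Z w)) \<le> c"
  then have "int_quantile M Z p \<le> c + \<epsilon>" if "\<epsilon> > 0" for \<epsilon>
    using int_quantile_le_approx[OF Z p that] by (meson add_mono_thms_linordered_semiring(3) order_trans)
  then show "int_quantile M Z p \<le> c" by (rule field_le_epsilon)
qed (use int_quantile_ge[OF Z] p in \<open>meson less_imp_le order_trans\<close>)

text \<open>Near-optimal \<open>a\<close> for \<open>Z\<close> and \<open>b\<close> for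
  \<open>W\<close> combine to the candidate s a + t b for \<open>V\<close>, and the shortfall is
  convex. Since \<open>V\<close> need only dominate the combination, the lemma covers monotonicity
  and composition with a concave map.\<close>

lemma int_quantile_concave:
  assumes Z: "integrable M Z" and W: "integrable M W" and V: "integrable M V"
    and p: "0 < p" "p \<le> 1" and l: "0 \<le> s" "0 \<le> t" "s + t = 1"
    and ge: "AE w in M. s * Z w + t * W w \<le> V w"
  shows "s * int_quantile M Z p + t * int_quantile M W p \<le> int_quantile M V p"
proof (rule field_le_epsilon)
  fix \<epsilon> :: real assume e: "\<epsilon> > 0"
  obtain a where a: "int_quantile M Z p \<le> a * p - (LINT w|M. max 0 (a - Z w)) + \<epsilon>"
    using int_quantile_le_approx[OF Z p e] by blast
  obtain b where b: "int_quantile M W p \<le> b * p - (LINT w|M. max 0 (b - W w)) + \<epsilon>"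
    using int_quantile_le_approx[OF W p e] by blast
  let ?i = "\<lambda>c Z. LINT w|M. max 0 (c - Z w)"
  have "?i (s * a + t * b) V \<le> (LINT w|M. s * max 0 (a - Z w) + t * max 0 (b - W w))"
  proof (rule integral_mono_AE)
    show "AE w in M. max 0 (s * a + t * b - V w) \<le> s * max 0 (a - Z w) + t * max 0 (b - W w)"
      using ge
    proof eventually_elim
      case (elim w)
      have "s * (a - Z w) \<le> s * max 0 (a - Z w)" "t * (b - W w) \<le> t * max 0 (b - W w)"
        "0 \<le> s * max 0 (a - Z w)" "0 \<le> t * max 0 (b - W w)"
        using l by (auto intro: mult_left_mono)
      then show ?case using elim by (simp add: algebra_simps)
    qed
  qed (use integrable_shortfall Z W V in auto)
  also have "\<dots> = s * ?i a Z + t * ?i b W" using integrable_shortfall Z W by simp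
  finally have c: "?i (s * a + t * b) V \<le> s * ?i a Z + t * ?i b W" .
  have "s * int_quantile M Z p + t * int_quantile M W p
      \<le> s * (a * p - ?i a Z + \<epsilon>) + t * (b * p - ?i b W + \<epsilon>)"
    using a b l by (intro add_mono mult_left_mono) auto
  also have "\<dots> = (s * a + t * b) * p - (s * ?i a Z + t * ?i b W) + (s + t) * \<epsilon>"
    by (simp add: algebra_simps)
  also have "\<dots> \<le> (s * a + t * b) * p - ?i (s * a + t * b) V + \<epsilon>" using c l by simp
  also have "\<dots> \<le> int_quantile M V p + \<epsilon>" using int_quantile_ge[OF V, of p] p by simp
  finally show "s * int_quantile M Z p + t * int_quantile M W p \<le> int_quantile M V p + \<epsilon>" .
qed

text \<open>The degenerate weights s = 1, t = 0 of \<open>int_quantile_concave\<close>.\<close>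

lemma int_quantile_mono:
  assumes "integrable M Z" "integrable M W" "0 < p" "p \<le> 1" "AE w in M. Z w \<le> W w"
  shows "int_quantile M Z p \<le> int_quantile M W p"
  using int_quantile_concave[OF assms(1,1,2,3,4), of 1 0] assms(5) by simp

text \<open>The shortfall is 1-Lipschitz in the L1 norm for every \<eta>; the constant does not
  depend on p, so AVaR is Lipschitz uniformly on p \<ge> \<alpha>.\<close>

lemma int_quantile_Lipschitz:
  assumes Z: "integrable M Z" and W: "integrable M W" and p: "0 < p" "p \<le> 1"
  shows "int_quantile M Z p \<le> int_quantile M W p + (LINT w|M. \<bar>Z w - W w\<bar>)"
  unfolding int_quantile_le_iff[OF Z p]
proof
  fix \<eta>
  have "(LINT w|M. max 0 (\<eta> - W w)) \<le> (LINT w|M. max 0 (\<eta> - Z w) + \<bar>Z w - W w\<bar>)"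
    by (rule integral_mono) (use integrable_shortfall Z W in auto)
  also have "\<dots> = (LINT w|M. max 0 (\<eta> - Z w)) + (LINT w|M. \<bar>Z w - W w\<bar>)"
    using integrable_shortfall Z W by simp
  finally show "\<eta> * p - (LINT w|M. max 0 (\<eta> - Z w)) \<le> int_quantile M W p + (LINT w|M. \<bar>Z w - W w\<bar>)"
    using int_quantile_ge[OF W, of p \<eta>] p by simp
qed

text \<open>As p \<le> 1, the positive part of \<eta> - Z dominates p (\<eta> - Z). Divided by p,
  this is the lower bound - E Z for AVaR.\<close>

lemma int_quantile_le_expectation:
  assumes Z: "integrable M Z" and p: "0 < p" "p \<le> 1"
  shows "int_quantile M Z p \<le> p * (LINT w|M. Z w)"
  unfolding int_quantile_le_iff[OF Z p]
proof
  fix \<eta>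
  have "p * (LINT w|M. \<eta> - Z w) \<le> (LINT w|M. max 0 (\<eta> - Z w))"
    unfolding integral_mult_right_zero[symmetric]
  proof (rule integral_mono)
    fix w
    have "p * (\<eta> - Z w) \<le> p * max 0 (\<eta> - Z w)" using p by (intro mult_left_mono) auto
    also have "\<dots> \<le> 1 * max 0 (\<eta> - Z w)" using p by (intro mult_right_mono) auto
    finally show "p * (\<eta> - Z w) \<le> max 0 (\<eta> - Z w)" by simp
  qed (use integrable_shortfall Z in auto)
  then show "\<eta> * p - (LINT w|M. max 0 (\<eta> - Z w)) \<le> p * (LINT w|M. Z w)"
    using Z by (simp add: prob_space algebra_simps)
qed

text \<open>For \<eta> = l the shortfall vanishes.\<close>

lemma int_quantile_ge_lower_bound:
  assumes Z: "integrable M Z" and p: "0 \<le> p" "p \<le> 1" and l: "AE w in M. l \<le> Z w"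
  shows "p * l \<le> int_quantile M Z p"
proof -
  have "(LINT w|M. max 0 (l - Z w)) = 0"
    by (rule integral_eq_zero_AE) (use l in \<open>auto elim: eventually_mono\<close>)
  then show ?thesis using int_quantile_ge[OF Z p, of l] by (simp add: mult.commute)
qed

text \<open>If Z \<le> d < c had positive probability, this probability itself would be a level p at
  which the integrated quantile is at most p d. A sequence of values d increasing to c then gives
  the essential lower bound; this is how the case p = 0 is reached.\<close>

lemma lower_bound_if_int_quantile_ge:
  assumes Z: "integrable M Z" and ge: "\<And>p. 0 < p \<Longrightarrow> p \<le> 1 \<Longrightarrow> p * c \<le> int_quantile M Z p"
  shows "AE w in M. c \<le> Z w"
proof -
  have Zm[measurable]: "Z \<in> borel_measurable M" using Z by auto
  have "AE w in M. d < Z w" if d: "d < c" for d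
  proof (rule ccontr)
    assume "\<not> ?thesis"
    define p where "p = prob {w\<in>space M. Z w \<le> d}"
    have p0: "p > 0"
    proof (rule ccontr)
      assume "\<not> p > 0"
      then have "prob {w\<in>space M. Z w \<le> d} = 0" unfolding p_def using measure_nonneg by (metis less_eq_real_def)
      then have "AE w in M. \<not> Z w \<le> d" by (subst (asm) prob_Collect_eq_0) auto
      then show False using \<open>\<not> (AE w in M. d < Z w)\<close> by (simp add: not_le)
    qed
    have p1: "p \<le> 1" by (simp add: p_def)
    have "int_quantile M Z p \<le> p * d"
      unfolding int_quantile_le_iff[OF Z p0 p1]
    proof
      fix \<eta>
      have "(LINT w|M. max 0 (\<eta> - d) * indicat_real {w\<in>space M. Z w \<le> d} w) \<le> (LINT w|M. max 0 (\<eta> - Z w))"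
      proof (rule integral_mono)
        show "integrable M (\<lambda>w. max 0 (\<eta> - d) * indicat_real {w\<in>space M. Z w \<le> d} w)"
          by (intro integrable_mult_right integrable_const_bound[where B=1]) auto
      qed (use integrable_shortfall[OF Z] in \<open>auto simp: indicator_def\<close>)
      then have "max 0 (\<eta> - d) * p \<le> (LINT w|M. max 0 (\<eta> - Z w))" by (simp add: p_def)
      moreover have "(\<eta> - d) * p \<le> max 0 (\<eta> - d) * p" using p0 by (intro mult_right_mono) auto
      ultimately show "\<eta> * p - (LINT w|M. max 0 (\<eta> - Z w)) \<le> p * d" by (simp add: algebra_simps)
    qed
    with ge[OF p0 p1] have "p * c \<le> p * d" by simp
    then show False using p0 d by simp
  qed
  then have "AE w in M. \<forall>n. c - 1 / real (Suc n) < Z w"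
    unfolding AE_all_countable by simp
  then show ?thesis
  proof eventually_elim
    case (elim w)
    show ?case
    proof (rule ccontr)
      assume "\<not> c \<le> Z w"
      then obtain n where "1 / real (Suc n) < c - Z w"
        using reals_Archimedean[of "c - Z w"] by (auto simp: inverse_eq_divide)
      then show False using elim[rule_format, of n] by simp
    qed
  qed
qed

text \<open>Extended by 0 outside (0, 1) the quantile function is integrable, so its integral up to
  p is an indefinite integral; the endpoints and the value at p = 0 are reconciled with the
  definition.\<close>

lemma continuous_on_int_quantile:
  assumes "integrable M Z"
  shows "continuous_on {0..1} (int_quantile M Z)"
proof -
  let ?f = "\<lambda>t. indicat_real {0<..<1} t * quantile M Z t"
  have fi: "integrable lborel ?f"
    using set_integrable_quantile[OF assms] by (simp add: set_integrable_def)
  have fi': "set_integrable lborel {0..1} ?f"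
    unfolding set_integrable_def using integrable_mult_indicator[OF _ fi, of "{0..1}"] by simp
  have "continuous_on {0..1} (\<lambda>p. integral {0..p} ?f)"
    by (rule indefinite_integral_continuous_1) (rule set_borel_integral_eq_integral(1)[OF fi'])
  moreover have "integral {0..p} ?f = int_quantile M Z p" if "p \<in> {0..1}" for p
  proof -
    have "set_integrable lborel {0..p} ?f"
      by (rule set_integrable_subset[OF fi']) (use that in auto)
    from set_borel_integral_eq_integral(2)[OF this]
    have "integral {0..p} ?f = (LINT t:{0..p}|lborel. ?f t)" by simp
    also have "\<dots> = int_quantile M Z p"
    proof (cases "p = 0")
      case True
      have "(LINT t:{0..p}|lborel. ?f t) = integral\<^sup>L lborel (\<lambda>t::real. 0)"
        unfolding set_lebesgue_integral_def
        by (rule Bochner_Integration.integral_cong) (use True in \<open>auto simp: indicator_def\<close>)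
      then show ?thesis using True by (simp add: int_quantile_def)
    next
      case False
      have "(LINT t:{0..p}|lborel. ?f t) = (LINT t:{0<..<p}|lborel. quantile M Z t)"
        unfolding set_lebesgue_integral_def
      proof (rule integral_cong_AE)
        have "AE t in lborel. t \<noteq> p" by (rule AE_lborel_singleton)
        then show "AE t in lborel. indicat_real {0..p} t *\<^sub>R ?f t = indicat_real {0<..<p} t *\<^sub>R quantile M Z t"
          by eventually_elim (use that in \<open>auto simp: indicator_def\<close>)
        show "(\<lambda>t. indicat_real {0<..<p} t *\<^sub>R quantile M Z t) \<in> borel_measurable lborel"
          using set_integrable_quantile'[OF assms, of p] that unfolding set_integrable_def by auto
        show "(\<lambda>t. indicat_real {0..p} t *\<^sub>R ?f t) \<in> borel_measurable lborel"
          using borel_measurable_integrable[OF fi] by (intro borel_measurable_scaleR) auto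
      qed
      then show ?thesis using False by (simp add: int_quantile_def)
    qed
    finally show ?thesis .
  qed
  ultimately show ?thesis by (subst (asm) continuous_on_cong[OF refl]) auto
qed

end

section \<open>Dual description of AVaR\<close>

text \<open>The real-valued form of \<open>AVaR\<close> for nonzero p. It keeps the necessity
  argument, where p \<ge> \<alpha> > 0, free of extended reals.\<close>

definition avar :: "'w measure \<Rightarrow> real \<Rightarrow> ('w \<Rightarrow> real) \<Rightarrow> real" where
  "avar M p Z = - int_quantile M Z p / p"

lemma AVaR_eq_avar: "p \<noteq> 0 \<Longrightarrow> AVaR M p Z = ereal (avar M p Z)"
  by (simp add: AVaR_def avar_def)

text \<open>The subdifferential of AVaR at \<open>0\<close>; its support function is AVaR.\<close>

definition avar_dual_set :: "'w measure \<Rightarrow> real \<Rightarrow> ('w \<Rightarrow> real) set" where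
  "avar_dual_set M p = {\<zeta> \<in> borel_measurable M.
     (AE w in M. - (1 / p) \<le> \<zeta> w \<and> \<zeta> w \<le> 0) \<and> (LINT w|M. \<zeta> w) = -1}"

context prob_space
begin

section \<open>Weak duality for AVaR and explicit maximizers\<close>

lemma integrable_bounded_mult:
  fixes f h :: "'a \<Rightarrow> real"
  assumes f: "f \<in> borel_measurable M" and b: "AE w in M. \<bar>f w\<bar> \<le> B" and h: "integrable M h"
  shows "integrable M (\<lambda>w. f w * h w)"
proof (rule Bochner_Integration.integrable_bound)
  show "integrable M (\<lambda>w. B * \<bar>h w\<bar>)" using h by simp
  show "AE w in M. norm (f w * h w) \<le> norm (B * \<bar>h w\<bar>)"
    using b
  proof eventually_elim
    case (elim w)
    then have "\<bar>f w\<bar> * \<bar>h w\<bar> \<le> \<bar>B\<bar> * \<bar>h w\<bar>" by (intro mult_right_mono) auto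
    then show ?case by (simp add: abs_mult)
  qed
qed (use f h in auto)

lemma avar_dual_set_bound:
  assumes "\<zeta> \<in> avar_dual_set M p" "0 < p"
  shows "AE w in M. \<bar>\<zeta> w\<bar> \<le> 1 / p"
proof -
  have "AE w in M. - (1 / p) \<le> \<zeta> w \<and> \<zeta> w \<le> 0" using assms by (simp add: avar_dual_set_def)
  then show ?thesis by eventually_elim auto
qed

lemma integrable_avar_dual_set:
  assumes "\<zeta> \<in> avar_dual_set M p" "0 < p" "integrable M Z"
  shows "integrable M (\<lambda>w. \<zeta> w * Z w)"
  by (rule integrable_bounded_mult[OF _ avar_dual_set_bound[OF assms(1,2)]])
    (use assms in \<open>auto simp: avar_dual_set_def\<close>)

text \<open>The function - p \<zeta> takes values in [0, 1] and has mean p, so (- p \<zeta>) (\<eta>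
  - Z) is at most the positive part of \<eta> - Z; integration gives the bound for every
  \<eta>.\<close>

lemma expectation_le_avar:
  assumes z: "\<zeta> \<in> avar_dual_set M p" and p: "0 < p" "p \<le> 1" and Z: "integrable M Z"
  shows "(LINT w|M. \<zeta> w * Z w) \<le> avar M p Z"
proof -
  have "integrable M (\<lambda>w. \<zeta> w * 1)" by (rule integrable_avar_dual_set[OF z p(1)]) simp
  then have zi: "integrable M \<zeta>" by simp
  have zZ: "integrable M (\<lambda>w. \<zeta> w * Z w)" by (rule integrable_avar_dual_set[OF z p(1) Z])
  have "int_quantile M Z p \<le> - p * (LINT w|M. \<zeta> w * Z w)"
    unfolding int_quantile_le_iff[OF Z p]
  proof
    fix \<eta>
    have "(LINT w|M. (- p * \<eta>) * \<zeta> w + p * (\<zeta> w * Z w)) \<le> (LINT w|M. max 0 (\<eta> - Z w))"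
    proof (rule integral_mono_AE)
      have "AE w in M. - (1 / p) \<le> \<zeta> w \<and> \<zeta> w \<le> 0" using z by (auto simp: avar_dual_set_def)
      then show "AE w in M. (- p * \<eta>) * \<zeta> w + p * (\<zeta> w * Z w) \<le> max 0 (\<eta> - Z w)"
      proof eventually_elim
        case (elim w)
        then have u: "0 \<le> - p * \<zeta> w" "- p * \<zeta> w \<le> 1"
          using p by (auto simp: field_simps mult_le_0_iff)
        have "(- p * \<eta>) * \<zeta> w + p * (\<zeta> w * Z w) = (- p * \<zeta> w) * (\<eta> - Z w)"
          by (simp add: algebra_simps)
        also have "\<dots> \<le> (- p * \<zeta> w) * max 0 (\<eta> - Z w)" using u by (intro mult_left_mono) auto
        also have "\<dots> \<le> 1 * max 0 (\<eta> - Z w)" using u by (intro mult_right_mono) auto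
        finally show ?case by simp
      qed
    qed (use zi zZ integrable_shortfall[OF Z] in auto)
    then show "\<eta> * p - (LINT w|M. max 0 (\<eta> - Z w)) \<le> - p * (LINT w|M. \<zeta> w * Z w)"
      using zi zZ z by (simp add: avar_dual_set_def mult.commute)
  qed
  then show ?thesis using p by (simp add: avar_def field_simps)
qed

lemma avar_mono:
  assumes "integrable M Z" "integrable M W" "0 < p" "p \<le> 1" "AE w in M. Z w \<le> W w"
  shows "avar M p W \<le> avar M p Z"
  using int_quantile_mono[OF assms] assms(3) by (simp add: avar_def divide_right_mono)

lemma avar_Lipschitz:
  assumes "integrable M Z" "integrable M W" "0 < p" "p \<le> 1"
  shows "avar M p Z \<le> avar M p W + (LINT w|M. \<bar>Z w - W w\<bar>) / p"
  using int_quantile_Lipschitz[OF assms(2,1,3,4)] assms(3)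
  by (simp add: avar_def abs_minus_commute divide_simps)

lemma avar_convex:
  assumes "integrable M Z" "integrable M W" "integrable M V"
    and p: "0 < p" "p \<le> 1" and "0 \<le> s" "0 \<le> t" "s + t = 1"
    and "AE w in M. s * Z w + t * W w \<le> V w"
  shows "avar M p V \<le> s * avar M p Z + t * avar M p W"
  using int_quantile_concave[OF assms] p by (simp add: avar_def divide_simps algebra_simps)

lemma continuous_on_avar:
  assumes "integrable M Z" "0 < \<alpha>" "\<beta> \<le> 1"
  shows "continuous_on {\<alpha>..\<beta>} (\<lambda>p. avar M p Z)"
  unfolding avar_def using assms
  by (intro continuous_intros continuous_on_subset[OF continuous_on_int_quantile]) auto

text \<open>The gap between the two probabilities is the atom of \<open>Z\<close> at its quantile,
  which the maximizer below has to split.\<close>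

lemma quantile_prob:
  assumes Z[measurable]: "Z \<in> borel_measurable M" and p: "0 < p" "p < 1"
  shows "prob {w\<in>space M. Z w < quantile M Z p} \<le> p"
    and "p \<le> prob {w\<in>space M. Z w \<le> quantile M Z p}"
proof -
  interpret D: cdf_distribution "distr M borel Z"
    unfolding cdf_distribution_def by simp
  let ?q = "quantile M Z p"
  have q: "p \<le> D.C x \<longleftrightarrow> ?q \<le> x" for x unfolding quantile_def by (rule D.pseudoinverse[OF p])
  have C: "D.C x = prob {w\<in>space M. Z w \<le> x}" for x
    unfolding cdf_def by (subst measure_distr) (auto intro: arg_cong[where f=prob])
  show "p \<le> prob {w\<in>space M. Z w \<le> ?q}" using q[of ?q] C by simp
  let ?A = "\<lambda>n. {w\<in>space M. Z w \<le> ?q - 1 / real (Suc n)}"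
  have "(\<lambda>n. prob (?A n)) \<longlonglongrightarrow> prob (\<Union>n. ?A n)"
  proof (rule finite_Lim_measure_incseq)
    show "incseq ?A"
    proof (rule incseq_SucI)
      fix n
      have "1 / real (Suc (Suc n)) \<le> 1 / real (Suc n)" by (rule divide_left_mono) auto
      then show "?A n \<subseteq> ?A (Suc n)" by auto
    qed
  qed auto
  moreover have "(\<Union>n. ?A n) = {w\<in>space M. Z w < ?q}"
  proof (intro set_eqI iffI)
    fix w assume w: "w \<in> {w\<in>space M. Z w < ?q}"
    then obtain n where "1 / real (Suc n) < ?q - Z w"
      using reals_Archimedean[of "?q - Z w"] by (auto simp: inverse_eq_divide)
    then have "w \<in> ?A n" using w by simp
    then show "w \<in> (\<Union>n. ?A n)" by blast
  next
    fix w assume "w \<in> (\<Union>n. ?A n)"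
    then obtain n where "w \<in> space M" "Z w \<le> ?q - 1 / real (Suc n)" by blast
    moreover have "1 / real (Suc n) > 0" by simp
    ultimately have "Z w < ?q" by linarith
    with \<open>w \<in> space M\<close> show "w \<in> {w\<in>space M. Z w < ?q}" by simp
  qed
  ultimately have lim: "(\<lambda>n. prob (?A n)) \<longlonglongrightarrow> prob {w\<in>space M. Z w < ?q}" by simp
  have "prob (?A n) \<le> p" for n
    using q[of "?q - 1 / real (Suc n)"] C[of "?q - 1 / real (Suc n)"] by (simp add: not_le)
  then show "prob {w\<in>space M. Z w < ?q} \<le> p" by (intro LIMSEQ_le_const2[OF lim]) auto
qed

text \<open>Complementary slackness: \<open>eq\<close> turns the estimate behind
  \<open>expectation_le_avar\<close> into an equality for a single \<eta>.\<close>

lemma avar_dual_set_maximizerI: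
  assumes z: "\<zeta> \<in> avar_dual_set M p" and p: "0 < p" "p \<le> 1" and Z: "integrable M Z"
    and eq: "AE w in M. - p * \<zeta> w * (\<eta> - Z w) = max 0 (\<eta> - Z w)"
  shows "(LINT w|M. \<zeta> w * Z w) = avar M p Z"
proof (rule antisym)
  show "(LINT w|M. \<zeta> w * Z w) \<le> avar M p Z" by (rule expectation_le_avar[OF z p Z])
  have "integrable M (\<lambda>w. \<zeta> w * 1)" by (rule integrable_avar_dual_set[OF z p(1)]) simp
  then have zi: "integrable M \<zeta>" by simp
  have zZ: "integrable M (\<lambda>w. \<zeta> w * Z w)" by (rule integrable_avar_dual_set[OF z p(1) Z])
  have "(LINT w|M. max 0 (\<eta> - Z w)) = (LINT w|M. (- p * \<eta>) * \<zeta> w + p * (\<zeta> w * Z w))"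
    by (rule integral_cong_AE)
      (use eq zi zZ integrable_shortfall[OF Z] in \<open>auto simp: algebra_simps elim: eventually_mono\<close>)
  also have "\<dots> = p * \<eta> + p * (LINT w|M. \<zeta> w * Z w)"
    using zi zZ z by (simp add: avar_dual_set_def)
  finally show "avar M p Z \<le> (LINT w|M. \<zeta> w * Z w)"
    using int_quantile_ge[OF Z, of p \<eta>] p by (simp add: avar_def field_simps)
qed

text \<open>For p < 1 the maximizer is - 1 / p below the quantile, a fraction \<open>c p\<close> of
  this on the atom at the quantile, and 0 above; for p = 1 it is -1. It is explicit, and the
  functions of p involved are built from monotone ones, so joint measurability requires no selection
  theorem.\<close>

lemma avar_measurable_maximizer:
  assumes Zi: "integrable M Z"
  shows "\<exists>\<zeta>. (\<lambda>(p, w). \<zeta> p w) \<in> borel_measurable (borel \<Otimes>\<^sub>M M) \<and>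
    (\<forall>p\<in>{0<..1}. \<zeta> p \<in> avar_dual_set M p \<and> (LINT w|M. \<zeta> p w * Z w) = avar M p Z)"
proof -
  have Z[measurable]: "Z \<in> borel_measurable M" using Zi by auto
  define q where "q p = (if p \<in> {0<..<1} then quantile M Z p else 0)" for p
  have qm[measurable]: "q \<in> borel_measurable borel"
  proof -
    have "quantile M Z \<in> borel_measurable (restrict_space borel {0<..<1})"
      by (intro borel_measurable_mono_on_fnc) (auto simp: mono_on_def intro: quantile_mono)
    then have "(\<lambda>p. indicat_real {0<..<1} p *\<^sub>R quantile M Z p) \<in> borel_measurable borel"
      by (subst (asm) borel_measurable_restrict_space_iff) auto
    also have "(\<lambda>p. indicat_real {0<..<1} p *\<^sub>R quantile M Z p) = q"
      by (auto simp: q_def indicator_def)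
    finally show ?thesis .
  qed
  define L where "L x = prob {w\<in>space M. Z w < x}" for x
  define R where "R x = prob {w\<in>space M. Z w \<le> x}" for x
  have Lm[measurable]: "L \<in> borel_measurable borel"
    by (rule borel_measurable_mono) (auto simp: L_def mono_def intro!: finite_measure_mono)
  have Rm[measurable]: "R \<in> borel_measurable borel"
    by (rule borel_measurable_mono) (auto simp: R_def mono_def intro!: finite_measure_mono)
  \<comment> \<open>The fraction that makes the mean of \<open>\<theta> p\<close> equal to p.
    Without an atom the quotient is 0 by division by zero, and the mean is already p.\<close>
  define c where "c p = (p - L (q p)) / (R (q p) - L (q p))" for p
  have [measurable]: "c \<in> borel_measurable borel" unfolding c_def[abs_def] by measurable
  define \<theta> where "\<theta> p w = (if Z w < q p then 1 else if Z w = q p then c p else 0)" for p w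
  define \<zeta> where "\<zeta> p w = (if p < 1 then - (1 / p) * \<theta> p w else -1)" for p w
  have "(\<lambda>(p, w). \<zeta> p w) \<in> borel_measurable (borel \<Otimes>\<^sub>M M)"
    unfolding \<zeta>_def \<theta>_def by measurable
  moreover have "\<zeta> p \<in> avar_dual_set M p \<and> (LINT w|M. \<zeta> p w * Z w) = avar M p Z"
    if p: "p \<in> {0<..1}" for p
  proof (cases "p < 1")
    case False
    with p have p1: "p = 1" by auto
    then have z: "\<zeta> 1 = (\<lambda>w. -1)" by (auto simp: \<zeta>_def)
    have d: "\<zeta> p \<in> avar_dual_set M p" unfolding p1 z by (simp add: avar_dual_set_def prob_space)
    moreover have "avar M p Z \<le> (LINT w|M. \<zeta> p w * Z w)"
      unfolding p1 z avar_def using int_quantile_1[OF Zi] by simp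
    ultimately show ?thesis using expectation_le_avar[OF d _ _ Zi] p by (auto intro: antisym)
  next
    case True
    with p have p01: "0 < p" "p < 1" by auto
    have q: "q p = quantile M Z p" using p01 by (simp add: q_def)
    have Lp: "L (q p) \<le> p" and Rp: "p \<le> R (q p)"
      unfolding L_def R_def q using quantile_prob[OF Z p01] by auto
    have c: "0 \<le> c p" "c p \<le> 1"
      using Lp Rp by (auto simp: c_def divide_le_eq)
    have \<theta>01: "0 \<le> \<theta> p w" "\<theta> p w \<le> 1" for w using c by (auto simp: \<theta>_def)
    have \<theta>m[measurable]: "\<theta> p \<in> borel_measurable M" unfolding \<theta>_def[abs_def] by measurable
    have E: "(LINT w|M. \<theta> p w) = p"
    proof -
      let ?A = "{w\<in>space M. Z w < q p}" and ?B = "{w\<in>space M. Z w = q p}"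
      have "R (q p) = prob (?A \<union> ?B)" unfolding R_def by (rule arg_cong[where f=prob]) auto
      also have "\<dots> = L (q p) + prob ?B" unfolding L_def by (rule finite_measure_Union) auto
      finally have B: "prob ?B = R (q p) - L (q p)" by simp
      have "(LINT w|M. \<theta> p w) = (LINT w|M. indicat_real ?A w + c p * indicat_real ?B w)"
        by (rule Bochner_Integration.integral_cong) (auto simp: \<theta>_def)
      also have "\<dots> = L (q p) + c p * prob ?B"
        by (subst Bochner_Integration.integral_add) (auto simp: L_def intro!: integrable_mult_right integrable_const_bound[where B=1])
      also have "\<dots> = p" unfolding B c_def using Lp Rp by (cases "R (q p) = L (q p)") auto
      finally show ?thesis .
    qed
    have z: "\<zeta> p = (\<lambda>w. - (1 / p) * \<theta> p w)" using p01 by (auto simp: \<zeta>_def)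
    have d: "\<zeta> p \<in> avar_dual_set M p"
      unfolding z avar_dual_set_def using E p01 \<theta>01 by (auto simp: divide_right_mono)
    moreover have "(LINT w|M. \<zeta> p w * Z w) = avar M p Z"
      by (rule avar_dual_set_maximizerI[OF d _ _ Zi, where \<eta>="q p"])
        (use p01 in \<open>auto simp: z \<theta>_def\<close>)
    ultimately show ?thesis by simp
  qed
  ultimately show ?thesis by blast
qed

end

section \<open>The spaces \<open>L\<^sub>m\<close>\<close>

context prob_space
begin

lemma Lp_space_measurable: "f \<in> Lp_space M q \<Longrightarrow> f \<in> borel_measurable M"
  by (simp add: Lp_space_def)

lemma Lp_space_iff: "f \<in> Lp_space M (ereal m) \<longleftrightarrow> f \<in> borel_measurable M \<and> integrable M (\<lambda>w. \<bar>f w\<bar> powr m)"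
  by (simp add: Lp_space_def)

lemma Lp_space_integrable:
  assumes m: "1 \<le> m" and f: "f \<in> Lp_space M (ereal m)"
  shows "integrable M f"
proof (rule Bochner_Integration.integrable_bound)
  show "integrable M (\<lambda>w. 1 + \<bar>f w\<bar> powr m)" using f by (simp add: Lp_space_iff)
  have "\<bar>y\<bar> \<le> 1 + \<bar>y\<bar> powr m" for y :: real
  proof (cases "\<bar>y\<bar> \<le> 1")
    case False
    then have "\<bar>y\<bar> powr 1 \<le> \<bar>y\<bar> powr m" using m by (intro powr_mono) auto
    then show ?thesis using False by simp
  qed (simp add: add_increasing2)
  then show "AE w in M. norm (f w) \<le> norm (1 + \<bar>f w\<bar> powr m)"
    by (intro AE_I2) (simp add: abs_of_nonneg)
qed (use f in \<open>simp add: Lp_space_iff\<close>)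

text \<open>The factor \<open>2 powr m\<close> comes from \<bar>u\<bar> + \<bar>v\<bar> \<le> 2
  max(\<bar>u\<bar>, \<bar>v\<bar>), which replaces Minkowski's inequality.\<close>

lemma Lp_space_dominated:
  assumes m: "1 \<le> m" and f: "f \<in> borel_measurable M"
    and h: "h \<in> Lp_space M (ereal m)" "k \<in> Lp_space M (ereal m)"
    and le: "AE w in M. \<bar>f w\<bar> \<le> \<bar>h w\<bar> + \<bar>k w\<bar>"
  shows "f \<in> Lp_space M (ereal m)"
    and "(LINT w|M. \<bar>f w\<bar> powr m) \<le> 2 powr m * ((LINT w|M. \<bar>h w\<bar> powr m) + (LINT w|M. \<bar>k w\<bar> powr m))"
proof -
  let ?b = "\<lambda>w. 2 powr m * (\<bar>h w\<bar> powr m + \<bar>k w\<bar> powr m)"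
  have i: "integrable M ?b" using h by (simp add: Lp_space_iff)
  have b: "\<bar>y\<bar> powr m \<le> 2 powr m * (\<bar>u\<bar> powr m + \<bar>v\<bar> powr m)" if "\<bar>y\<bar> \<le> \<bar>u\<bar> + \<bar>v\<bar>" for y u v :: real
  proof -
    have "\<bar>y\<bar> powr m \<le> (2 * max \<bar>u\<bar> \<bar>v\<bar>) powr m" using that m by (intro powr_mono2) auto
    also have "\<dots> = 2 powr m * max \<bar>u\<bar> \<bar>v\<bar> powr m" by (simp add: powr_mult)
    also have "\<dots> \<le> 2 powr m * (\<bar>u\<bar> powr m + \<bar>v\<bar> powr m)"
      by (intro mult_left_mono) (auto simp: max_def)
    finally show ?thesis .
  qed
  have ae: "AE w in M. \<bar>f w\<bar> powr m \<le> ?b w" using le by eventually_elim (rule b)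
  have fi: "integrable M (\<lambda>w. \<bar>f w\<bar> powr m)"
    by (rule Bochner_Integration.integrable_bound[OF i]) (use f ae in \<open>auto elim: eventually_mono\<close>)
  then show "f \<in> Lp_space M (ereal m)" using f by (simp add: Lp_space_iff)
  have "(LINT w|M. \<bar>f w\<bar> powr m) \<le> (LINT w|M. ?b w)" by (rule integral_mono_AE[OF fi i ae])
  then show "(LINT w|M. \<bar>f w\<bar> powr m) \<le> 2 powr m * ((LINT w|M. \<bar>h w\<bar> powr m) + (LINT w|M. \<bar>k w\<bar> powr m))"
    using h by (simp add: Lp_space_iff)
qed

lemma Lp_space_add:
  assumes "1 \<le> m" "h \<in> Lp_space M (ereal m)" "k \<in> Lp_space M (ereal m)"
  shows "(\<lambda>w. h w + k w) \<in> Lp_space M (ereal m)"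
  by (rule Lp_space_dominated(1)[OF assms(1) _ assms(2,3)]) (use assms in \<open>auto simp: Lp_space_iff\<close>)

lemma Lp_space_diff:
  assumes "1 \<le> m" "h \<in> Lp_space M (ereal m)" "k \<in> Lp_space M (ereal m)"
  shows "(\<lambda>w. h w - k w) \<in> Lp_space M (ereal m)"
  by (rule Lp_space_dominated(1)[OF assms(1) _ assms(2,3)]) (use assms in \<open>auto simp: Lp_space_iff\<close>)

lemma bounded_in_Lp_space:
  assumes m: "1 \<le> m" and f: "f \<in> borel_measurable M" and b: "AE w in M. \<bar>f w\<bar> \<le> B"
  shows "f \<in> Lp_space M (conj_exponent m)"
proof (cases "m = 1")
  case True
  then show ?thesis using f b by (auto simp: Lp_space_def conj_exponent_def)
next
  case False
  have q: "0 \<le> m / (m - 1)" using m by simp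
  have "integrable M (\<lambda>w. \<bar>f w\<bar> powr (m / (m - 1)))"
  proof (rule integrable_const_bound[where B="\<bar>B\<bar> powr (m / (m - 1))"])
    show "AE w in M. norm (\<bar>f w\<bar> powr (m / (m - 1))) \<le> \<bar>B\<bar> powr (m / (m - 1))"
      using b by eventually_elim (auto intro!: powr_mono2 q)
  qed (use f in measurable)
  then show ?thesis using f False by (simp add: Lp_space_iff conj_exponent_def)
qed

lemma Lp_norm_powr:
  assumes "1 \<le> m"
  shows "Lp_norm M m f powr m = (LINT w|M. \<bar>f w\<bar> powr m)"
  using assms by (simp add: Lp_norm_def powr_powr)

text \<open>An elementary substitute for Jensen's inequality: splitting at \<bar>y\<bar> =
  \<epsilon> bounds \<bar>y\<bar> by \<epsilon> plus a multiple of its m-th power, and each part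
  contributes at most \<epsilon>.\<close>

lemma L1_norm_le_Lp_norm:
  assumes m: "1 \<le> m" and f: "f \<in> Lp_space M (ereal m)" and e: "0 < \<epsilon>" "Lp_norm M m f \<le> \<epsilon>"
  shows "(LINT w|M. \<bar>f w\<bar>) \<le> 2 * \<epsilon>"
proof -
  have "Lp_norm M m f powr m \<le> \<epsilon> powr m"
    using e m by (intro powr_mono2) (auto simp: Lp_norm_def)
  then have N: "(LINT w|M. \<bar>f w\<bar> powr m) \<le> \<epsilon> powr m" by (simp add: Lp_norm_powr[OF m])
  have b: "\<bar>y\<bar> \<le> \<epsilon> + \<epsilon> powr (1 - m) * \<bar>y\<bar> powr m" for y :: real
  proof (cases "\<bar>y\<bar> \<le> \<epsilon>")
    case True
    then show ?thesis by (simp add: add_increasing2)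
  next
    case False
    then have "\<bar>y\<bar> = \<bar>y\<bar> powr (1 - m) * \<bar>y\<bar> powr m"
      using e(1) by (simp add: powr_add[symmetric])
    also have "\<dots> \<le> \<epsilon> powr (1 - m) * \<bar>y\<bar> powr m"
      using False e(1) m by (intro mult_right_mono powr_mono2') auto
    finally show ?thesis using e(1) by simp
  qed
  have "(LINT w|M. \<bar>f w\<bar>) \<le> (LINT w|M. \<epsilon> + \<epsilon> powr (1 - m) * \<bar>f w\<bar> powr m)"
    by (rule integral_mono) (use Lp_space_integrable[OF m f] f b in \<open>auto simp: Lp_space_iff\<close>)
  also have "\<dots> = \<epsilon> + \<epsilon> powr (1 - m) * (LINT w|M. \<bar>f w\<bar> powr m)"
    using f by (simp add: Lp_space_iff prob_space)
  also have "\<dots> \<le> \<epsilon> + \<epsilon> powr (1 - m) * \<epsilon> powr m"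
    using N by (intro add_left_mono mult_left_mono) auto
  also have "\<dots> = 2 * \<epsilon>" using e(1) by (simp add: powr_add[symmetric])
  finally show ?thesis .
qed

lemma norm_continuous_Lp_norm_less:
  assumes "norm_continuous M m g" "0 < \<epsilon>"
  obtains \<delta> where "0 < \<delta>" "\<And>d. norm d < \<delta> \<Longrightarrow> Lp_norm M m (\<lambda>w. g (x + d) w - g x w) < \<epsilon>"
proof -
  have "\<forall>\<^sub>F y in at x. dist (Lp_norm M m (\<lambda>w. g y w - g x w)) 0 < \<epsilon>"
    using assms unfolding norm_continuous_def by (intro tendstoD) auto
  then obtain \<delta> where \<delta>: "\<delta> > 0"
    "\<forall>y. y \<noteq> x \<and> dist y x < \<delta> \<longrightarrow> dist (Lp_norm M m (\<lambda>w. g y w - g x w)) 0 < \<epsilon>"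
    unfolding eventually_at by auto
  have "Lp_norm M m (\<lambda>w. g (x + d) w - g x w) < \<epsilon>" if "norm d < \<delta>" for d
    using \<delta>(2)[rule_format, of "x + d"] that assms(2)
    by (cases "d = 0") (auto simp: dist_norm Lp_norm_def)
  then show ?thesis using that \<delta>(1) by blast
qed

lemma Lp_norm_scale:
  assumes "1 \<le> m"
  shows "Lp_norm M m (\<lambda>w. c * f w) = \<bar>c\<bar> * Lp_norm M m f"
  using assms by (simp add: Lp_norm_def abs_mult powr_mult powr_powr)

lemma Lp_norm_cong_AE:
  assumes "f \<in> borel_measurable M" "h \<in> borel_measurable M" "AE w in M. f w = h w"
  shows "Lp_norm M m f = Lp_norm M m h"
proof -
  have "(LINT w|M. \<bar>f w\<bar> powr m) = (LINT w|M. \<bar>h w\<bar> powr m)"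
    by (rule integral_cong_AE) (use assms in \<open>auto elim: eventually_mono\<close>)
  then show ?thesis by (simp add: Lp_norm_def)
qed

text \<open>Weak duality at \<open>W\<close> minus the equality at \<open>Z\<close> is the
  subgradient inequality.\<close>

lemma AVaR_subdifferentialI:
  assumes m: "1 \<le> m" and Z: "Z \<in> Lp_space M (ereal m)" and p: "0 < p" "p \<le> 1"
    and z: "\<zeta> \<in> avar_dual_set M p" and eq: "(LINT w|M. \<zeta> w * Z w) = avar M p Z"
  shows "\<zeta> \<in> AVaR_subdifferential M m p Z"
proof -
  have Zi: "integrable M Z" by (rule Lp_space_integrable[OF m Z])
  have "\<zeta> \<in> Lp_space M (conj_exponent m)"
    by (rule bounded_in_Lp_space[OF m _ avar_dual_set_bound[OF z p(1)]])
      (use z in \<open>simp add: avar_dual_set_def\<close>)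
  moreover have "AVaR M p W \<ge> AVaR M p Z + ereal (LINT w|M. \<zeta> w * (W w - Z w))"
    if W: "W \<in> Lp_space M (ereal m)" for W
  proof -
    have Wi: "integrable M W" by (rule Lp_space_integrable[OF m W])
    have "(LINT w|M. \<zeta> w * (W w - Z w)) = (LINT w|M. \<zeta> w * W w) - (LINT w|M. \<zeta> w * Z w)"
      using integrable_avar_dual_set[OF z p(1)] Wi Zi by (simp add: right_diff_distrib)
    then show ?thesis
      using expectation_le_avar[OF z p Wi] eq p by (simp add: AVaR_eq_avar)
  qed
  ultimately show ?thesis by (simp add: AVaR_subdifferential_def)
qed

end

text \<open>For random directions with finitely many values, integrability of the composition
  reduces to finitely many sections \<open>h d\<close>.\<close>

lemma integrable_compose_simple:
  fixes h :: "'b \<Rightarrow> 'a \<Rightarrow> real"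
  assumes u: "simple_function M u" and h: "\<And>d. integrable M (h d)"
  shows "integrable M (\<lambda>w. h (u w) w)"
proof -
  have fin: "finite (u ` space M)" using u by (rule simple_functionD)
  have "integrable M (\<lambda>w. \<Sum>d\<in>u ` space M. indicat_real (u -` {d} \<inter> space M) w *\<^sub>R h d w)"
    by (intro Bochner_Integration.integrable_sum integrable_mult_indicator h simple_functionD(2)[OF u])
  moreover have "(\<Sum>d\<in>u ` space M. indicat_real (u -` {d} \<inter> space M) w *\<^sub>R h d w) = h (u w) w"
    if "w \<in> space M" for w
  proof -
    have "(\<Sum>d\<in>u ` space M. indicat_real (u -` {d} \<inter> space M) w *\<^sub>R h d w) =
        (\<Sum>d\<in>u ` space M. if d = u w then h d w else 0)"
      using that by (intro sum.cong) (auto simp: indicator_def)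
    then show ?thesis using that fin by simp
  qed
  ultimately show ?thesis by (simp cong: Bochner_Integration.integrable_cong)
qed

section \<open>Subgradients of concave operators\<close>

text \<open>A version of Strassen's disintegration theorem. The linear functional \<open>T\<close> is extended from the
  functions \<open>1\<^sub>N e\<close>, with \<open>e\<close> constant, to simple functions with values in the Banach space; the
  extension is disintegrated by the Radon--Nikodym theorem. The weight \<open>1\<close> is used where
  \<open>\<xi>\<close> vanishes, in order to obtain a subgradient there as well.\<close>

theorem (in prob_space) concave_op_subgradient_exists:
  fixes g :: "'x::real_normed_vector \<Rightarrow> 'a \<Rightarrow> real" and T :: "'x \<Rightarrow> real"
  assumes m: "1 \<le> m" and gL: "\<And>x. g x \<in> Lp_space M (ereal m)" and gc: "norm_continuous M m g"
    and conc: "\<And>w. w \<in> space M \<Longrightarrow> concave_on UNIV (\<lambda>x. g x w)"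
    and \<xi>m[measurable]: "\<xi> \<in> borel_measurable M"
    and \<xi>0: "AE w in M. \<xi> w \<le> 0" and \<xi>B: "AE w in M. \<bar>\<xi> w\<bar> \<le> B"
    and T: "linear T" and Tle: "\<And>e. T e \<le> (LINT w|M. \<xi> w * (g (x + e) w - g x w))"
  shows "\<exists>S\<in>concave_op_subdifferential M m g x. \<forall>e. T e = (LINT w|M. \<xi> w * S e w)"
proof -
  define \<theta> where "\<theta> w = (if \<xi> w < 0 then - \<xi> w else 1)" for w
  have \<theta>pos: "\<theta> w > 0" for w by (simp add: \<theta>_def)
  have \<theta>m[measurable]: "\<theta> \<in> borel_measurable M" unfolding \<theta>_def[abs_def] by measurable
  have \<theta>B: "AE w in M. \<bar>\<theta> w\<bar> \<le> max B 1" using \<xi>B by eventually_elim (auto simp: \<theta>_def)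
  have gi: "integrable M (g y)" for y by (rule Lp_space_integrable[OF m gL])
  have gm[measurable]: "g y \<in> borel_measurable M" for y by (rule Lp_space_measurable[OF gL])
  define N where "N = {w\<in>space M. \<xi> w < 0}"
  have Nm[measurable]: "N \<in> sets M" unfolding N_def by measurable
  let ?v = "\<lambda>A e. (\<lambda>w. indicat_real A w *\<^sub>R e) :: 'a \<Rightarrow> 'x"
  have vs: "simple_function M (?v A e)" if "A \<in> sets M" for A e
    by (rule simple_function_compose1[OF simple_function_indicator[OF that], of "\<lambda>r. r *\<^sub>R e"])
  \<comment> \<open>The minus sign makes the integral functional convex in \<open>y\<close>, as
    \<open>g\<close> is concave.\<close>
  define f where "f y w = \<theta> w * (g x w - g (x + y w) w)" for y w
  define \<Phi> where "\<Phi> y = (LINT w|M. f y w)" for y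
  have fi: "integrable M (f y)" if "simple_function M y" for y
  proof -
    have "integrable M (\<lambda>w. g x w - g (x + y w) w)"
      by (intro Bochner_Integration.integrable_diff gi integrable_compose_simple[OF that, of "\<lambda>d. g (x + d)"])
    then show ?thesis
      unfolding f_def[abs_def] by (rule integrable_bounded_mult[OF \<theta>m \<theta>B])
  qed
  have conv: "\<Phi> (s *\<^sub>R u + t *\<^sub>R v) \<le> s * \<Phi> u + t * \<Phi> v"
    if u: "simple_function M u" and v: "simple_function M v" and st: "0 \<le> s" "0 \<le> t" "s + t = 1" for s t u v
  proof -
    have suv: "simple_function M (s *\<^sub>R u + t *\<^sub>R v)"
      using simple_function_compose2[OF u v, of "\<lambda>a b. s *\<^sub>R a + t *\<^sub>R b"]
      by (simp add: plus_fun_def scaleR_fun_def)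
    have "\<Phi> (s *\<^sub>R u + t *\<^sub>R v) \<le> (LINT w|M. s * f u w + t * f v w)"
      unfolding \<Phi>_def
    proof (rule integral_mono)
      fix w assume w: "w \<in> space M"
      have "s * g (x + u w) w + t * g (x + v w) w \<le> g (s *\<^sub>R (x + u w) + t *\<^sub>R (x + v w)) w"
        using conc[OF w] st by (auto simp: concave_on_iff)
      also have "s *\<^sub>R (x + u w) + t *\<^sub>R (x + v w) = (s + t) *\<^sub>R x + (s *\<^sub>R u w + t *\<^sub>R v w)"
        by (simp add: algebra_simps)
      finally have "s * g (x + u w) w + t * g (x + v w) w \<le> g (x + (s *\<^sub>R u w + t *\<^sub>R v w)) w"
        using st by simp
      then have "g x w - g (x + (s *\<^sub>R u w + t *\<^sub>R v w)) w
          \<le> (s + t) * g x w - (s * g (x + u w) w + t * g (x + v w) w)" using st by simp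
      also have "\<dots> = s * (g x w - g (x + u w) w) + t * (g x w - g (x + v w) w)"
        by (simp add: algebra_simps)
      finally have "f (s *\<^sub>R u + t *\<^sub>R v) w \<le> \<theta> w * (s * (g x w - g (x + u w) w) + t * (g x w - g (x + v w) w))"
        unfolding f_def using \<theta>pos[of w] by (intro mult_left_mono) auto
      then show "f (s *\<^sub>R u + t *\<^sub>R v) w \<le> s * f u w + t * f v w"
        by (simp add: f_def algebra_simps)
    qed (use fi u v suv in auto)
    also have "\<dots> = s * \<Phi> u + t * \<Phi> v" using fi u v by (simp add: \<Phi>_def)
    finally show ?thesis .
  qed
  \<comment> \<open>The infimum over \<open>e\<close> encodes the extension: a minorant of it is
    below \<Phi> (take e = 0) and agrees with \<open>T\<close> on the functions 1_N e. It is
    nonnegative at y = 0 because \<open>\<theta>\<close> equals - \<xi> on \<open>N\<close>, so that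
    \<Phi>(1_N e) is the right-hand side of \<open>Tle\<close>.\<close>
  define A where "A = {(y, r). simple_function M y \<and> (\<exists>e. \<Phi> (y + ?v N e) - T e \<le> r)}"
  have sadd: "simple_function M (u + v)" if "simple_function M u" "simple_function M v" for u v :: "'a \<Rightarrow> 'x"
    using simple_function_compose2[OF that, of "(+)"] by (simp add: plus_fun_def)
  have sscale: "simple_function M (c *\<^sub>R u)" if "simple_function M u" for u :: "'a \<Rightarrow> 'x" and c
    using simple_function_compose1[OF that, of "(*\<^sub>R) c"] by (simp add: scaleR_fun_def)
  have "\<exists>F. linear F \<and> (\<forall>(h, r)\<in>A. F h \<le> r)"
  proof (rule linear_minorant_of_convex_set)
    show "subspace {y::'a \<Rightarrow> 'x. simple_function M y}"
      by (rule subspaceI) (auto simp: zero_fun_def sadd sscale)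
    show "h \<in> {y. simple_function M y}" if "(h, r) \<in> A" for h r using that by (simp add: A_def)
    show "0 \<le> r" if "(0, r) \<in> A" for r
    proof -
      obtain e where e: "\<Phi> (0 + ?v N e) - T e \<le> r" using \<open>(0, r) \<in> A\<close> by (auto simp: A_def)
      have "T e \<le> \<Phi> (?v N e)"
      proof -
        have "(LINT w|M. \<xi> w * (g (x + e) w - g x w)) = \<Phi> (?v N e)"
          unfolding \<Phi>_def
        proof (rule integral_cong_AE)
          show "AE w in M. \<xi> w * (g (x + e) w - g x w) = f (?v N e) w"
            using \<xi>0 AE_space
            by eventually_elim (auto simp: f_def \<theta>_def N_def indicator_def algebra_simps)
        qed (use fi[OF vs[OF Nm]] in auto)
        then show ?thesis using Tle[of e] by simp
      qed
      then show ?thesis using e by simp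
    qed
    show "\<exists>t>0. \<exists>r. (t *\<^sub>R h, r) \<in> A" if "h \<in> {y. simple_function M y}" for h
    proof -
      have "(1 *\<^sub>R h, \<Phi> (h + ?v N 0) - T 0) \<in> A" using that by (auto simp: A_def intro!: exI[of _ 0])
      then show ?thesis using zero_less_one by blast
    qed
    show "convex A"
    proof (rule convexI)
      fix a b and s t :: real
      assume a: "a \<in> A" and b: "b \<in> A" and st: "0 \<le> s" "0 \<le> t" "s + t = 1"
      obtain y r e where a': "a = (y, r)" "simple_function M y" "\<Phi> (y + ?v N e) - T e \<le> r"
        using a by (auto simp: A_def)
      obtain y' r' e' where b': "b = (y', r')" "simple_function M y'" "\<Phi> (y' + ?v N e') - T e' \<le> r'"
        using b by (auto simp: A_def)
      have eq: "s *\<^sub>R y + t *\<^sub>R y' + ?v N (s *\<^sub>R e + t *\<^sub>R e') = s *\<^sub>R (y + ?v N e) + t *\<^sub>R (y' + ?v N e')"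
        by (auto simp: fun_eq_iff algebra_simps)
      have "\<Phi> (s *\<^sub>R y + t *\<^sub>R y' + ?v N (s *\<^sub>R e + t *\<^sub>R e')) - T (s *\<^sub>R e + t *\<^sub>R e')
          \<le> s * (\<Phi> (y + ?v N e) - T e) + t * (\<Phi> (y' + ?v N e') - T e')"
        using conv[OF sadd[OF a'(2) vs[OF Nm]] sadd[OF b'(2) vs[OF Nm]] st, of e e'] T unfolding eq
        by (simp add: linear_add linear_scale algebra_simps)
      also have "\<dots> \<le> s * r + t * r'" using a'(3) b'(3) st by (intro add_mono mult_left_mono) auto
      finally show "s *\<^sub>R a + t *\<^sub>R b \<in> A"
        using a'(1,2) b'(1,2) by (auto simp: A_def sadd sscale)
    qed
  qed
  then obtain F where F: "linear F" and Fle: "\<And>h r. (h, r) \<in> A \<Longrightarrow> F h \<le> r" by auto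
  have F1: "F y \<le> \<Phi> (y + ?v N e) - T e" if "simple_function M y" for y e
    by (rule Fle) (use that in \<open>auto simp: A_def\<close>)
  have F2: "F y \<le> \<Phi> y" if "simple_function M y" for y
    using F1[OF that, of 0] T by (simp add: linear_0 zero_fun_def[symmetric])
  have FT: "T e = F (?v N e)" for e
  proof -
    \<comment> \<open>At y = - 1_N d and e = d the argument of \<Phi> vanishes.\<close>
    have le: "T d \<le> F (?v N d)" for d
    proof -
      have "F (- ?v N d) \<le> \<Phi> (- ?v N d + ?v N d) - T d"
        using sscale[OF vs[OF Nm], of "-1" d] by (intro F1) simp
      moreover have "\<Phi> 0 = 0" by (simp add: \<Phi>_def f_def)
      ultimately show ?thesis by (simp add: linear_neg[OF F])
    qed
    have "?v N (- e) = - ?v N e" by (auto simp: fun_eq_iff)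
    then show ?thesis using le[of e] le[of "- e"] by (simp add: linear_neg[OF F] linear_neg[OF T])
  qed
  have \<Phi>v: "\<Phi> (?v A d) = (LINT w:A|M. \<theta> w * (g x w - g (x + d) w))" if "A \<in> sets M" for A d
    unfolding \<Phi>_def set_lebesgue_integral_def
    by (rule Bochner_Integration.integral_cong) (auto simp: f_def indicator_def)
  have \<theta>i: "integrable M (\<lambda>w. \<theta> w * h w)" if "integrable M h" for h
    by (rule integrable_bounded_mult[OF \<theta>m \<theta>B that])
  have "\<exists>s. integrable M s \<and> (\<forall>A\<in>sets M. F (?v A d) = (LINT w:A|M. s w))" for d
  proof (rule dominated_additive_has_density)
    \<comment> \<open>\<open>F\<close> is bounded from above only; its value in direction - d
      provides the lower bound, so both directions enter the majorant.\<close>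
    let ?k = "\<lambda>w. \<theta> w * (\<bar>g x w - g (x + d) w\<bar> + \<bar>g x w - g (x + - d) w\<bar>)"
    show "sigma_finite_measure M" by (rule sigma_finite_measure_axioms)
    show k: "integrable M ?k" using gi by (intro \<theta>i) auto
    show "F (?v (A \<union> B) d) = F (?v A d) + F (?v B d)" if "A \<inter> B = {}" for A B
    proof -
      have "?v (A \<union> B) d = ?v A d + ?v B d" using that by (auto simp: fun_eq_iff indicator_def)
      then show ?thesis by (simp add: linear_add[OF F])
    qed
    show "\<bar>F (?v A d)\<bar> \<le> (LINT w:A|M. ?k w)" if A: "A \<in> sets M" for A
    proof -
      have b: "(LINT w:A|M. \<theta> w * (g x w - g (x + e) w)) \<le> (LINT w:A|M. ?k w)" if "e = d \<or> e = - d" for e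
      proof (rule set_integral_mono)
        show "\<theta> w * (g x w - g (x + e) w) \<le> ?k w" for w
          using that \<theta>pos[of w] by (intro mult_left_mono) auto
      qed (use A k gi in \<open>auto intro!: integrable_imp_set_integrable \<theta>i\<close>)
      have "?v A (- d) = - ?v A d" by (auto simp: fun_eq_iff)
      then have "- F (?v A d) = F (?v A (- d))" by (simp add: linear_neg[OF F])
      moreover have "F (?v A d) \<le> (LINT w:A|M. ?k w)" "F (?v A (- d)) \<le> (LINT w:A|M. ?k w)"
        by (rule order_trans[OF F2[OF vs[OF A]]], unfold \<Phi>v[OF A], rule b, simp)+
      ultimately show ?thesis by linarith
    qed
  qed
  then obtain s where si: "\<And>d. integrable M (s d)"
    and s: "\<And>d A. A \<in> sets M \<Longrightarrow> F (?v A d) = (LINT w:A|M. s d w)" by metis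
  have [measurable]: "s d \<in> borel_measurable M" for d using si by auto
  \<comment> \<open>The weight is divided out and the sign of \<open>f\<close> reversed;
    \<open>\<theta>\<close> is positive everywhere, so \<open>S\<close> is a subgradient also where
    \<open>\<xi>\<close> vanishes.\<close>
  define S where "S d w = - s d w / \<theta> w" for d w
  have [measurable]: "S d \<in> borel_measurable M" for d unfolding S_def[abs_def] by measurable
  have Sge: "AE w in M. S d w \<ge> g (x + d) w - g x w" for d
  proof -
    have "AE w in M. s d w \<le> \<theta> w * (g x w - g (x + d) w)"
      by (rule AE_le_if_set_integral_le)
        (use si gi F2[OF vs] s \<Phi>v in \<open>auto simp: sigma_finite_measure_axioms intro!: \<theta>i\<close>)
    then show ?thesis
    proof eventually_elim
      case (elim w)
      then show ?case using \<theta>pos[of w] by (simp add: S_def divide_simps algebra_simps)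
    qed
  qed
  have Sadd: "AE w in M. S (d + e) w = S d w + S e w" for d e
  proof -
    have "AE w in M. s (d + e) w = s d w + s e w"
    proof (rule density_unique_real)
      fix A assume A: "A \<in> sets M"
      have "?v A (d + e) = ?v A d + ?v A e" by (auto simp: fun_eq_iff algebra_simps)
      then have "(LINT w:A|M. s (d + e) w) = (LINT w:A|M. s d w) + (LINT w:A|M. s e w)"
        using s[OF A] by (simp add: linear_add[OF F] flip: s[OF A])
      also have "\<dots> = (LINT w:A|M. s d w + s e w)"
        using si A by (intro set_integral_add(2)[symmetric] integrable_imp_set_integrable)
      finally show "(LINT w:A|M. s (d + e) w) = (LINT w:A|M. s d w + s e w)" .
    qed (use si in auto)
    then show ?thesis by eventually_elim (simp add: S_def add_divide_distrib diff_divide_distrib)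
  qed
  have Sscale: "AE w in M. S (c *\<^sub>R d) w = c * S d w" for c d
  proof -
    have "AE w in M. s (c *\<^sub>R d) w = c * s d w"
    proof (rule density_unique_real)
      fix A assume A: "A \<in> sets M"
      have "?v A (c *\<^sub>R d) = c *\<^sub>R ?v A d" by (auto simp: fun_eq_iff algebra_simps)
      then show "(LINT w:A|M. s (c *\<^sub>R d) w) = (LINT w:A|M. c * s d w)"
        using s[OF A] by (simp add: linear_scale[OF F] flip: s[OF A])
    qed (use si in auto)
    then show ?thesis by eventually_elim (simp add: S_def)
  qed
  \<comment> \<open>The supergradient inequality in the directions d and - d, combined by linearity.
    It transfers integrability and continuity from \<open>g\<close> to \<open>S\<close>.\<close>
  have Sabs: "AE w in M. \<bar>S d w\<bar> \<le> \<bar>g (x + d) w - g x w\<bar> + \<bar>g (x + - d) w - g x w\<bar>" for d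
    using Sge[of d] Sge[of "- d"] Sscale[of "-1" d] by eventually_elim auto
  have dL: "(\<lambda>w. g (x + d) w - g x w) \<in> Lp_space M (ereal m)" for d
    by (rule Lp_space_diff[OF m gL gL])
  have SL: "S d \<in> Lp_space M (ereal m)" for d
    by (rule Lp_space_dominated(1)[OF m _ dL dL Sabs]) simp
  obtain \<delta> where \<delta>: "\<delta> > 0" "\<And>d. norm d < \<delta> \<Longrightarrow> Lp_norm M m (\<lambda>w. g (x + d) w - g x w) < 1"
    using norm_continuous_Lp_norm_less[OF gc, of 1 x] by auto
  \<comment> \<open>The constant of \<open>Lp_space_dominated\<close>, with 2 for the directions d
    and - d, whose increments have norm at most 1 within distance \<delta>.\<close>
  define K where "K = (2 powr m * 2) powr (1 / m)"
  have Ssmall: "Lp_norm M m (S d) \<le> K" if d: "norm d < \<delta>" for d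
  proof -
    have n: "(LINT w|M. \<bar>g (x + e) w - g x w\<bar> powr m) \<le> 1" if "e = d \<or> e = - d" for e
    proof -
      have "Lp_norm M m (\<lambda>w. g (x + e) w - g x w) \<le> 1"
        using \<delta>(2)[of e] that d by force
      then have "Lp_norm M m (\<lambda>w. g (x + e) w - g x w) powr m \<le> 1 powr m"
        using m by (intro powr_mono2) (auto simp: Lp_norm_def)
      then show ?thesis by (simp add: Lp_norm_powr[OF m])
    qed
    have "(LINT w|M. \<bar>S d w\<bar> powr m) \<le> 2 powr m * ((LINT w|M. \<bar>g (x + d) w - g x w\<bar> powr m) +
        (LINT w|M. \<bar>g (x + - d) w - g x w\<bar> powr m))"
      by (rule Lp_space_dominated(2)[OF m _ dL dL Sabs]) simp
    also have "\<dots> \<le> 2 powr m * 2" using n[of d] n[of "- d"] by (intro mult_left_mono) auto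
    finally show ?thesis unfolding Lp_norm_def K_def using m by (intro powr_mono2) auto
  qed
  have Sb: "Lp_norm M m (S d) \<le> (K * (2 / \<delta>)) * norm d" for d
  proof (cases "d = 0")
    case True
    have "Lp_norm M m (S 0) = Lp_norm M m (\<lambda>w. 0 * S 0 w)"
      by (rule Lp_norm_cong_AE) (use Sscale[of 0 0] in auto)
    then show ?thesis using True Lp_norm_scale[OF m, of 0 "S 0"] by simp
  next
    case False
    define c where "c = \<delta> / (2 * norm d)"
    have c: "c > 0" using False \<delta>(1) by (simp add: c_def)
    have "norm (c *\<^sub>R d) = \<delta> / 2" using False \<delta>(1) by (simp add: c_def)
    then have "Lp_norm M m (S (c *\<^sub>R d)) \<le> K" using \<delta>(1) by (intro Ssmall) auto
    also have "Lp_norm M m (S (c *\<^sub>R d)) = Lp_norm M m (\<lambda>w. c * S d w)"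
      by (rule Lp_norm_cong_AE) (use Sscale[of c d] in auto)
    also have "\<dots> = c * Lp_norm M m (S d)" using c Lp_norm_scale[OF m, of c "S d"] by simp
    finally show ?thesis using c False \<delta>(1) by (simp add: c_def field_simps)
  qed
  have "S \<in> concave_op_subdifferential M m g x"
    unfolding concave_op_subdifferential_def cont_linear_op_def
    using SL Sadd Sscale Sge Sb by blast
  moreover have "T e = (LINT w|M. \<xi> w * S e w)" for e
  proof -
    have "T e = (LINT w:N|M. s e w)" using FT s[OF Nm] by simp
    also have "\<dots> = (LINT w|M. \<xi> w * S e w)"
      unfolding set_lebesgue_integral_def
    proof (rule integral_cong_AE)
      show "AE w in M. indicat_real N w *\<^sub>R s e w = \<xi> w * S e w"
        using \<xi>0 AE_space
        by eventually_elim (auto simp: S_def N_def \<theta>_def indicator_def)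
    qed auto
    finally show ?thesis .
  qed
  ultimately show ?thesis by blast
qed

section \<open>Subgradients of mixtures of AVaR\<close>

text \<open>Used to discard the constant when a positively homogeneous expression is bounded along a
  whole ray.\<close>

lemma nonpos_if_scaled_bounded:
  fixes a D :: real
  assumes "\<And>t. t > 0 \<Longrightarrow> t * a \<le> D"
  shows "a \<le> 0"
proof (rule ccontr)
  assume a: "\<not> a \<le> 0"
  then have "((\<bar>D\<bar> + 1) / a) * a \<le> D" by (intro assms) auto
  then show False using a by simp
qed

lemma continuous_on_imp_set_integrable:
  fixes f :: "real \<Rightarrow> real"
  assumes \<mu>: "finite_measure \<mu>" "sets \<mu> = sets borel" and f: "continuous_on {a..b} f"
  shows "set_integrable \<mu> {a..b} f"
proof -
  interpret finite_measure \<mu> by fact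
  note [measurable_cong] = \<mu>(2)
  have m: "(\<lambda>p. indicat_real {a..b} p *\<^sub>R f p) \<in> borel_measurable borel"
    by (rule borel_measurable_continuous_on_indicator[OF _ f]) simp
  obtain B where B: "\<And>p. p \<in> {a..b} \<Longrightarrow> \<bar>f p\<bar> \<le> B"
    using continuous_on_interval_bounded[OF f] by blast
  show ?thesis
    unfolding set_integrable_def
  proof (rule integrable_const_bound[where B="\<bar>B\<bar>"])
    show "AE p in \<mu>. norm (indicat_real {a..b} p *\<^sub>R f p) \<le> \<bar>B\<bar>"
      using B by (intro AE_I2) (force simp: indicator_def)
  qed (use m in measurable)
qed

lemma avar_dual_set_cong_AE:
  assumes "\<zeta> \<in> avar_dual_set M p" "\<zeta>' \<in> borel_measurable M" and ae: "AE w in M. \<zeta>' w = \<zeta> w"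
  shows "\<zeta>' \<in> avar_dual_set M p"
proof -
  have "(LINT w|M. \<zeta>' w) = (LINT w|M. \<zeta> w)"
    by (rule integral_cong_AE) (use assms in \<open>auto simp: avar_dual_set_def\<close>)
  moreover have "AE w in M. - (1 / p) \<le> \<zeta> w \<and> \<zeta> w \<le> 0" using assms by (simp add: avar_dual_set_def)
  then have "AE w in M. - (1 / p) \<le> \<zeta>' w \<and> \<zeta>' w \<le> 0" using ae by eventually_elim simp
  ultimately show ?thesis using assms by (simp add: avar_dual_set_def)
qed

context prob_space
begin

section \<open>Integrability and null sets on the product space\<close>

lemma integrable_pair_fst:
  fixes h :: "'b \<Rightarrow> real"
  shows "integrable N h \<Longrightarrow> integrable (N \<Otimes>\<^sub>M M) (\<lambda>x. h (fst x))"
  by (rule integrable_distr[OF measurable_fst]) (simp add: distr_pair_fst)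

lemma integrable_pair_snd:
  fixes h :: "'a \<Rightarrow> real"
  assumes N: "prob_space N" and h: "integrable M h"
  shows "integrable (N \<Otimes>\<^sub>M M) (\<lambda>x. h (snd x))"
proof -
  interpret N: prob_space N by fact
  interpret Q: pair_prob_space M N by standard
  from Q.integrable_product_swap[OF N.integrable_pair_fst[OF h]] show ?thesis
    by (simp add: case_prod_unfold)
qed

text \<open>Fubini's theorem for null sets. The exceptional set in \<open>le\<close> depends on p,
  whereas averaging over p at fixed w calls for the opposite order of quantifiers.\<close>

lemma AE_AE_nonpos_swap:
  fixes \<zeta> :: "real \<Rightarrow> 'a \<Rightarrow> real"
  assumes N: "prob_space N" "sets N = sets borel" and A: "A \<in> sets borel"
    and \<zeta>: "(\<lambda>(p, w). \<zeta> p w) \<in> borel_measurable (borel \<Otimes>\<^sub>M M)"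
    and le: "\<And>p. p \<in> A \<Longrightarrow> AE w in M. \<zeta> p w \<le> 0"
  shows "AE w in M. AE p in N. p \<in> A \<longrightarrow> \<zeta> p w \<le> 0"
proof -
  interpret N: prob_space N by fact
  interpret P: pair_prob_space N M by standard
  have Ps: "sets (N \<Otimes>\<^sub>M M) = sets (borel \<Otimes>\<^sub>M M)" by (rule sets_pair_measure_cong[OF N(2) refl])
  have "(\<lambda>x. \<zeta> (fst x) (snd x)) \<in> borel_measurable (borel \<Otimes>\<^sub>M M)"
    using \<zeta> by (simp add: case_prod_unfold)
  then have m: "{x \<in> space (N \<Otimes>\<^sub>M M). fst x \<in> A \<longrightarrow> \<zeta> (fst x) (snd x) \<le> 0} \<in> sets (N \<Otimes>\<^sub>M M)"
    unfolding sets_eq_imp_space_eq[OF Ps] Ps using A by measurable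
  have "AE w in M. p \<in> A \<longrightarrow> \<zeta> p w \<le> 0" for p using le[of p] by (cases "p \<in> A") auto
  then have "AE p in N. AE w in M. p \<in> A \<longrightarrow> \<zeta> p w \<le> 0" by (rule AE_I2)
  then show ?thesis
    by (rule iffD1[OF P.AE_commute[of "\<lambda>p w. p \<in> A \<longrightarrow> \<zeta> p w \<le> 0", OF m]])
qed

text \<open>\<open>V e\<close> stands for \<open>g (xh + e)\<close>, with 0 as the reference point,
  and \<open>T\<close> for the normalized multiplier. The constant family with T = 0 is used as
  well, when the multiplier \<kappa> vanishes.\<close>

context
  fixes V :: "'x::real_vector \<Rightarrow> 'a \<Rightarrow> real" and T :: "'x \<Rightarrow> real"
    and \<alpha> \<beta> :: real and \<mu> :: "real measure"
  assumes \<mu>: "prob_measure_on \<alpha> \<beta> \<mu>" and \<alpha>: "0 < \<alpha>" "\<beta> \<le> 1"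
    and Vi: "\<And>e. integrable M (V e)"
    and conc: "\<And>w. w \<in> space M \<Longrightarrow> concave_on UNIV (\<lambda>e. V e w)"
    and T: "linear T"
    and Tle: "\<And>e. T e \<le> (LINT p:{\<alpha>..\<beta>}|\<mu>. avar M p (V e)) - (LINT p:{\<alpha>..\<beta>}|\<mu>. avar M p (V 0))"
begin

text \<open>The perturbation function below uses the representation
  \<open>AVaR\<^sub>p Z = inf\<^sub>\<eta> (- \<eta> + E (\<eta> - Z)\<^sup>+ / p)\<close> with \<open>\<eta>\<close> depending on \<open>p\<close>. Since \<open>\<eta>\<close> is part of
  the infimum, the constraints \<open>E \<zeta>\<^sub>p = -1\<close> and \<open>- 1 / p \<le> \<zeta>\<^sub>p \<le> 0\<close> for the density \<open>\<zeta>\<close> of the linear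
  minorant result from a substitution, and no measurable choice of optimal \<open>\<eta>\<close> is needed.\<close>

theorem avar_mixture_density:
  shows "\<exists>\<zeta>. \<zeta> \<in> borel_measurable (\<mu> \<Otimes>\<^sub>M M) \<and> (\<forall>x. \<bar>\<zeta> x\<bar> \<le> 1 / \<alpha>) \<and>
    (AE p in \<mu>. (\<lambda>w. \<zeta> (p, w)) \<in> avar_dual_set M p \<and> (LINT w|M. \<zeta> (p, w) * V 0 w) = avar M p (V 0)) \<and>
    (\<forall>e. T e \<le> (LINT x|(\<mu> \<Otimes>\<^sub>M M). \<zeta> x * (V e (snd x) - V 0 (snd x))))"
proof -
  note \<mu>p = prob_measure_onD(1)[OF \<mu>] and \<mu>s = prob_measure_onD(2)[OF \<mu>]
  interpret \<mu>: prob_space \<mu> by (rule \<mu>p)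
  interpret P: pair_prob_space \<mu> M by standard
  note [measurable_cong] = \<mu>s
  let ?P = "\<mu> \<Otimes>\<^sub>M M"
  note ae\<mu> = prob_measure_onD(3)[OF \<mu>]
  have Vm[measurable]: "V e \<in> borel_measurable M" for e using Vi by auto
  \<comment> \<open>Equal to 1 / p on the interval, which carries \<mu>, and bounded by 1 / \<alpha>
    everywhere.\<close>
  define k where "k p = 1 / max \<alpha> p" for p
  have wm[measurable]: "k \<in> borel_measurable borel" unfolding k_def[abs_def] by measurable
  have k: "0 < k p" "k p \<le> 1 / \<alpha>" "p \<in> {\<alpha>..\<beta>} \<Longrightarrow> k p = 1 / p" for p
    using \<alpha> by (auto simp: k_def frac_le)
  note fstm = integrable_pair_fst[of \<mu>] and sndm = integrable_pair_snd[OF \<mu>p]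
  have wi: "integrable ?P (\<lambda>x. k (fst x) * max 0 (U x))" if "integrable ?P U" for U :: "real \<times> 'a \<Rightarrow> real"
    by (rule P.P.integrable_bounded_mult[where B="1 / \<alpha>"]) (use that k in \<open>auto simp: abs_of_pos less_imp_le\<close>)
  define J where "J e \<eta> U = (LINT x|?P. k (fst x) * max 0 (\<eta> (fst x) - V e (snd x) - U x))" for e \<eta> U
  define c where "c = (LINT p:{\<alpha>..\<beta>}|\<mu>. avar M p (V 0))"
  have avi: "set_integrable \<mu> {\<alpha>..\<beta>} (\<lambda>p. avar M p (V e))" for e
    by (rule continuous_on_imp_set_integrable[OF \<mu>.finite_measure_axioms \<mu>s continuous_on_avar[OF Vi \<alpha>]])
  \<comment> \<open>Both \<open>e\<close> and the function \<open>\<eta>\<close> are minimized out;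
    nonnegativity at U = 0 combines \<open>int_quantile_ge\<close> for each p with
    \<open>Tle\<close>.\<close>
  define A where "A = {(U, r). integrable ?P U \<and>
     (\<exists>e \<eta>. integrable \<mu> \<eta> \<and> - (LINT p|\<mu>. \<eta> p) + J e \<eta> U - c - T e \<le> r)}"
  have Ui: "integrable ?P (\<lambda>x. \<eta> (fst x) - V e (snd x) - U x)" if "integrable \<mu> \<eta>" "integrable ?P U" for \<eta> e U
    using fstm[OF that(1)] sndm[OF Vi[of e]] that(2) by simp
  have "\<exists>F. linear F \<and> (\<forall>(U, r)\<in>A. F U \<le> r)"
  proof (rule linear_minorant_of_convex_set)
    show "subspace {U :: real \<times> 'a \<Rightarrow> real. integrable ?P U}"
      by (rule subspaceI) (auto simp: zero_fun_def plus_fun_def scaleR_fun_def)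
    show "U \<in> {U. integrable ?P U}" if "(U, r) \<in> A" for U r using that by (simp add: A_def)
    show "\<exists>t>0. \<exists>r. (t *\<^sub>R U, r) \<in> A" if "U \<in> {U. integrable ?P U}" for U
    proof -
      have "(1 *\<^sub>R U, - (LINT p|\<mu>. 0) + J 0 (\<lambda>p. 0) U - c - T 0) \<in> A"
        using that unfolding A_def mem_Collect_eq case_prod_conv scaleR_one
        by (intro conjI exI[of _ 0] exI[of _ "\<lambda>p. 0"]) simp_all
      then show ?thesis using zero_less_one by blast
    qed
    show "0 \<le> r" if "(0, r) \<in> A" for r
    proof -
      obtain e \<eta> where \<eta>: "integrable \<mu> \<eta>" and r: "- (LINT p|\<mu>. \<eta> p) + J e \<eta> 0 - c - T e \<le> r"
        using \<open>(0, r) \<in> A\<close> by (auto simp: A_def)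
      have i: "integrable ?P (\<lambda>x. k (fst x) * max 0 (\<eta> (fst x) - V e (snd x) - 0))"
        by (intro wi Ui[OF \<eta>]) simp
      then have i': "integrable ?P (\<lambda>(p, w). k p * max 0 (\<eta> p - V e w))" by (simp add: case_prod_unfold)
      have J: "J e \<eta> 0 = (LINT p|\<mu>. LINT w|M. k p * max 0 (\<eta> p - V e w))"
        using P.integral_fst'[OF i'] by (simp add: J_def case_prod_unfold)
      have i2: "integrable \<mu> (\<lambda>p. LINT w|M. k p * max 0 (\<eta> p - V e w))" using P.integrable_fst'[OF i'] by simp
      have "(LINT p:{\<alpha>..\<beta>}|\<mu>. avar M p (V e)) \<le> (LINT p|\<mu>. - \<eta> p + (LINT w|M. k p * max 0 (\<eta> p - V e w)))"
        unfolding set_lebesgue_integral_def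
      proof (rule integral_mono_AE)
        show "AE p in \<mu>. indicat_real {\<alpha>..\<beta>} p *\<^sub>R avar M p (V e) \<le> - \<eta> p + (LINT w|M. k p * max 0 (\<eta> p - V e w))"
          using ae\<mu>
        proof eventually_elim
          case (elim p)
          then have p: "0 < p" "p \<le> 1" using \<alpha> by auto
          have "\<eta> p * p - (LINT w|M. max 0 (\<eta> p - V e w)) \<le> int_quantile M (V e) p"
            by (rule int_quantile_ge[OF Vi]) (use p in auto)
          then have "avar M p (V e) \<le> - \<eta> p + (1 / p) * (LINT w|M. max 0 (\<eta> p - V e w))"
            using p by (simp add: avar_def field_simps)
          then show ?case using elim k(3)[OF elim] by simp
        qed
      qed (use avi \<eta> i2 in \<open>auto simp: set_integrable_def\<close>)
      also have "\<dots> = - (LINT p|\<mu>. \<eta> p) + J e \<eta> 0" using \<eta> i2 by (simp add: J)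
      finally show ?thesis using r Tle[of e] by (simp add: c_def)
    qed
    show "convex A"
    proof (rule convexI)
      fix a b and s t :: real
      assume a: "a \<in> A" and b: "b \<in> A" and st: "0 \<le> s" "0 \<le> t" "s + t = 1"
      obtain U r e \<eta> where a': "a = (U, r)" "integrable ?P U" "integrable \<mu> \<eta>" "- (LINT p|\<mu>. \<eta> p) + J e \<eta> U - c - T e \<le> r"
        using a by (auto simp: A_def)
      obtain U' r' e' \<eta>' where b': "b = (U', r')" "integrable ?P U'" "integrable \<mu> \<eta>'" "- (LINT p|\<mu>. \<eta>' p) + J e' \<eta>' U' - c - T e' \<le> r'"
        using b by (auto simp: A_def)
      let ?\<eta> = "\<lambda>p. s * \<eta> p + t * \<eta>' p" and ?e = "s *\<^sub>R e + t *\<^sub>R e'" and ?U = "s *\<^sub>R U + t *\<^sub>R U'"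
      have UU: "integrable ?P ?U" using a'(2) b'(2) by (simp add: plus_fun_def scaleR_fun_def)
      have \<eta>\<eta>: "integrable \<mu> ?\<eta>" using a'(3) b'(3) by simp
      note ia = wi[OF Ui[OF a'(3,2)], of e] and ib = wi[OF Ui[OF b'(3,2)], of e']
      have "J ?e ?\<eta> ?U \<le> (LINT x|?P. s * (k (fst x) * max 0 (\<eta> (fst x) - V e (snd x) - U x))
          + t * (k (fst x) * max 0 (\<eta>' (fst x) - V e' (snd x) - U' x)))"
        unfolding J_def
      proof (rule integral_mono)
        fix x assume "x \<in> space ?P"
        then have "snd x \<in> space M" by (auto simp: space_pair_measure)
        then have g: "s * V e (snd x) + t * V e' (snd x) \<le> V ?e (snd x)"
          using conc[of "snd x"] st by (auto simp: concave_on_iff)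
        let ?a = "\<eta> (fst x) - V e (snd x) - U x" and ?b = "\<eta>' (fst x) - V e' (snd x) - U' x"
        have "s * ?a \<le> s * max 0 ?a" "t * ?b \<le> t * max 0 ?b" "0 \<le> s * max 0 ?a" "0 \<le> t * max 0 ?b"
          using st by (auto intro: mult_left_mono)
        then have "max 0 (?\<eta> (fst x) - V ?e (snd x) - ?U x) \<le> s * max 0 ?a + t * max 0 ?b"
          using g by (simp add: algebra_simps)
        then have "k (fst x) * max 0 (?\<eta> (fst x) - V ?e (snd x) - ?U x) \<le> k (fst x) * (s * max 0 ?a + t * max 0 ?b)"
          using k(1)[of "fst x"] by (intro mult_left_mono) auto
        then show "k (fst x) * max 0 (?\<eta> (fst x) - V ?e (snd x) - ?U x) \<le> s * (k (fst x) * max 0 ?a) + t * (k (fst x) * max 0 ?b)"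
          by (simp add: algebra_simps)
      qed (use ia ib wi[OF Ui[OF \<eta>\<eta> UU], of ?e] in auto)
      also have "\<dots> = s * J e \<eta> U + t * J e' \<eta>' U'" using ia ib by (simp add: J_def)
      finally have Jc: "J ?e ?\<eta> ?U \<le> s * J e \<eta> U + t * J e' \<eta>' U'" .
      have "- (LINT p|\<mu>. ?\<eta> p) + J ?e ?\<eta> ?U - c - T ?e \<le>
          - (s * (LINT p|\<mu>. \<eta> p) + t * (LINT p|\<mu>. \<eta>' p)) + (s * J e \<eta> U + t * J e' \<eta>' U') - (s + t) * c - (s * T e + t * T e')"
        using Jc st a'(3) b'(3) T by (simp add: linear_add linear_scale)
      also have "\<dots> = s * (- (LINT p|\<mu>. \<eta> p) + J e \<eta> U - c - T e) + t * (- (LINT p|\<mu>. \<eta>' p) + J e' \<eta>' U' - c - T e')"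
        by (simp add: algebra_simps)
      also have "\<dots> \<le> s * r + t * r'" using a'(4) b'(4) st by (intro add_mono mult_left_mono) auto
      finally show "s *\<^sub>R a + t *\<^sub>R b \<in> A"
        unfolding A_def a'(1) b'(1) using UU \<eta>\<eta> by auto
    qed
  qed
  then obtain F where F: "linear F" and Fle: "\<And>U r. (U, r) \<in> A \<Longrightarrow> F U \<le> r" by auto
  have Fadd: "F (\<lambda>x. u x + v x) = F u + F v" for u v using linear_add[OF F, of u v] by (simp add: plus_fun_def)
  have Fdiff: "F (\<lambda>x. u x - v x) = F u - F v" for u v using linear_diff[OF F, of u v] by (simp add: fun_diff_def)
  have Fscale: "F (\<lambda>x. a * u x) = a * F u" for a u using linear_scale[OF F, of a u] by (simp add: scaleR_fun_def)
  have F0: "F (\<lambda>x. 0) = 0" using Fscale[of 0 "\<lambda>x. 0"] by simp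
  let ?W = "\<lambda>U. LINT x|?P. k (fst x) * max 0 (U x)"
  have main: "F (\<lambda>x. \<eta> (fst x)) - F (\<lambda>x. V e (snd x)) - F U \<le> - (LINT p|\<mu>. \<eta> p) + ?W U - c - T e"
    if \<eta>: "integrable \<mu> \<eta>" and U: "integrable ?P U" for e \<eta> U
  proof -
    \<comment> \<open>This perturbation cancels \<eta> and \<open>V e\<close> inside the positive
      part and leaves \<open>U\<close>. By linearity of \<open>F\<close>, the three can then be
      varied independently.\<close>
    have "F (\<lambda>x. \<eta> (fst x) - V e (snd x) - U x) \<le> - (LINT p|\<mu>. \<eta> p) + J e \<eta> (\<lambda>x. \<eta> (fst x) - V e (snd x) - U x) - c - T e"
      by (rule Fle) (use \<eta> Ui[OF \<eta> U] in \<open>auto simp: A_def\<close>)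
    then show ?thesis by (simp add: Fdiff J_def)
  qed
  have T0: "T 0 = 0" by (rule linear_0[OF T])
  have F\<eta>: "F (\<lambda>x. \<eta> (fst x)) = - (LINT p|\<mu>. \<eta> p)" if \<eta>: "integrable \<mu> \<eta>" for \<eta>
  proof -
    \<comment> \<open>Scaling h and - h leaves only the equality that expresses mean -1 of the
      density.\<close>
    have le: "F (\<lambda>x. h (fst x)) + (LINT p|\<mu>. h p) \<le> 0" if h: "integrable \<mu> h" for h
    proof (rule nonpos_if_scaled_bounded)
      fix t :: real
      show "t * (F (\<lambda>x. h (fst x)) + (LINT p|\<mu>. h p)) \<le> F (\<lambda>x. V 0 (snd x)) - c"
        using main[of "\<lambda>p. t * h p" "\<lambda>x. 0" 0] h by (simp add: Fscale F0 T0 algebra_simps)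
    qed
    show ?thesis using le[OF \<eta>] le[of "\<lambda>p. -1 * \<eta> p"] \<eta> Fscale[of "-1" "\<lambda>x. \<eta> (fst x)"] by simp
  qed
  \<comment> \<open>The functional form of - k \<le> \<zeta> \<le> 0: taking U to be an indicator
    gives the lower bound, and the negative of an indicator, whose positive part is 0, the upper
    one.\<close>
  have FW: "- F U \<le> ?W U" if U: "integrable ?P U" for U
  proof -
    have "- F U - ?W U \<le> 0"
    proof (rule nonpos_if_scaled_bounded)
      fix t :: real assume t: "t > 0"
      have "?W (\<lambda>x. t * U x) = (LINT x|?P. t * (k (fst x) * max 0 (U x)))"
        using t by (intro Bochner_Integration.integral_cong) (auto simp: max_def zero_le_mult_iff mult_le_0_iff)
      then show "t * (- F U - ?W U) \<le> F (\<lambda>x. V 0 (snd x)) - c"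
        using main[of "\<lambda>p. 0" "\<lambda>x. t * U x" 0] U by (simp add: Fscale F0 T0 algebra_simps)
    qed
    then show ?thesis by simp
  qed
  have FT: "T e \<le> F (\<lambda>x. V e (snd x)) - c" for e
    using main[of "\<lambda>p. 0" "\<lambda>x. 0" e] by (simp add: F0)
  have Wb: "?W U \<le> (1 / \<alpha>) * (LINT x|?P. \<bar>U x\<bar>)" if U: "integrable ?P U" for U
  proof -
    have "?W U \<le> (LINT x|?P. (1 / \<alpha>) * \<bar>U x\<bar>)"
      using k \<alpha> by (intro integral_mono wi U mult_mono) (use U in \<open>auto simp: less_imp_le\<close>)
    then show ?thesis by simp
  qed
  have Fb: "\<bar>F U\<bar> \<le> (1 / \<alpha>) * (LINT x|?P. \<bar>U x\<bar>)" if U: "integrable ?P U" for U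
    using FW[OF U] Wb[OF U] FW[of "\<lambda>x. -1 * U x"] Wb[of "\<lambda>x. -1 * U x"] U Fscale[of "-1" U]
    by (simp add: abs_le_iff)
  obtain \<zeta> where \<zeta>m[measurable]: "\<zeta> \<in> borel_measurable ?P" and \<zeta>b: "\<And>x. \<bar>\<zeta> x\<bar> \<le> 1 / \<alpha>"
    and F\<zeta>: "\<And>U. integrable ?P U \<Longrightarrow> F U = (LINT x|?P. \<zeta> x * U x)"
    using L1_functional_has_density[of ?P F "1 / \<alpha>"] Fadd Fscale Fb P.P.finite_measure_axioms \<alpha> by auto
  have \<zeta>i: "integrable ?P (\<lambda>x. \<zeta> x * U x)" if "integrable ?P U" for U
    by (rule P.P.integrable_bounded_mult[OF \<zeta>m AE_I2[OF \<zeta>b] that])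
  have \<zeta>1: "integrable ?P \<zeta>" using \<zeta>i[of "\<lambda>x. 1"] by simp
  have ind: "integrable ?P (indicat_real A)" if "A \<in> sets ?P" for A
    using that by (intro P.P.integrable_const_bound[where B=1]) auto
  have w1: "integrable ?P (\<lambda>x. k (fst x))" using wi[of "\<lambda>x. 1"] by simp
  have \<zeta>s: "(\<lambda>w. \<zeta> (p, w)) \<in> borel_measurable M" for p
    by (rule measurable_Pair2[OF \<zeta>m]) (simp add: sets_eq_imp_space_eq[OF \<mu>s])
  have up: "AE x in ?P. \<zeta> x \<le> 0"
  proof (rule AE_le_if_set_integral_le)
    fix A assume A: "A \<in> sets ?P"
    have "- F (\<lambda>x. -1 * indicat_real A x) \<le> ?W (\<lambda>x. -1 * indicat_real A x)"
      by (rule FW) (use ind[OF A] in simp)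
    also have "?W (\<lambda>x. -1 * indicat_real A x) = (LINT x|?P. 0)"
      by (rule Bochner_Integration.integral_cong) (auto simp: indicator_def)
    finally have "F (indicat_real A) \<le> 0" using Fscale[of "-1" "indicat_real A"] by simp
    then show "(LINT x:A|?P. \<zeta> x) \<le> (LINT x:A|?P. 0)"
      using F\<zeta>[OF ind[OF A]] by (simp add: set_lebesgue_integral_def mult.commute)
  qed (use \<zeta>1 P.P.sigma_finite_measure_axioms in auto)
  have lo: "AE x in ?P. - k (fst x) \<le> \<zeta> x"
  proof (rule AE_le_if_set_integral_le)
    fix A assume A: "A \<in> sets ?P"
    have "- F (indicat_real A) \<le> ?W (indicat_real A)" by (rule FW[OF ind[OF A]])
    then show "(LINT x:A|?P. - k (fst x)) \<le> (LINT x:A|?P. \<zeta> x)"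
      using F\<zeta>[OF ind[OF A]] by (simp add: set_lebesgue_integral_def mult.commute)
  qed (use \<zeta>1 w1 P.P.sigma_finite_measure_axioms in auto)
  have fub: "integrable \<mu> (\<lambda>p. LINT w|M. \<zeta> (p, w) * U (p, w))"
    "(LINT p|\<mu>. LINT w|M. \<zeta> (p, w) * U (p, w)) = (LINT x|?P. \<zeta> x * U x)" if "integrable ?P U" for U
    using P.integrable_fst'[OF \<zeta>i[OF that]] P.integral_fst'[OF \<zeta>i[OF that]] by auto
  have Em: "AE p in \<mu>. (LINT w|M. \<zeta> (p, w)) = -1"
  proof (rule density_unique_real)
    show "integrable \<mu> (\<lambda>p. LINT w|M. \<zeta> (p, w))" using fub(1)[of "\<lambda>x. 1"] by simp
    fix A assume A: "A \<in> sets \<mu>"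
    have i: "integrable \<mu> (indicat_real A)" using A by (intro \<mu>.integrable_const_bound[where B=1]) auto
    have "(LINT p:A|\<mu>. LINT w|M. \<zeta> (p, w)) = (LINT p|\<mu>. LINT w|M. \<zeta> (p, w) * indicat_real A (fst (p, w)))"
      unfolding set_lebesgue_integral_def by (simp add: mult.commute)
    also have "\<dots> = F (\<lambda>x. indicat_real A (fst x))"
      by (subst fub(2)[OF fstm[OF i]]) (rule F\<zeta>[OF fstm[OF i], symmetric])
    also have "\<dots> = (LINT p:A|\<mu>. -1)" using F\<eta>[OF i] by (simp add: set_lebesgue_integral_def)
    finally show "(LINT p:A|\<mu>. LINT w|M. \<zeta> (p, w)) = (LINT p:A|\<mu>. -1)" .
  qed simp
  have "AE x in ?P. - k (fst x) \<le> \<zeta> x \<and> \<zeta> x \<le> 0" using lo up by eventually_elim simp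
  then have "AE p in \<mu>. AE w in M. - k p \<le> \<zeta> (p, w) \<and> \<zeta> (p, w) \<le> 0"
    using P.AE_pair by fastforce
  then have dual: "AE p in \<mu>. (\<lambda>w. \<zeta> (p, w)) \<in> avar_dual_set M p"
    using Em ae\<mu> by eventually_elim (auto simp: avar_dual_set_def k(3) \<zeta>s)
  note V0 = sndm[OF Vi[of 0]]
  let ?E = "\<lambda>p. LINT w|M. \<zeta> (p, w) * V 0 w"
  have Ei: "integrable \<mu> ?E" and EF: "(LINT p|\<mu>. ?E p) = F (\<lambda>x. V 0 (snd x))"
    using fub[OF V0] F\<zeta>[OF V0] by auto
  have le: "AE p in \<mu>. ?E p \<le> indicat_real {\<alpha>..\<beta>} p *\<^sub>R avar M p (V 0)"
    using dual ae\<mu>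
  proof eventually_elim
    case (elim p)
    then show ?case using expectation_le_avar[OF elim(1) _ _ Vi] \<alpha> by auto
  qed
  \<comment> \<open>\<open>FT\<close> at e = 0 bounds the integral of the nonnegative duality gap by
    0, so the gap vanishes for almost every p.\<close>
  have "(LINT p|\<mu>. indicat_real {\<alpha>..\<beta>} p *\<^sub>R avar M p (V 0) - ?E p) \<le> 0"
    using avi[of 0] Ei FT[of 0] EF by (simp add: set_integrable_def c_def set_lebesgue_integral_def T0)
  moreover have "0 \<le> (LINT p|\<mu>. indicat_real {\<alpha>..\<beta>} p *\<^sub>R avar M p (V 0) - ?E p)"
    by (rule integral_nonneg_AE) (use le in \<open>auto elim: eventually_mono\<close>)
  ultimately have z: "(LINT p|\<mu>. indicat_real {\<alpha>..\<beta>} p *\<^sub>R avar M p (V 0) - ?E p) = 0" by simp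
  have "AE p in \<mu>. indicat_real {\<alpha>..\<beta>} p *\<^sub>R avar M p (V 0) - ?E p = 0"
    using z by (subst (asm) integral_nonneg_eq_0_iff_AE)
      (use avi[of 0] Ei le in \<open>auto simp: set_integrable_def elim: eventually_mono\<close>)
  then have eq: "AE p in \<mu>. ?E p = avar M p (V 0)" using ae\<mu> by eventually_elim simp
  have c: "c = F (\<lambda>x. V 0 (snd x))"
    using z avi[of 0] Ei EF by (simp add: set_integrable_def c_def set_lebesgue_integral_def)
  have "T e \<le> (LINT x|?P. \<zeta> x * (V e (snd x) - V 0 (snd x)))" for e
    using FT[of e] F\<zeta>[of "\<lambda>x. V e (snd x) - V 0 (snd x)"] sndm[OF Vi[of e]] V0 by (simp add: c Fdiff)
  moreover have "AE p in \<mu>. (\<lambda>w. \<zeta> (p, w)) \<in> avar_dual_set M p \<and> ?E p = avar M p (V 0)"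
    using dual eq by eventually_elim simp
  ultimately show ?thesis using \<zeta>m \<zeta>b by blast
qed

text \<open>Membership in the subdifferential is required for every p in the interval, while the
  density provides almost every p. On the exceptional null set it is replaced by the explicit
  maximizer, which leaves the product integral unchanged; Fubini's theorem then brings in the
  average over p.\<close>

theorem avar_mixture_subgradient:
  shows "\<exists>\<zeta>. (\<lambda>(p, w). \<zeta> p w) \<in> borel_measurable (borel \<Otimes>\<^sub>M M) \<and> (\<forall>p w. \<bar>\<zeta> p w\<bar> \<le> 1 / \<alpha>) \<and>
    (\<forall>p\<in>{\<alpha>..\<beta>}. \<zeta> p \<in> avar_dual_set M p \<and> (LINT w|M. \<zeta> p w * V 0 w) = avar M p (V 0)) \<and>
    (\<forall>e. T e \<le> (LINT w|M. (LINT p:{\<alpha>..\<beta>}|\<mu>. \<zeta> p w) * (V e w - V 0 w)))"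
proof -
  note \<mu>p = prob_measure_onD(1)[OF \<mu>] and \<mu>s = prob_measure_onD(2)[OF \<mu>]
  interpret \<mu>: prob_space \<mu> by (rule \<mu>p)
  interpret P: pair_prob_space \<mu> M by standard
  note [measurable_cong] = \<mu>s
  let ?P = "\<mu> \<Otimes>\<^sub>M M"
  note ae\<mu> = prob_measure_onD(3)[OF \<mu>]
  have Ps: "sets ?P = sets (borel \<Otimes>\<^sub>M M)" by (rule sets_pair_measure_cong[OF \<mu>s refl])
  obtain \<zeta>0 where \<zeta>0m[measurable]: "\<zeta>0 \<in> borel_measurable ?P" and \<zeta>0b: "\<And>x. \<bar>\<zeta>0 x\<bar> \<le> 1 / \<alpha>"
    and \<zeta>0: "AE p in \<mu>. (\<lambda>w. \<zeta>0 (p, w)) \<in> avar_dual_set M p \<and> (LINT w|M. \<zeta>0 (p, w) * V 0 w) = avar M p (V 0)"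
    and T\<zeta>0: "\<And>e. T e \<le> (LINT x|?P. \<zeta>0 x * (V e (snd x) - V 0 (snd x)))"
    using avar_mixture_density by blast
  obtain N where N: "N \<in> null_sets \<mu>" and good': "\<And>p. p \<in> space \<mu> - N \<Longrightarrow>
      (\<lambda>w. \<zeta>0 (p, w)) \<in> avar_dual_set M p \<and> (LINT w|M. \<zeta>0 (p, w) * V 0 w) = avar M p (V 0)"
  proof -
    from AE_E3[OF \<zeta>0] show ?thesis using that by metis
  qed
  have good: "(\<lambda>w. \<zeta>0 (p, w)) \<in> avar_dual_set M p" "(LINT w|M. \<zeta>0 (p, w) * V 0 w) = avar M p (V 0)" if "p \<notin> N" for p
    using good'[of p] that by (simp_all add: sets_eq_imp_space_eq[OF \<mu>s])
  have Nm[measurable]: "N \<in> sets borel" using N \<mu>s by auto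
  obtain d where dm[measurable]: "(\<lambda>(p, w). d p w) \<in> borel_measurable (borel \<Otimes>\<^sub>M M)"
    and d: "\<And>p. p \<in> {0<..1} \<Longrightarrow> d p \<in> avar_dual_set M p \<and> (LINT w|M. d p w * V 0 w) = avar M p (V 0)"
    using avar_measurable_maximizer[OF Vi[of 0]] by blast
  \<comment> \<open>For p in the interval, elements of the dual set lie between - 1 / p and 0 almost
    everywhere, so the truncation changes a null set only; it makes the bound valid
    everywhere.\<close>
  define \<zeta> where "\<zeta> p w = max (- (1 / \<alpha>)) (min (1 / \<alpha>) (if p \<in> N then d p w else \<zeta>0 (p, w)))" for p w
  have \<zeta>m: "(\<lambda>(p, w). \<zeta> p w) \<in> borel_measurable (borel \<Otimes>\<^sub>M M)"
  proof -
    have "\<zeta>0 \<in> borel_measurable (borel \<Otimes>\<^sub>M M)" using \<zeta>0m measurable_cong_sets[OF Ps refl] by blast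
    moreover have "(\<lambda>x. d (fst x) (snd x)) \<in> borel_measurable (borel \<Otimes>\<^sub>M M)"
      using dm by (simp add: case_prod_unfold)
    ultimately have "(\<lambda>x. max (- (1 / \<alpha>)) (min (1 / \<alpha>) (if fst x \<in> N then d (fst x) (snd x) else \<zeta>0 x)))
        \<in> borel_measurable (borel \<Otimes>\<^sub>M M)" by measurable
    then show ?thesis by (simp add: \<zeta>_def case_prod_unfold)
  qed
  have \<zeta>b: "\<bar>\<zeta> p w\<bar> \<le> 1 / \<alpha>" for p w using \<alpha> by (auto simp: \<zeta>_def abs_le_iff)
  have \<zeta>s: "\<zeta> p \<in> borel_measurable M" for p
    using measurable_Pair2[OF \<zeta>m, of p] by simp
  have "\<zeta> p \<in> avar_dual_set M p \<and> (LINT w|M. \<zeta> p w * V 0 w) = avar M p (V 0)" if p: "p \<in> {\<alpha>..\<beta>}" for p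
  proof -
    define z where "z = (if p \<in> N then d p else (\<lambda>w. \<zeta>0 (p, w)))"
    have z: "z \<in> avar_dual_set M p" "(LINT w|M. z w * V 0 w) = avar M p (V 0)"
      using good[of p] d[of p] p \<alpha> by (auto simp: z_def)
    have "AE w in M. - (1 / p) \<le> z w \<and> z w \<le> 0" using z by (simp add: avar_dual_set_def)
    then have ae: "AE w in M. \<zeta> p w = z w"
    proof eventually_elim
      case (elim w)
      have "1 / p \<le> 1 / \<alpha>" using p \<alpha> by (simp add: frac_le)
      moreover have "0 < 1 / \<alpha>" using \<alpha> by simp
      moreover have "\<zeta> p w = max (- (1 / \<alpha>)) (min (1 / \<alpha>) (z w))" by (simp add: \<zeta>_def z_def)
      ultimately show ?case using elim by linarith
    qed
    have "(LINT w|M. \<zeta> p w * V 0 w) = (LINT w|M. z w * V 0 w)"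
      by (rule integral_cong_AE) (use ae z Vi[of 0] \<zeta>s[of p] in \<open>auto simp: avar_dual_set_def elim: eventually_mono\<close>)
    then show ?thesis using avar_dual_set_cong_AE[OF z(1) \<zeta>s ae] z(2) by simp
  qed
  moreover have "T e \<le> (LINT w|M. (LINT p:{\<alpha>..\<beta>}|\<mu>. \<zeta> p w) * (V e w - V 0 w))" for e
  proof -
    have \<zeta>mP: "(\<lambda>x. \<zeta> (fst x) (snd x)) \<in> borel_measurable ?P"
      using \<zeta>m unfolding measurable_cong_sets[OF Ps refl] by (simp add: case_prod_unfold)
    have eq: "\<zeta> p w = \<zeta>0 (p, w)" if "p \<notin> N" for p w
      using that \<zeta>0b[of "(p, w)"] \<alpha> by (simp add: \<zeta>_def abs_le_iff)
    have "AE p in \<mu>. p \<notin> N" by (rule AE_not_in[OF N])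
    then have aeP: "AE x in ?P. fst x \<notin> N"
      by (intro P.AE_pair_measure) auto
    have Vi2: "integrable ?P (\<lambda>x. V e (snd x) - V 0 (snd x))"
      by (rule integrable_pair_snd[OF \<mu>p]) (simp add: Vi)
    have i: "integrable ?P (\<lambda>x. \<zeta> (fst x) (snd x) * (V e (snd x) - V 0 (snd x)))"
      by (rule P.P.integrable_bounded_mult[OF \<zeta>mP AE_I2[OF \<zeta>b] Vi2])
    then have i': "integrable ?P (\<lambda>(p, w). \<zeta> p w * (V e w - V 0 w))" by (simp add: case_prod_unfold)
    have "(LINT x|?P. \<zeta>0 x * (V e (snd x) - V 0 (snd x))) = (LINT x|?P. \<zeta> (fst x) (snd x) * (V e (snd x) - V 0 (snd x)))"
    proof (rule integral_cong_AE)
      show "AE x in ?P. \<zeta>0 x * (V e (snd x) - V 0 (snd x)) = \<zeta> (fst x) (snd x) * (V e (snd x) - V 0 (snd x))"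
        using aeP by eventually_elim (simp add: eq)
    qed (use i \<zeta>0m Vi2 in auto)
    also have "\<dots> = (LINT w|M. LINT p|\<mu>. \<zeta> p w * (V e w - V 0 w))"
      using P.integral_snd[OF i'] by (simp add: case_prod_unfold)
    also have "\<dots> = (LINT w|M. (LINT p:{\<alpha>..\<beta>}|\<mu>. \<zeta> p w) * (V e w - V 0 w))"
    proof (rule Bochner_Integration.integral_cong[OF refl])
      fix w assume w: "w \<in> space M"
      have [measurable]: "(\<lambda>p. \<zeta> p w) \<in> borel_measurable borel"
        using measurable_Pair1[OF \<zeta>m w] by simp
      have "(LINT p|\<mu>. \<zeta> p w) = (LINT p:{\<alpha>..\<beta>}|\<mu>. \<zeta> p w)"
        unfolding set_lebesgue_integral_def
        by (rule integral_cong_AE) (use ae\<mu> in \<open>auto elim: eventually_mono\<close>)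
      then show "(LINT p|\<mu>. \<zeta> p w * (V e w - V 0 w)) = (LINT p:{\<alpha>..\<beta>}|\<mu>. \<zeta> p w) * (V e w - V 0 w)"
        by simp
    qed
    finally show ?thesis using T\<zeta>0[of e] by simp
  qed
  ultimately show ?thesis using \<zeta>m \<zeta>b by blast
qed

end

text \<open>The average inherits the bound of \<open>\<zeta>\<close> pointwise, but its sign only
  almost everywhere, after a change in the order of the null sets.\<close>

lemma AVaR_subdifferential_integralI:
  fixes \<zeta> :: "real \<Rightarrow> 'a \<Rightarrow> real"
  assumes m: "1 \<le> m" and Z: "Z \<in> Lp_space M (ereal m)"
    and \<mu>: "prob_measure_on \<alpha> \<beta> \<mu>" and \<alpha>: "0 < \<alpha>" "\<beta> \<le> 1"
    and \<zeta>m: "(\<lambda>(p, w). \<zeta> p w) \<in> borel_measurable (borel \<Otimes>\<^sub>M M)"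
    and \<zeta>b: "\<And>p w. \<bar>\<zeta> p w\<bar> \<le> 1 / \<alpha>"
    and \<zeta>: "\<And>p. p \<in> {\<alpha>..\<beta>} \<Longrightarrow> \<zeta> p \<in> avar_dual_set M p \<and> (LINT w|M. \<zeta> p w * Z w) = avar M p Z"
  defines "\<xi> \<equiv> \<lambda>w. LINT p:{\<alpha>..\<beta>}|\<mu>. \<zeta> p w"
  shows "\<xi> \<in> AVaR_subdifferential_integral M m \<mu> \<alpha> \<beta> Z" and "\<xi> \<in> borel_measurable M"
    and "AE w in M. \<xi> w \<le> 0" and "AE w in M. \<bar>\<xi> w\<bar> \<le> 1 / \<alpha>"
proof -
  note \<mu>p = prob_measure_onD(1)[OF \<mu>] and \<mu>s = prob_measure_onD(2)[OF \<mu>]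
  interpret \<mu>: prob_space \<mu> by (rule \<mu>p)
  note [measurable_cong] = \<mu>s
  have Ps': "sets (M \<Otimes>\<^sub>M \<mu>) = sets (M \<Otimes>\<^sub>M borel)" by (rule sets_pair_measure_cong[OF refl \<mu>s])
  have [measurable]: "(\<lambda>x. \<zeta> (fst x) (snd x)) \<in> borel_measurable (borel \<Otimes>\<^sub>M M)"
    using \<zeta>m by (simp add: case_prod_unfold)
  have \<zeta>w: "(\<lambda>p. \<zeta> p w) \<in> borel_measurable borel" if "w \<in> space M" for w
    using measurable_Pair1[OF \<zeta>m that] by simp
  show \<xi>m: "\<xi> \<in> borel_measurable M"
    unfolding \<xi>_def set_lebesgue_integral_def
  proof (rule \<mu>.borel_measurable_lebesgue_integral)
    have "(\<lambda>x. indicat_real {\<alpha>..\<beta>} (snd x) *\<^sub>R \<zeta> (snd x) (fst x)) \<in> borel_measurable (M \<Otimes>\<^sub>M borel)"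
      using measurable_compose[OF measurable_pair_swap'[of M borel] \<zeta>m] by (simp add: case_prod_unfold)
    then show "(\<lambda>(w, p). indicat_real {\<alpha>..\<beta>} p *\<^sub>R \<zeta> p w) \<in> borel_measurable (M \<Otimes>\<^sub>M \<mu>)"
      unfolding measurable_cong_sets[OF Ps' refl] by (simp add: case_prod_unfold)
  qed
  have si: "set_integrable \<mu> {\<alpha>..\<beta>} (\<lambda>p. \<zeta> p w)" if "w \<in> space M" for w
    unfolding set_integrable_def
  proof (rule \<mu>.integrable_const_bound[where B="1 / \<alpha>"])
    have "\<bar>indicat_real {\<alpha>..\<beta>} p\<bar> * \<bar>\<zeta> p w\<bar> \<le> 1 * (1 / \<alpha>)" for p
      by (intro mult_mono \<zeta>b) (auto simp: indicator_def)
    then show "AE p in \<mu>. norm (indicat_real {\<alpha>..\<beta>} p *\<^sub>R \<zeta> p w) \<le> 1 / \<alpha>"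
      by (intro AE_I2) (simp add: abs_mult)
  qed (use \<zeta>w[OF that] in measurable)
  have \<xi>b: "\<bar>\<xi> w\<bar> \<le> 1 / \<alpha>" if "w \<in> space M" for w
  proof -
    have "\<bar>\<xi> w\<bar> \<le> (LINT p|\<mu>. \<bar>indicat_real {\<alpha>..\<beta>} p *\<^sub>R \<zeta> p w\<bar>)"
      unfolding \<xi>_def set_lebesgue_integral_def by (rule integral_abs_bound)
    also have "\<dots> \<le> (LINT p|\<mu>. 1 / \<alpha>)"
    proof (rule integral_mono)
      show "integrable \<mu> (\<lambda>p. \<bar>indicat_real {\<alpha>..\<beta>} p *\<^sub>R \<zeta> p w\<bar>)"
        using si[OF that] unfolding set_integrable_def by (rule integrable_abs)
      show "\<bar>indicat_real {\<alpha>..\<beta>} p *\<^sub>R \<zeta> p w\<bar> \<le> 1 / \<alpha>" for p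
        using \<zeta>b[of p w] \<alpha> by (auto simp: indicator_def)
    qed simp
    also have "\<dots> = 1 / \<alpha>" by (simp add: \<mu>.prob_space)
    finally show ?thesis .
  qed
  then show \<xi>B: "AE w in M. \<bar>\<xi> w\<bar> \<le> 1 / \<alpha>" by (rule AE_I2)
  have "AE w in M. AE p in \<mu>. p \<in> {\<alpha>..\<beta>} \<longrightarrow> \<zeta> p w \<le> 0"
    by (rule AE_AE_nonpos_swap[OF \<mu>p \<mu>s _ \<zeta>m]) (use \<zeta> in \<open>auto simp: avar_dual_set_def\<close>)
  then show "AE w in M. \<xi> w \<le> 0"
  proof eventually_elim
    case (elim w)
    have "0 \<le> (LINT p|\<mu>. - (indicat_real {\<alpha>..\<beta>} p *\<^sub>R \<zeta> p w))"
      by (rule integral_nonneg_AE) (use elim in \<open>auto simp: indicator_def elim: eventually_mono\<close>)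
    then show ?case by (simp add: \<xi>_def set_lebesgue_integral_def)
  qed
  show "\<xi> \<in> AVaR_subdifferential_integral M m \<mu> \<alpha> \<beta> Z"
    unfolding AVaR_subdifferential_integral_def
  proof (intro CollectI conjI exI[of _ \<zeta>] ballI)
    show "\<xi> \<in> Lp_space M (conj_exponent m)" by (rule bounded_in_Lp_space[OF m \<xi>m \<xi>B])
    show "\<zeta> p \<in> AVaR_subdifferential M m p Z" if "p \<in> {\<alpha>..\<beta>}" for p
      by (rule AVaR_subdifferentialI[OF m Z]) (use \<zeta>[OF that] that \<alpha> in auto)
    show "AE w in M. set_integrable \<mu> {\<alpha>..\<beta>} (\<lambda>p. \<zeta> p w) \<and> \<xi> w = (LINT p:{\<alpha>..\<beta>}|\<mu>. \<zeta> p w)"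
      using si by (intro AE_I2) (auto simp: \<xi>_def)
  qed (rule \<zeta>m)
qed

end

section \<open>Sufficiency of the optimality conditions\<close>

lemma ext_integral_eq:
  assumes f: "set_integrable \<mu> A f" and F: "\<And>p. p \<in> A \<Longrightarrow> F p = ereal (f p)"
  shows "ext_integral \<mu> A F = ereal (LINT p:A|\<mu>. f p)"
proof -
  let ?h = "\<lambda>p. indicat_real A p *\<^sub>R f p"
  have i: "integrable \<mu> ?h" using f by (simp add: set_integrable_def)
  have 1: "(\<integral>\<^sup>+p\<in>A. e2ennreal (F p) \<partial>\<mu>) = (\<integral>\<^sup>+p. ennreal (?h p) \<partial>\<mu>)"
    by (rule nn_integral_cong) (auto simp: indicator_def F e2ennreal_ereal)
  have 2: "(\<integral>\<^sup>+p\<in>A. e2ennreal (- F p) \<partial>\<mu>) = (\<integral>\<^sup>+p. ennreal (- ?h p) \<partial>\<mu>)"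
    by (rule nn_integral_cong) (auto simp: indicator_def F e2ennreal_ereal)
  have fin: "(\<integral>\<^sup>+p. ennreal (?h p) \<partial>\<mu>) < \<top>" "(\<integral>\<^sup>+p. ennreal (- ?h p) \<partial>\<mu>) < \<top>"
    using i by (auto simp: real_integrable_def top.not_eq_extremum)
  define a where "a = enn2real (\<integral>\<^sup>+p. ennreal (?h p) \<partial>\<mu>)"
  define b where "b = enn2real (\<integral>\<^sup>+p. ennreal (- ?h p) \<partial>\<mu>)"
  have a: "a \<ge> 0" "(\<integral>\<^sup>+p. ennreal (?h p) \<partial>\<mu>) = ennreal a"
    using fin(1) by (auto simp: a_def ennreal_enn2real)
  have b: "b \<ge> 0" "(\<integral>\<^sup>+p. ennreal (- ?h p) \<partial>\<mu>) = ennreal b"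
    using fin(2) by (auto simp: b_def ennreal_enn2real)
  have "(LINT p:A|\<mu>. f p) = a - b"
    unfolding set_lebesgue_integral_def real_lebesgue_integral_def[OF i] a(2) b(2) using a(1) b(1) by simp
  then show ?thesis unfolding ext_integral_def 1 2 a(2) b(2) using a(1) b(1) by (simp add: enn2ereal_ennreal)
qed

text \<open>Monotone in both parts, infinite values included; AVaR of \<open>Y\<close> may be
  infinite at p = 0.\<close>

lemma ext_integral_mono:
  assumes "\<And>p. p \<in> A \<Longrightarrow> F p \<le> G p"
  shows "ext_integral \<mu> A F \<le> ext_integral \<mu> A G"
  unfolding ext_integral_def
proof (rule ereal_minus_mono)
  show "enn2ereal (\<integral>\<^sup>+p\<in>A. e2ennreal (F p) \<partial>\<mu>) \<le> enn2ereal (\<integral>\<^sup>+p\<in>A. e2ennreal (G p) \<partial>\<mu>)"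
    unfolding less_eq_ennreal.rep_eq[symmetric]
    by (rule nn_integral_mono) (auto simp: indicator_def assms e2ennreal_mono)
  show "enn2ereal (\<integral>\<^sup>+p\<in>A. e2ennreal (- G p) \<partial>\<mu>) \<le> enn2ereal (\<integral>\<^sup>+p\<in>A. e2ennreal (- F p) \<partial>\<mu>)"
    unfolding less_eq_ennreal.rep_eq[symmetric]
    by (rule nn_integral_mono) (auto simp: indicator_def assms e2ennreal_mono)
qed

lemma Lp_dual_integrable:
  assumes "1 \<le> m" "\<zeta> \<in> Lp_space M (conj_exponent m)" "f \<in> Lp_space M (ereal m)"
  shows "integrable M (\<lambda>w. \<zeta> w * f w)"
  using Lp_dual_pairing[OF assms(1,2)] assms(3) by (metis order_refl)

context prob_space
begin

text \<open>Inequalities at p = 0 are proved below by comparing real upper bounds, which this lemma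
  converts into essential lower bounds on \<open>Z\<close>.\<close>

lemma AVaR_0_le_iff:
  assumes [measurable]: "Z \<in> borel_measurable M"
  shows "AVaR M 0 Z \<le> ereal b \<longleftrightarrow> (AE w in M. - b \<le> Z w)"
proof -
  have eq: "AVaR M 0 Z = esssup M (\<lambda>w. - ereal (Z w))" by (simp add: AVaR_def essinf_def)
  have m: "(\<lambda>w. - ereal (Z w)) \<in> borel_measurable M" by measurable
  show ?thesis
  proof
    assume "AVaR M 0 Z \<le> ereal b"
    then have le: "esssup M (\<lambda>w. - ereal (Z w)) \<le> ereal b" by (simp only: eq)
    have "AE w in M. - ereal (Z w) \<le> esssup M (\<lambda>w. - ereal (Z w))" by (rule esssup_AE)
    then have "AE w in M. - ereal (Z w) \<le> ereal b"
      by eventually_elim (rule order_trans[OF _ le])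
    then show "AE w in M. - b \<le> Z w" by eventually_elim simp
  next
    assume "AE w in M. - b \<le> Z w"
    then have "AE w in M. - ereal (Z w) \<le> ereal b" by eventually_elim auto
    then show "AVaR M 0 Z \<le> ereal b" unfolding eq by (rule esssup_I[OF m])
  qed
qed

lemma AVaR_ge_expectation:
  assumes Z: "integrable M Z" and p: "0 \<le> p" "p \<le> 1"
  shows "ereal (- (LINT w|M. Z w)) \<le> AVaR M p Z"
proof (cases "p = 0")
  case True
  show ?thesis
    unfolding True
  proof (rule ereal_le_real)
    fix b assume "AVaR M 0 Z \<le> ereal b"
    then have "AE w in M. - b \<le> Z w" using Z by (simp add: AVaR_0_le_iff)
    then have "(LINT w|M. - b) \<le> (LINT w|M. Z w)" by (intro integral_mono_AE Z) auto
    then show "ereal (- (LINT w|M. Z w)) \<le> ereal b" by (simp add: prob_space)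
  qed
next
  case False
  then show ?thesis
    using int_quantile_le_expectation[OF Z, of p] p by (simp add: AVaR_eq_avar avar_def field_simps)
qed

text \<open>Together with \<open>AVaR_ge_expectation\<close> this encloses AVaR between two values
  independent of p.\<close>

lemma AVaR_le_AVaR_0:
  assumes Z: "integrable M Z" and p: "0 \<le> p" "p \<le> 1"
  shows "AVaR M p Z \<le> AVaR M 0 Z"
proof (cases "p = 0")
  case False
  with p have p0: "p > 0" by simp
  show ?thesis
  proof (rule ereal_le_real)
    fix b assume "AVaR M 0 Z \<le> ereal b"
    then have "AE w in M. - b \<le> Z w" using Z by (simp add: AVaR_0_le_iff)
    from int_quantile_ge_lower_bound[OF Z p this]
    show "AVaR M p Z \<le> ereal b" using p0 by (simp add: AVaR_eq_avar avar_def field_simps)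
  qed
qed simp

lemma AVaR_mono:
  assumes Z: "integrable M Z" and W: "integrable M W" and p: "0 \<le> p" "p \<le> 1"
    and le: "AE w in M. Z w \<le> W w"
  shows "AVaR M p W \<le> AVaR M p Z"
proof (cases "p = 0")
  case True
  show ?thesis
    unfolding True
  proof (rule ereal_le_real)
    fix b assume "AVaR M 0 Z \<le> ereal b"
    then have "AE w in M. - b \<le> Z w" using Z by (simp add: AVaR_0_le_iff)
    then have "AE w in M. - b \<le> W w" using le by eventually_elim simp
    then show "AVaR M 0 W \<le> ereal b" using W by (simp add: AVaR_0_le_iff)
  qed
next
  case False
  then show ?thesis using avar_mono[OF Z W _ _ le, of p] p by (simp add: AVaR_eq_avar)
qed

text \<open>At \<open>p = 0\<close> the constraint on \<open>int_quantile\<close> is void, and the conclusion is obtained from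
  \<open>p \<rightarrow> 0\<close>.\<close>

lemma AVaR_le_if_int_quantile_ge:
  assumes Z: "integrable M Z" and Y: "integrable M Y"
    and ge: "\<And>p. 0 \<le> p \<Longrightarrow> p \<le> 1 \<Longrightarrow> int_quantile M Y p \<le> int_quantile M Z p"
    and p: "0 \<le> p" "p \<le> 1"
  shows "AVaR M p Z \<le> AVaR M p Y"
proof (cases "p = 0")
  case True
  show ?thesis
    unfolding True
  proof (rule ereal_le_real)
    fix b assume "AVaR M 0 Y \<le> ereal b"
    then have b: "AE w in M. - b \<le> Y w" using Y by (simp add: AVaR_0_le_iff)
    have "AE w in M. - b \<le> Z w"
    proof (rule lower_bound_if_int_quantile_ge[OF Z])
      fix p :: real assume "0 < p" "p \<le> 1"
      then show "p * - b \<le> int_quantile M Z p"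
        using int_quantile_ge_lower_bound[OF Y _ _ b, of p] ge[of p] by simp
    qed
    then show "AVaR M 0 Z \<le> ereal b" using Z by (simp add: AVaR_0_le_iff)
  qed
next
  case False
  then show ?thesis using ge[OF p] p by (simp add: AVaR_eq_avar avar_def divide_le_cancel)
qed

section \<open>Consequences of the subgradient inequality\<close>

lemma AVaR_subdifferentialD:
  assumes "\<zeta> \<in> AVaR_subdifferential M m p Z" "W \<in> Lp_space M (ereal m)"
  shows "AVaR M p Z + ereal (LINT w|M. \<zeta> w * (W w - Z w)) \<le> AVaR M p W"
  using assms by (simp add: AVaR_subdifferential_def)

text \<open>Tested with W = 0, where AVaR is at most 0, the subgradient inequality excludes the
  value \<infinity>; the expectation bounds AVaR from below.\<close>

lemma AVaR_subdifferential_finite: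
  assumes m: "1 \<le> m" and Z: "Z \<in> Lp_space M (ereal m)" and p: "0 \<le> p" "p \<le> 1"
    and z: "\<zeta> \<in> AVaR_subdifferential M m p Z"
  obtains a where "AVaR M p Z = ereal a"
proof -
  have Zi: "integrable M Z" by (rule Lp_space_integrable[OF m Z])
  have "(\<lambda>w. 0) \<in> Lp_space M (ereal m)" by (simp add: Lp_space_iff)
  with z have le: "AVaR M p Z + ereal (LINT w|M. \<zeta> w * (0 - Z w)) \<le> AVaR M p (\<lambda>w. 0)"
    by (rule AVaR_subdifferentialD)
  have "AVaR M p (\<lambda>w. 0) \<le> AVaR M 0 (\<lambda>w. 0)" by (rule AVaR_le_AVaR_0) (use p in auto)
  also have "\<dots> \<le> ereal 0" by (subst AVaR_0_le_iff) auto
  finally have "AVaR M p Z \<noteq> \<infinity>" using le by (cases "AVaR M p Z") auto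
  moreover have "AVaR M p Z \<noteq> - \<infinity>" using AVaR_ge_expectation[OF Zi p] by auto
  ultimately show ?thesis using that by (cases "AVaR M p Z") auto
qed

text \<open>Tested with \<open>Z\<close> plus the indicator of {\<zeta> > 0}: AVaR does not
  increase, so the integral of \<open>\<zeta>\<close> over this set is at most 0.\<close>

lemma AVaR_subdifferential_nonpos:
  assumes m: "1 \<le> m" and Z: "Z \<in> Lp_space M (ereal m)" and p: "0 \<le> p" "p \<le> 1"
    and z: "\<zeta> \<in> AVaR_subdifferential M m p Z"
  shows "AE w in M. \<zeta> w \<le> 0"
proof -
  have Zi: "integrable M Z" by (rule Lp_space_integrable[OF m Z])
  have zL: "\<zeta> \<in> Lp_space M (conj_exponent m)" using z by (simp add: AVaR_subdifferential_def)
  then have [measurable]: "\<zeta> \<in> borel_measurable M" by (rule Lp_space_measurable)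
  define A where "A = {w\<in>space M. 0 < \<zeta> w}"
  have [measurable]: "A \<in> sets M" unfolding A_def by measurable
  have ind: "indicat_real A \<in> Lp_space M (ereal m)"
    unfolding Lp_space_iff by (auto intro!: integrable_const_bound[where B=1] simp: indicator_def)
  have WL: "(\<lambda>w. Z w + indicat_real A w) \<in> Lp_space M (ereal m)" by (rule Lp_space_add[OF m Z ind])
  obtain a where a: "AVaR M p Z = ereal a" by (rule AVaR_subdifferential_finite[OF m Z p z])
  have "AVaR M p Z + ereal (LINT w|M. \<zeta> w * (Z w + indicat_real A w - Z w)) \<le> AVaR M p (\<lambda>w. Z w + indicat_real A w)"
    by (rule AVaR_subdifferentialD[OF z WL])
  also have "\<dots> \<le> AVaR M p Z"
    by (rule AVaR_mono[OF Zi Lp_space_integrable[OF m WL] p]) simp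
  finally have le: "(LINT w|M. \<zeta> w * indicat_real A w) \<le> 0" by (simp add: a)
  have i: "integrable M (\<lambda>w. \<zeta> w * indicat_real A w)" by (rule Lp_dual_integrable[OF m zL ind])
  have nn: "AE w in M. 0 \<le> \<zeta> w * indicat_real A w" by (auto simp: A_def indicator_def)
  have "(LINT w|M. \<zeta> w * indicat_real A w) = 0"
    using le integral_nonneg_AE[OF nn] by simp
  then have "AE w in M. \<zeta> w * indicat_real A w = 0"
    using integral_nonneg_eq_0_iff_AE[OF i nn] by simp
  then show ?thesis using AE_space by eventually_elim (auto simp: A_def indicator_def split: if_splits)
qed

theorem stationarity_sufficient:
  fixes \<phi> :: "'x::real_normed_vector \<Rightarrow> real" and g :: "'x \<Rightarrow> 'a \<Rightarrow> real" and C :: "'x set"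
  assumes m: "1 \<le> m" and Yi: "integrable M Y" and gL: "\<And>x. g x \<in> Lp_space M (ereal m)"
    and \<mu>: "prob_measure_on 0 1 \<mu>" and \<kappa>: "0 \<le> \<kappa>"
    and S: "S \<in> concave_op_subdifferential M m g xh"
    and st: "stationarity M m \<phi> g C 0 1 xh S \<mu> \<kappa>"
    and co: "complementarity M g Y 0 1 xh \<mu> \<kappa>"
    and y: "y \<in> feasible_set M g Y C 0 1"
  shows "\<phi> xh \<le> \<phi> y"
proof -
  have gi: "integrable M (g x)" for x by (rule Lp_space_integrable[OF m gL])
  have [measurable]: "g x \<in> borel_measurable M" for x by (rule Lp_space_measurable[OF gL])
  note \<mu>p = prob_measure_onD(1)[OF \<mu>] and \<mu>s = prob_measure_onD(2)[OF \<mu>]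
  interpret \<mu>: prob_space \<mu> by (rule \<mu>p)
  interpret Q: pair_prob_space M \<mu> by standard
  note [measurable_cong] = \<mu>s
  have Qs: "sets (M \<Otimes>\<^sub>M \<mu>) = sets (M \<Otimes>\<^sub>M borel)" by (rule sets_pair_measure_cong[OF refl \<mu>s])
  have yC: "y \<in> C" and yq: "\<And>p. 0 \<le> p \<Longrightarrow> p \<le> 1 \<Longrightarrow> int_quantile M Y p \<le> int_quantile M (g y) p"
    using y by (auto simp: feasible_set_def)
  obtain f \<xi> n where f: "f \<in> subdifferential \<phi> xh" and \<xi>: "\<xi> \<in> AVaR_subdifferential_integral M m \<mu> 0 1 (g xh)"
    and n: "n \<in> normal_cone C xh" and z: "0 = f + \<kappa> *\<^sub>R op_adjoint M S \<xi> + n"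
    using st unfolding stationarity_def by (auto elim!: set_plus_elim)
  have \<xi>L: "\<xi> \<in> Lp_space M (conj_exponent m)" using \<xi> by (simp add: AVaR_subdifferential_integral_def)
  have [measurable]: "\<xi> \<in> borel_measurable M" by (rule Lp_space_measurable[OF \<xi>L])
  have Sc: "cont_linear_op M m S" using S by (simp add: concave_op_subdifferential_def)
  define d where "d = y - xh"
  define V where "V w = g y w - g xh w" for w
  have VL: "V \<in> Lp_space M (ereal m)" unfolding V_def[abs_def] by (rule Lp_space_diff[OF m gL gL])
  have [measurable]: "V \<in> borel_measurable M" by (rule Lp_space_measurable[OF VL])
  have SV: "AE w in M. V w \<le> S d w"
    using S by (auto simp: concave_op_subdifferential_def V_def d_def dest: spec[of _ "y - xh"])
  have SdL: "S d \<in> Lp_space M (ereal m)" using Sc by (simp add: cont_linear_op_def)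
  have "blinfun_apply (f + \<kappa> *\<^sub>R op_adjoint M S \<xi> + n) d = 0" by (simp flip: z)
  then have fd: "blinfun_apply f d + \<kappa> * (LINT w|M. \<xi> w * S d w) + blinfun_apply n d = 0"
    by (simp add: blinfun.bilinear_simps op_adjoint_apply(2)[OF m \<xi>L Sc])
  have nd: "blinfun_apply n d \<le> 0" using n yC by (simp add: normal_cone_def d_def)
  have \<phi>y: "\<phi> xh + blinfun_apply f d \<le> \<phi> y" using f by (simp add: subdifferential_def d_def)
  have "\<kappa> * (LINT w|M. \<xi> w * S d w) \<le> 0"
  proof (cases "\<kappa> = 0")
    case False
    with \<kappa> have \<kappa>0: "\<kappa> > 0" by simp
    obtain \<zeta> where \<zeta>m: "(\<lambda>(p, w). \<zeta> p w) \<in> borel_measurable (borel \<Otimes>\<^sub>M M)"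
      and \<zeta>: "\<And>p. p \<in> {0..1} \<Longrightarrow> \<zeta> p \<in> AVaR_subdifferential M m p (g xh)"
      and \<xi>\<zeta>: "AE w in M. set_integrable \<mu> {0..1} (\<lambda>p. \<zeta> p w) \<and> \<xi> w = (LINT p:{0..1}|\<mu>. \<zeta> p w)"
      using \<xi> unfolding AVaR_subdifferential_integral_def by blast
    define a where "a p = real_of_ereal (AVaR M p (g xh))" for p
    have a: "AVaR M p (g xh) = ereal (a p)" if p: "p \<in> {0..1}" for p
    proof -
      obtain b where "AVaR M p (g xh) = ereal b"
        by (rule AVaR_subdifferential_finite[OF m gL _ _ \<zeta>[OF p]]) (use p in auto)
      then show ?thesis by (simp add: a_def)
    qed
    \<comment> \<open>\<open>a 0\<close> is a real number because \<open>\<zeta> 0\<close> is a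
      subgradient at p = 0, whether or not \<mu> charges 0.\<close>
    have ab: "\<bar>a p\<bar> \<le> \<bar>LINT w|M. g xh w\<bar> + \<bar>a 0\<bar>" if p: "p \<in> {0..1}" for p
      using AVaR_ge_expectation[OF gi[of xh], of p] AVaR_le_AVaR_0[OF gi[of xh], of p] p a[of 0] a[OF p]
      by simp
    have ai: "set_integrable \<mu> {0..1} a"
      unfolding set_integrable_def
    proof (rule \<mu>.integrable_const_bound[where B="\<bar>LINT w|M. g xh w\<bar> + \<bar>a 0\<bar>"])
      show "AE p in \<mu>. norm (indicat_real {0..1} p *\<^sub>R a p) \<le> \<bar>LINT w|M. g xh w\<bar> + \<bar>a 0\<bar>"
        using ab by (intro AE_I2) (auto simp: indicator_def)
      have "continuous_on {0<..1} (\<lambda>p. avar M p (g xh))"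
        unfolding avar_def
        by (intro continuous_intros continuous_on_subset[OF continuous_on_int_quantile] gi) auto
      then have c: "(\<lambda>p. indicat_real {0<..1} p *\<^sub>R avar M p (g xh)) \<in> borel_measurable borel"
        by (intro borel_measurable_continuous_on_indicator) auto
      have "(\<lambda>p. indicat_real {0..1} p *\<^sub>R a p) =
          (\<lambda>p. indicat_real {0} p * a 0 + indicat_real {0<..1} p *\<^sub>R avar M p (g xh))"
        by (auto simp: fun_eq_iff indicator_def a_def AVaR_eq_avar)
      then show "(\<lambda>p. indicat_real {0..1} p *\<^sub>R a p) \<in> borel_measurable \<mu>" using c by simp
    qed
    have "ereal \<kappa> * ereal (LINT p:{0..1}|\<mu>. a p) = ereal \<kappa> * ext_integral \<mu> {0..1} (\<lambda>p. AVaR M p Y)"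
      using co ext_integral_eq[OF ai a] by (simp add: complementarity_def)
    \<comment> \<open>Division by \<kappa> > 0; in particular the extended integral for
      \<open>Y\<close> is finite.\<close>
    then have Y: "ext_integral \<mu> {0..1} (\<lambda>p. AVaR M p Y) = ereal (LINT p:{0..1}|\<mu>. a p)"
      using \<kappa>0 by (cases "ext_integral \<mu> {0..1} (\<lambda>p. AVaR M p Y)") auto
    have \<zeta>0: "AE w in M. AE p in \<mu>. p \<in> {0..1} \<longrightarrow> \<zeta> p w \<le> 0"
    proof (rule AE_AE_nonpos_swap[OF \<mu>p \<mu>s _ \<zeta>m])
      show "AE w in M. \<zeta> p w \<le> 0" if "p \<in> {0..1}" for p
        by (rule AVaR_subdifferential_nonpos[OF m gL _ _ \<zeta>[OF that]]) (use that in auto)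
    qed simp
    let ?I = "\<lambda>p. indicat_real {0..1} p"
    \<comment> \<open>As \<open>\<zeta>\<close> has one sign, the integral of its absolute value is
      - \<xi>. This gives the integrability for Fubini's theorem from that of \<xi> V, although
      \<open>\<zeta>\<close> need not be bounded near p = 0.\<close>
    have \<xi>abs: "AE w in M. (LINT p|\<mu>. \<bar>?I p * \<zeta> p w\<bar>) = - \<xi> w \<and> \<xi> w \<le> 0"
      using \<zeta>0 \<xi>\<zeta>
    proof eventually_elim
      case (elim w)
      have i: "integrable \<mu> (\<lambda>p. ?I p * \<zeta> p w)" using elim by (simp add: set_integrable_def)
      have "(LINT p|\<mu>. \<bar>?I p * \<zeta> p w\<bar>) = (LINT p|\<mu>. - (?I p * \<zeta> p w))"
        by (rule integral_cong_AE)
          (use i elim(1) in \<open>auto simp: indicator_def elim: eventually_mono\<close>)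
      also have "\<dots> = - \<xi> w" using elim by (simp add: set_lebesgue_integral_def)
      finally have "(LINT p|\<mu>. \<bar>?I p * \<zeta> p w\<bar>) = - \<xi> w" .
      moreover have "0 \<le> (LINT p|\<mu>. \<bar>?I p * \<zeta> p w\<bar>)" by simp
      ultimately show ?case by simp
    qed
    have \<xi>V: "integrable M (\<lambda>w. \<xi> w * V w)" by (rule Lp_dual_integrable[OF m \<xi>L VL])
    let ?f = "\<lambda>(w, p). ?I p * \<zeta> p w * V w"
    have fm: "?f \<in> borel_measurable (M \<Otimes>\<^sub>M \<mu>)"
    proof -
      have [measurable]: "(\<lambda>x. \<zeta> (snd x) (fst x)) \<in> borel_measurable (M \<Otimes>\<^sub>M borel)"
        using measurable_compose[OF measurable_pair_swap'[of M borel] \<zeta>m] by (simp add: case_prod_unfold)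
      have "?f \<in> borel_measurable (M \<Otimes>\<^sub>M borel)" by (simp add: case_prod_unfold)
      then show ?thesis unfolding measurable_cong_sets[OF Qs refl] .
    qed
    have fi: "integrable (M \<Otimes>\<^sub>M \<mu>) ?f"
    proof (rule Q.Fubini_integrable[OF fm])
      have "AE w in M. \<bar>\<xi> w * V w\<bar> = (LINT p|\<mu>. norm (?f (w, p)))"
        using \<xi>abs
      proof eventually_elim
        case (elim w)
        have "(LINT p|\<mu>. norm (?f (w, p))) = (LINT p|\<mu>. \<bar>?I p * \<zeta> p w\<bar>) * \<bar>V w\<bar>"
          by (simp add: abs_mult flip: integral_mult_left_zero)
        then show ?case using elim by (simp add: abs_mult)
      qed
      moreover have "(\<lambda>w. LINT p|\<mu>. norm (?f (w, p))) \<in> borel_measurable M"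
        by (rule \<mu>.borel_measurable_lebesgue_integral) (use fm in \<open>simp add: case_prod_unfold\<close>)
      ultimately show "integrable M (\<lambda>w. LINT p|\<mu>. norm (?f (w, p)))"
        by (intro integrable_cong_AE_imp[OF integrable_abs[OF \<xi>V]])
      show "AE w in M. integrable \<mu> (\<lambda>p. ?f (w, p))"
        using \<xi>\<zeta> by eventually_elim (simp add: set_integrable_def)
    qed
    define L where "L p = (LINT w|M. \<zeta> p w * V w)" for p
    have Li: "set_integrable \<mu> {0..1} L" and LV: "(LINT p:{0..1}|\<mu>. L p) = (LINT w|M. \<xi> w * V w)"
    proof -
      have e1: "(LINT w|M. ?f (w, p)) = ?I p *\<^sub>R L p" for p by (simp add: L_def mult.assoc)
      show "set_integrable \<mu> {0..1} L"
        unfolding set_integrable_def using Q.integrable_snd[OF fi] e1 by simp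
      have "(LINT p:{0..1}|\<mu>. L p) = (LINT p|\<mu>. LINT w|M. ?f (w, p))"
        unfolding set_lebesgue_integral_def e1 ..
      also have "\<dots> = integral\<^sup>L (M \<Otimes>\<^sub>M \<mu>) ?f" using Q.integral_snd[OF fi] by simp
      also have "\<dots> = (LINT w|M. LINT p|\<mu>. ?f (w, p))" using Q.integral_fst[OF fi] by simp
      also have "\<dots> = (LINT w|M. \<xi> w * V w)"
      proof (rule integral_cong_AE)
        show "(\<lambda>w. LINT p|\<mu>. ?f (w, p)) \<in> borel_measurable M"
          using Q.integrable_fst[OF fi] by auto
        show "AE w in M. (LINT p|\<mu>. ?f (w, p)) = \<xi> w * V w"
          using \<xi>\<zeta> by eventually_elim (simp add: set_lebesgue_integral_def)
      qed simp
      finally show "(LINT p:{0..1}|\<mu>. L p) = (LINT w|M. \<xi> w * V w)" .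
    qed
    have "ereal (a p + L p) \<le> AVaR M p Y" if p: "p \<in> {0..1}" for p
    proof -
      have "AVaR M p (g xh) + ereal (LINT w|M. \<zeta> p w * (g y w - g xh w)) \<le> AVaR M p (g y)"
        by (rule AVaR_subdifferentialD[OF \<zeta>[OF p] gL])
      also have "\<dots> \<le> AVaR M p Y"
        by (rule AVaR_le_if_int_quantile_ge[OF gi Yi yq]) (use p in auto)
      finally show ?thesis by (simp add: a[OF p] L_def V_def)
    qed
    then have "ext_integral \<mu> {0..1} (\<lambda>p. ereal (a p + L p)) \<le> ext_integral \<mu> {0..1} (\<lambda>p. AVaR M p Y)"
      by (rule ext_integral_mono)
    moreover have "ext_integral \<mu> {0..1} (\<lambda>p. ereal (a p + L p)) = ereal (LINT p:{0..1}|\<mu>. a p + L p)"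
      by (rule ext_integral_eq) (use ai Li in auto)
    ultimately have "(LINT p:{0..1}|\<mu>. L p) \<le> 0" using ai Li by (simp add: Y)
    then have "(LINT w|M. \<xi> w * V w) \<le> 0" by (simp add: LV)
    moreover have "(LINT w|M. \<xi> w * S d w) \<le> (LINT w|M. \<xi> w * V w)"
    proof (rule integral_mono_AE[OF Lp_dual_integrable[OF m \<xi>L SdL] \<xi>V])
      show "AE w in M. \<xi> w * S d w \<le> \<xi> w * V w"
        using \<xi>abs SV by eventually_elim (auto intro: mult_left_mono_neg)
    qed
    ultimately show ?thesis using \<kappa>0 by (simp add: mult_le_0_iff)
  qed simp
  then show ?thesis using fd nd \<phi>y by linarith
qed

end

section \<open>Necessity of the optimality conditions\<close>

text \<open>A one-sided bound suffices, since the ball contains u together with - u.\<close>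

lemma linear_bounded_above_imp_bounded_linear:
  fixes f :: "'x::real_normed_vector \<Rightarrow> real"
  assumes f: "linear f" and \<delta>: "0 < \<delta>" and le: "\<And>u. norm u < \<delta> \<Longrightarrow> f u \<le> 1"
  shows "bounded_linear f"
proof (rule bounded_linear_intro[where K="2 / \<delta>"])
  show "f (x + y) = f x + f y" for x y by (rule linear_add[OF f])
  show "f (r *\<^sub>R x) = r *\<^sub>R f x" for r x by (simp add: linear_scale[OF f])
  show "norm (f x) \<le> norm x * (2 / \<delta>)" for x
  proof (cases "x = 0")
    case True
    then show ?thesis by (simp add: linear_0[OF f])
  next
    case False
    define c where "c = \<delta> / (2 * norm x)"
    have c: "c > 0" using False \<delta> by (simp add: c_def)
    have "norm (c *\<^sub>R x) < \<delta>" using False \<delta> by (simp add: c_def)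
    then have "f (c *\<^sub>R x) \<le> 1" "f (c *\<^sub>R (- x)) \<le> 1" by (auto intro!: le)
    then have "c * \<bar>f x\<bar> \<le> 1" using c by (simp add: linear_scale[OF f] linear_neg[OF f] abs_if)
    then show ?thesis using False \<delta> by (simp add: c_def field_simps)
  qed
qed

context prob_space
begin

lemma norm_continuous_L1:
  fixes g :: "'x::real_normed_vector \<Rightarrow> 'a \<Rightarrow> real"
  assumes m: "1 \<le> m" and gL: "\<And>x. g x \<in> Lp_space M (ereal m)" and gc: "norm_continuous M m g"
    and e: "0 < \<epsilon>"
  shows "\<exists>\<delta>>0. \<forall>d. norm d < \<delta> \<longrightarrow> (LINT w|M. \<bar>g (x + d) w - g x w\<bar>) \<le> \<epsilon>"
proof -
  obtain \<delta> where \<delta>: "\<delta> > 0" "\<And>d. norm d < \<delta> \<Longrightarrow> Lp_norm M m (\<lambda>w. g (x + d) w - g x w) < \<epsilon> / 2"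
    using norm_continuous_Lp_norm_less[OF gc, of "\<epsilon> / 2" x] e by auto
  have "(LINT w|M. \<bar>g (x + d) w - g x w\<bar>) \<le> 2 * (\<epsilon> / 2)" if "norm d < \<delta>" for d
    using \<delta>(2)[OF that] e by (intro L1_norm_le_Lp_norm[OF m] Lp_space_diff[OF m gL gL]) auto
  then show ?thesis using \<delta>(1) by auto
qed

context
  fixes \<phi> :: "'x::real_normed_vector \<Rightarrow> real" and g :: "'x \<Rightarrow> 'a \<Rightarrow> real" and C :: "'x set" and Y :: "'a \<Rightarrow> real"
    and xt xh :: 'x and m \<alpha> \<beta> :: real
  assumes m: "1 \<le> m" and Yi: "integrable M Y"
    and \<phi>: "convex_on UNIV \<phi>" "continuous_on UNIV \<phi>"
    and gL: "\<And>x. g x \<in> Lp_space M (ereal m)" and gc: "norm_continuous M m g"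
    and conc: "\<And>w. w \<in> space M \<Longrightarrow> concave_on UNIV (\<lambda>x. g x w)"
    and C: "convex C" and \<alpha>: "0 < \<alpha>" "\<alpha> \<le> \<beta>" "\<beta> \<le> 1"
    and slater: "xt \<in> C" "(INF p\<in>{\<alpha>..\<beta>}. int_quantile M (g xt) p - int_quantile M Y p) > 0"
    and opt: "optimal_solution M \<phi> g Y C \<alpha> \<beta> xh"
begin

text \<open>The Slater point makes the perturbed problem feasible along a small multiple of every
  direction. The linear minorant of the perturbation function splits by coordinates into
  \<open>f\<close>, \<open>T\<close> and a functional of the right-hand side.\<close>

theorem lagrange_multipliers:
  obtains f T \<kappa> \<mu> where "f \<in> subdifferential \<phi> xh" "linear T" "0 \<le> \<kappa>" "prob_measure_on \<alpha> \<beta> \<mu>"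
    and "\<And>e. T e \<le> \<kappa> * ((LINT p:{\<alpha>..\<beta>}|\<mu>. avar M p (g (xh + e))) - (LINT p:{\<alpha>..\<beta>}|\<mu>. avar M p (g xh)))"
    and "\<And>y. y \<in> C \<Longrightarrow> 0 \<le> blinfun_apply f (y - xh) + T (y - xh)"
    and "\<kappa> * (LINT p:{\<alpha>..\<beta>}|\<mu>. avar M p (g xh)) = \<kappa> * (LINT p:{\<alpha>..\<beta>}|\<mu>. avar M p Y)"
proof -
  have gi: "integrable M (g x)" for x by (rule Lp_space_integrable[OF m gL])
  have pp: "0 < p" "p \<le> 1" if "p \<in> {\<alpha>..\<beta>}" for p using that \<alpha> by auto
  have le_iff: "avar M p Z - avar M p Y \<le> 0 \<longleftrightarrow> int_quantile M Y p \<le> int_quantile M Z p" if "p \<in> {\<alpha>..\<beta>}" for p Z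
    using pp[OF that] by (simp add: avar_def divide_le_cancel)
  have opt1: "xh \<in> C" "\<And>p. p \<in> {\<alpha>..\<beta>} \<Longrightarrow> avar M p (g xh) - avar M p Y \<le> 0"
    and opt2: "\<And>y. y \<in> C \<Longrightarrow> (\<And>p. p \<in> {\<alpha>..\<beta>} \<Longrightarrow> avar M p (g y) - avar M p Y \<le> 0) \<Longrightarrow> \<phi> xh \<le> \<phi> y"
    using opt le_iff by (auto simp: optimal_solution_def feasible_set_def)
  obtain \<delta> where \<delta>: "\<delta> > 0" "\<And>p. p \<in> {\<alpha>..\<beta>} \<Longrightarrow> avar M p (g xt) - avar M p Y \<le> - \<delta>"
  proof -
    let ?D = "\<lambda>p. int_quantile M (g xt) p - int_quantile M Y p"
    have "continuous_on {\<alpha>..\<beta>} ?D"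
      by (intro continuous_intros continuous_on_subset[OF continuous_on_int_quantile] gi Yi) (use \<alpha> in auto)
    then have "compact (?D ` {\<alpha>..\<beta>})" by (intro compact_continuous_image) auto
    then have bdd: "bdd_below (?D ` {\<alpha>..\<beta>})" by (intro bounded_imp_bdd_below compact_imp_bounded)
    define \<delta> where "\<delta> = (INF p\<in>{\<alpha>..\<beta>}. ?D p)"
    have "avar M p (g xt) - avar M p Y \<le> - \<delta>" if p: "p \<in> {\<alpha>..\<beta>}" for p
    proof -
      have "\<delta> \<le> ?D p" unfolding \<delta>_def by (rule cINF_lower[OF bdd p])
      \<comment> \<open>Since p \<le> 1, dividing by p preserves the gap \<delta>.\<close>
      moreover have "\<delta> * p \<le> \<delta> * 1" using pp[OF p] slater(2) by (intro mult_left_mono) (auto simp: \<delta>_def)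
      ultimately show ?thesis using pp[OF p] by (simp add: avar_def divide_simps)
    qed
    then show ?thesis using that slater(2) by (auto simp: \<delta>_def)
  qed
  \<comment> \<open>In essence the epigraph of the optimal value. The constraint is written with
    AVaR, so that it is convex and its multiplier integrates AVaR.\<close>
  define A where "A = {((u, e, h), r). continuous_on UNIV h \<and>
     (\<exists>y\<in>C. (\<forall>p\<in>{\<alpha>..\<beta>}. avar M p (g (y + e)) - avar M p Y \<le> h p) \<and> \<phi> (y + u) - \<phi> xh \<le> r)}"
  have "\<exists>F. linear F \<and> (\<forall>(h, r)\<in>A. F h \<le> r)"
  proof (rule linear_minorant_of_convex_set)
    show "subspace {(u :: 'x, e :: 'x, h :: real \<Rightarrow> real). continuous_on UNIV h}"
      by (rule subspaceI)
        (auto simp: zero_prod_def zero_fun_def plus_fun_def scaleR_fun_def intro!: continuous_intros)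
    show "v \<in> {(u, e, h). continuous_on UNIV h}" if "(v, r) \<in> A" for v r using that by (auto simp: A_def)
    show "0 \<le> r" if "(0, r) \<in> A" for r
      using that opt2 by (force simp: A_def zero_prod_def)
    show "\<exists>t>0. \<exists>r. (t *\<^sub>R v, r) \<in> A" if v: "v \<in> {(u, e, h). continuous_on UNIV h}" for v
    proof -
      obtain u e h where v: "v = (u, e, h)" and h: "continuous_on UNIV h" using v by auto
      obtain B where B: "\<And>p. p \<in> {\<alpha>..\<beta>} \<Longrightarrow> \<bar>h p\<bar> \<le> B"
        using continuous_on_interval_bounded[OF continuous_on_subset[OF h subset_UNIV]] by blast
      have B0: "B \<ge> 0" using B[of \<alpha>] \<alpha> by auto
      obtain \<epsilon> where \<epsilon>: "\<epsilon> > 0" "\<And>d. norm d < \<epsilon> \<Longrightarrow> (LINT w|M. \<bar>g (xt + d) w - g xt w\<bar>) \<le> \<alpha> * (\<delta> / 2)"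
        using norm_continuous_L1[OF m gL gc, of "\<alpha> * (\<delta> / 2)" xt] \<alpha> \<delta>(1) by auto
      \<comment> \<open>The gap \<delta> is shared: the first bound limits the loss from shifting
        \<open>g\<close> to \<delta> / 2, the second the loss from \<open>h\<close>. Adding 1 avoids
        zero denominators.\<close>
      define t where "t = min (\<epsilon> / (2 * (norm e + 1))) (\<delta> / (2 * (B + 1)))"
      have t: "t > 0" using \<epsilon>(1) \<delta>(1) B0 by (auto simp: t_def add_nonneg_pos)
      have "t * norm e \<le> (\<epsilon> / (2 * (norm e + 1))) * (norm e + 1)"
        using t by (intro mult_mono) (auto simp: t_def)
      also have "\<dots> = \<epsilon> / 2" using norm_ge_zero[of e] by (simp add: field_simps add_nonneg_eq_0_iff)
      also have "\<dots> < \<epsilon>" using \<epsilon>(1) by simp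
      finally have te: "norm (t *\<^sub>R e) < \<epsilon>" using t by simp
      have "t * B \<le> (\<delta> / (2 * (B + 1))) * (B + 1)"
        using t B0 by (intro mult_mono) (auto simp: t_def)
      also have "\<dots> = \<delta> / 2" using B0 by (simp add: field_simps add_nonneg_eq_0_iff)
      finally have tB: "t * B \<le> \<delta> / 2" .
      have "avar M p (g (xt + t *\<^sub>R e)) - avar M p Y \<le> t * h p" if p: "p \<in> {\<alpha>..\<beta>}" for p
      proof -
        have "(LINT w|M. \<bar>g (xt + t *\<^sub>R e) w - g xt w\<bar>) / p \<le> (\<alpha> * (\<delta> / 2)) / \<alpha>"
          using \<epsilon>(2)[OF te] p \<alpha> \<delta>(1) by (intro frac_le) auto
        also have "(\<alpha> * (\<delta> / 2)) / \<alpha> = \<delta> / 2" using \<alpha>(1) by simp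
        finally have "avar M p (g (xt + t *\<^sub>R e)) \<le> avar M p (g xt) + \<delta> / 2"
          using avar_Lipschitz[OF gi[of "xt + t *\<^sub>R e"] gi[of xt] pp[OF p]] by linarith
        moreover have "- (t * B) \<le> t * h p"
          using mult_left_mono[of "- B" "h p" t] B[OF p] t by (auto simp: abs_le_iff)
        ultimately show ?thesis using \<delta>(2)[OF p] tB by linarith
      qed
      then have "(t *\<^sub>R v, \<phi> (xt + t *\<^sub>R u) - \<phi> xh) \<in> A"
        using slater(1) h by (auto simp: A_def v scaleR_fun_def intro!: continuous_intros bexI[of _ xt])
      then show ?thesis using t by blast
    qed
    show "convex A"
    proof (rule convexI)
      fix a b and s t :: real
      assume a: "a \<in> A" and b: "b \<in> A" and st: "0 \<le> s" "0 \<le> t" "s + t = 1"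
      obtain u e h r y where a': "a = ((u, e, h), r)" "continuous_on UNIV h" "y \<in> C"
        "\<And>p. p \<in> {\<alpha>..\<beta>} \<Longrightarrow> avar M p (g (y + e)) - avar M p Y \<le> h p" "\<phi> (y + u) - \<phi> xh \<le> r"
        using a by (auto simp: A_def)
      obtain u' e' h' r' y' where b': "b = ((u', e', h'), r')" "continuous_on UNIV h'" "y' \<in> C"
        "\<And>p. p \<in> {\<alpha>..\<beta>} \<Longrightarrow> avar M p (g (y' + e')) - avar M p Y \<le> h' p" "\<phi> (y' + u') - \<phi> xh \<le> r'"
        using b by (auto simp: A_def)
      let ?y = "s *\<^sub>R y + t *\<^sub>R y'"
      have y: "?y \<in> C" by (rule convexD[OF C a'(3) b'(3) st])
      have avc: "avar M p (g (?y + (s *\<^sub>R e + t *\<^sub>R e'))) - avar M p Y \<le> s * h p + t * h' p" if p: "p \<in> {\<alpha>..\<beta>}" for p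
      proof -
        have "avar M p (g (?y + (s *\<^sub>R e + t *\<^sub>R e'))) \<le> s * avar M p (g (y + e)) + t * avar M p (g (y' + e'))"
        proof (rule avar_convex[OF gi gi gi pp[OF p] st AE_I2])
          fix w assume "w \<in> space M"
          then have "s * g (y + e) w + t * g (y' + e') w \<le> g (s *\<^sub>R (y + e) + t *\<^sub>R (y' + e')) w"
            using conc[of w] st by (auto simp: concave_on_iff)
          then show "s * g (y + e) w + t * g (y' + e') w \<le> g (?y + (s *\<^sub>R e + t *\<^sub>R e')) w"
            by (simp add: algebra_simps)
        qed
        also have "\<dots> - avar M p Y = s * (avar M p (g (y + e)) - avar M p Y) + t * (avar M p (g (y' + e')) - avar M p Y)"
          using st by (simp add: algebra_simps flip: distrib_right)
        also have "\<dots> \<le> s * h p + t * h' p"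
          using a'(4)[OF p] b'(4)[OF p] st by (intro add_mono mult_left_mono) auto
        finally show ?thesis by simp
      qed
      have "\<phi> (s *\<^sub>R (y + u) + t *\<^sub>R (y' + u')) \<le> s * \<phi> (y + u) + t * \<phi> (y' + u')"
        using \<phi>(1) st by (auto simp: convex_on_def)
      also have "\<dots> \<le> s * (r + \<phi> xh) + t * (r' + \<phi> xh)"
        using a'(5) b'(5) st by (intro add_mono mult_left_mono) auto
      also have "\<dots> = s * r + t * r' + (s + t) * \<phi> xh" by (simp add: algebra_simps)
      finally have "\<phi> (?y + (s *\<^sub>R u + t *\<^sub>R u')) - \<phi> xh \<le> s * r + t * r'"
        using st by (simp add: algebra_simps)
      then show "s *\<^sub>R a + t *\<^sub>R b \<in> A"
        unfolding A_def a'(1) b'(1) using y avc a'(2) b'(2)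
        by (auto simp: plus_fun_def scaleR_fun_def intro!: continuous_intros bexI[of _ ?y])
    qed
  qed
  then obtain F where F: "linear F" and Fle: "\<And>v r. (v, r) \<in> A \<Longrightarrow> F v \<le> r" by auto
  define f where "f u = F (u, 0, 0)" for u
  define T where "T e = F (0, e, 0)" for e
  \<comment> \<open>Relaxing the constraint lowers the optimal value; the sign makes
    \<open>L\<close> a positive functional, with total mass \<open>\<kappa>\<close>.\<close>
  define L where "L h = - F (0, 0, h)" for h
  have Fsplit: "F (u, e, h) = f u + T e - L h" for u e h
    using linear_add[OF F, of "(u, 0, 0)" "(0, e, h)"] linear_add[OF F, of "(0, e, 0)" "(0, 0, h)"]
    by (simp add: f_def T_def L_def)
  have fl: "linear f"
    by (rule linearI) (simp_all add: f_def flip: linear_add[OF F] linear_scale[OF F, unfolded real_scaleR_def])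
  have Tl: "linear T"
    by (rule linearI) (simp_all add: T_def flip: linear_add[OF F] linear_scale[OF F, unfolded real_scaleR_def])
  have Ladd: "L (\<lambda>p. h p + k p) = L h + L k" for h k
    using linear_add[OF F, of "(0, 0, h)" "(0, 0, k)"] by (simp add: L_def plus_fun_def)
  have Lscale: "L (\<lambda>p. c * h p) = c * L h" for c h
    using linear_scale[OF F, of c "(0, 0, h)"] by (simp add: L_def scaleR_fun_def)
  have Ldiff: "L (\<lambda>p. h p - k p) = L h - L k" for h k
    using Ladd[of h "\<lambda>p. -1 * k p"] Lscale[of "-1" k] by simp
  have key: "f u + T e \<le> \<phi> (y + u) - \<phi> xh + L h"
    if "continuous_on UNIV h" "y \<in> C" "\<And>p. p \<in> {\<alpha>..\<beta>} \<Longrightarrow> avar M p (g (y + e)) - avar M p Y \<le> h p" for u e y h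
  proof -
    have "F (u, e, h) \<le> \<phi> (y + u) - \<phi> xh" by (rule Fle) (use that in \<open>auto simp: A_def intro!: bexI[of _ y]\<close>)
    then show ?thesis by (simp add: Fsplit)
  qed
  have f0: "f 0 = 0" and T0: "T 0 = 0" by (simp_all add: linear_0[OF fl] linear_0[OF Tl])
  have Lpos: "0 \<le> L h" if hc: "continuous_on UNIV h" and h0: "\<And>p. p \<in> {\<alpha>..\<beta>} \<Longrightarrow> 0 \<le> h p" for h
  proof -
    have "f 0 + T 0 \<le> \<phi> (xh + 0) - \<phi> xh + L h"
    proof (rule key[OF hc opt1(1)])
      show "avar M p (g (xh + 0)) - avar M p Y \<le> h p" if "p \<in> {\<alpha>..\<beta>}" for p
        using opt1(2)[OF that] h0[OF that] by simp
    qed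
    then show ?thesis using f0 T0 by simp
  qed
  define \<kappa> where "\<kappa> = L (\<lambda>p. 1)"
  have \<kappa>: "\<kappa> \<ge> 0" unfolding \<kappa>_def by (rule Lpos) auto
  have "\<exists>\<mu>. prob_measure_on \<alpha> \<beta> \<mu> \<and> (\<forall>h. continuous_on UNIV h \<longrightarrow> L h = \<kappa> * (LINT p|\<mu>. h p))"
  proof (cases "\<kappa> = 0")
    case True
    have le0: "L h \<le> 0" if h: "continuous_on UNIV h" for h
    proof -
      obtain B where B: "\<And>p. p \<in> {\<alpha>..\<beta>} \<Longrightarrow> \<bar>h p\<bar> \<le> B"
        using continuous_on_interval_bounded[OF continuous_on_subset[OF h subset_UNIV]] by blast
      have "0 \<le> L (\<lambda>p. B * 1 - h p)"
        by (rule Lpos) (use B h in \<open>auto simp: abs_le_iff intro!: continuous_intros\<close>)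
      then show ?thesis using Ldiff[of "\<lambda>p. B * 1" h] Lscale[of B "\<lambda>p. 1"] True by (simp add: \<kappa>_def)
    qed
    have "L h = 0" if h: "continuous_on UNIV h" for h
      using le0[OF h] le0[of "\<lambda>p. -1 * h p"] h Lscale[of "-1" h] by (simp add: continuous_on_minus)
    \<comment> \<open>If \<kappa> = 0 then \<open>L\<close> vanishes, and any probability measure on
      the interval represents it.\<close>
    moreover have "prob_measure_on \<alpha> \<beta> (return borel \<alpha>)"
      using \<alpha> by (auto simp: prob_measure_on_def prob_space_return measure_return)
    ultimately show ?thesis using True by auto
  next
    case False
    then have k: "\<kappa> > 0" using \<kappa> by simp
    have "\<exists>\<mu>. prob_measure_on \<alpha> \<beta> \<mu> \<and> (\<forall>h. continuous_on UNIV h \<longrightarrow> L h / \<kappa> = (LINT p|\<mu>. h p))"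
      by (rule Riesz_representation_interval[OF \<alpha>(2)])
        (use k Ladd Lscale Lpos in \<open>auto simp: add_divide_distrib \<kappa>_def\<close>)
    then show ?thesis using k by (auto simp: field_simps)
  qed
  then obtain \<mu> where \<mu>: "prob_measure_on \<alpha> \<beta> \<mu>"
    and L\<mu>: "\<And>h. continuous_on UNIV h \<Longrightarrow> L h = \<kappa> * (LINT p|\<mu>. h p)" by blast
  note \<mu>p = prob_measure_onD(1)[OF \<mu>] and \<mu>s = prob_measure_onD(2)[OF \<mu>]
  interpret \<mu>: prob_space \<mu> by (rule \<mu>p)
  note [measurable_cong] = \<mu>s
  note ae\<mu> = prob_measure_onD(3)[OF \<mu>]
  define av where "av Z = (LINT p:{\<alpha>..\<beta>}|\<mu>. avar M p Z)" for Z
  \<comment> \<open>Constant continuation beyond the endpoints, because \<open>L\<close> acts on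
    functions that are continuous on the whole line.\<close>
  define ext where "ext Z p = avar M (max \<alpha> (min \<beta> p)) Z" for Z p
  have extc: "continuous_on UNIV (ext Z)" if "integrable M Z" for Z
    unfolding ext_def
    by (rule continuous_on_compose2[OF continuous_on_avar[OF that \<alpha>(1,3)]]) (use \<alpha> in \<open>auto intro!: continuous_intros\<close>)
  have Lext: "L (ext Z) = \<kappa> * av Z" if Z: "integrable M Z" for Z
  proof -
    have "(LINT p|\<mu>. ext Z p) = av Z"
      unfolding av_def set_lebesgue_integral_def
    proof (rule integral_cong_AE)
      show "AE p in \<mu>. ext Z p = indicat_real {\<alpha>..\<beta>} p *\<^sub>R avar M p Z"
        using ae\<mu> by eventually_elim (simp add: ext_def)
      show "ext Z \<in> borel_measurable \<mu>"
        using borel_measurable_continuous_onI[OF extc[OF Z]] by measurable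
      show "(\<lambda>p. indicat_real {\<alpha>..\<beta>} p *\<^sub>R avar M p Z) \<in> borel_measurable \<mu>"
        using borel_measurable_continuous_on_indicator[OF _ continuous_on_avar[OF Z \<alpha>(1,3)]] by measurable
    qed
    then show ?thesis using L\<mu>[OF extc[OF Z]] by simp
  qed
  have key': "f u + T e \<le> \<phi> (y + u) - \<phi> xh + \<kappa> * (av (g (y + e)) - av Y)" if y: "y \<in> C" for u e y
  proof -
    have "f u + T e \<le> \<phi> (y + u) - \<phi> xh + L (\<lambda>p. ext (g (y + e)) p - ext Y p)"
      by (rule key) (use y extc gi Yi in \<open>auto intro!: continuous_intros simp: ext_def\<close>)
    then show ?thesis by (simp add: Ldiff Lext gi Yi right_diff_distrib)
  qed
  \<comment> \<open>Feasibility of \<open>xh\<close> gives one inequality of complementarity; the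
    other is \<open>key'\<close> at y = xh without perturbation.\<close>
  have "0 \<le> L (\<lambda>p. ext Y p - ext (g xh) p)"
    by (rule Lpos) (use opt1(2) extc gi Yi in \<open>auto intro!: continuous_intros simp: ext_def\<close>)
  then have compl: "\<kappa> * av (g xh) = \<kappa> * av Y"
    using key'[OF opt1(1), of 0 0] f0 T0
    by (intro antisym) (simp_all add: Ldiff Lext gi Yi right_diff_distrib)
  have fle: "f u \<le> \<phi> (xh + u) - \<phi> xh" for u
    using key'[OF opt1(1), of u 0] compl T0 by (simp add: right_diff_distrib)
  have Tle: "T e \<le> \<kappa> * (av (g (xh + e)) - av (g xh))" for e
    using key'[OF opt1(1), of 0 e] compl f0 unfolding right_diff_distrib add_0_right by linarith
  \<comment> \<open>The shifts u = e = - (y - xh) return both arguments to \<open>xh\<close>, so the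
    right-hand side vanishes by complementarity.\<close>
  have cone: "0 \<le> f (y - xh) + T (y - xh)" if "y \<in> C" for y
    using key'[OF that, of "- (y - xh)" "- (y - xh)"] compl
    by (simp add: linear_neg[OF fl] linear_neg[OF Tl] right_diff_distrib del: minus_diff_eq)
  have "bounded_linear f"
  proof -
    have "isCont \<phi> xh" using \<phi>(2) by (simp add: continuous_on_eq_continuous_at)
    then obtain d where d: "d > 0" "\<And>y. dist y xh < d \<Longrightarrow> dist (\<phi> y) (\<phi> xh) < 1"
      unfolding continuous_at_eps_delta by (metis zero_less_one)
    have "f u \<le> 1" if "norm u < d" for u
      using fle[of u] d(2)[of "xh + u"] that by (auto simp: dist_norm abs_less_iff)
    then show ?thesis using linear_bounded_above_imp_bounded_linear[OF fl d(1)] by blast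
  qed
  then have fb: "blinfun_apply (Blinfun f) = f" by (rule bounded_linear_Blinfun_apply)
  have "Blinfun f \<in> subdifferential \<phi> xh"
    unfolding subdifferential_def
  proof (intro CollectI allI)
    fix y show "\<phi> y \<ge> \<phi> xh + blinfun_apply (Blinfun f) (y - xh)" using fle[of "y - xh"] by (simp add: fb)
  qed
  moreover have "0 \<le> blinfun_apply (Blinfun f) (y - xh) + T (y - xh)" if "y \<in> C" for y
    unfolding fb by (rule cone[OF that])
  ultimately show ?thesis
    using that[OF _ Tl \<kappa> \<mu> Tle[unfolded av_def] _ compl[unfolded av_def]] by blast
qed

text \<open>The multiplier \<open>T\<close> is factored through \<xi> and \<open>S\<close>; the
  normal vector is then whatever makes the sum zero, and \<open>cone\<close> states its
  membership.\<close>

theorem stationarity_necessary: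
  shows "\<exists>S\<in>concave_op_subdifferential M m g xh. \<exists>\<mu> \<kappa>. prob_measure_on \<alpha> \<beta> \<mu> \<and> 0 \<le> \<kappa> \<and>
    stationarity M m \<phi> g C \<alpha> \<beta> xh S \<mu> \<kappa> \<and> complementarity M g Y \<alpha> \<beta> xh \<mu> \<kappa>"
proof -
  have gi: "integrable M (g x)" for x by (rule Lp_space_integrable[OF m gL])
  obtain f T \<kappa> \<mu> where f: "f \<in> subdifferential \<phi> xh" and T: "linear T" and \<kappa>: "0 \<le> \<kappa>"
    and \<mu>: "prob_measure_on \<alpha> \<beta> \<mu>"
    and Tle: "\<And>e. T e \<le> \<kappa> * ((LINT p:{\<alpha>..\<beta>}|\<mu>. avar M p (g (xh + e))) - (LINT p:{\<alpha>..\<beta>}|\<mu>. avar M p (g xh)))"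
    and cone: "\<And>y. y \<in> C \<Longrightarrow> 0 \<le> blinfun_apply f (y - xh) + T (y - xh)"
    and compl: "\<kappa> * (LINT p:{\<alpha>..\<beta>}|\<mu>. avar M p (g xh)) = \<kappa> * (LINT p:{\<alpha>..\<beta>}|\<mu>. avar M p Y)"
    using lagrange_multipliers by blast
  have "\<exists>\<xi>\<in>AVaR_subdifferential_integral M m \<mu> \<alpha> \<beta> (g xh). \<exists>S\<in>concave_op_subdifferential M m g xh.
      \<forall>e. T e = \<kappa> * (LINT w|M. \<xi> w * S e w)"
  proof (cases "\<kappa> = 0")
    case True
    have T0: "T e = 0" for e
      using Tle[of e] Tle[of "- e"] True by (simp add: linear_neg[OF T])
    \<comment> \<open>Even with multiplier 0 the Minkowski sum needs an element \<xi>, so the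
      integral of subdifferentials must be shown to be nonempty.\<close>
    have "\<exists>\<zeta>. (\<lambda>(p, w). \<zeta> p w) \<in> borel_measurable (borel \<Otimes>\<^sub>M M) \<and> (\<forall>p w. \<bar>\<zeta> p w\<bar> \<le> 1 / \<alpha>) \<and>
      (\<forall>p\<in>{\<alpha>..\<beta>}. \<zeta> p \<in> avar_dual_set M p \<and> (LINT w|M. \<zeta> p w * g xh w) = avar M p (g xh)) \<and>
      (\<forall>e::'x. 0 \<le> (LINT w|M. (LINT p:{\<alpha>..\<beta>}|\<mu>. \<zeta> p w) * (g xh w - g xh w)))"
      by (rule avar_mixture_subgradient[OF \<mu> \<alpha>(1,3), of "\<lambda>_::'x. g xh" "\<lambda>_. 0"])
        (simp_all add: gi concave_on_const linear_zero)
    then obtain \<zeta> where \<zeta>: "(\<lambda>(p, w). \<zeta> p w) \<in> borel_measurable (borel \<Otimes>\<^sub>M M)" "\<And>p w. \<bar>\<zeta> p w\<bar> \<le> 1 / \<alpha>"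
      "\<And>p. p \<in> {\<alpha>..\<beta>} \<Longrightarrow> \<zeta> p \<in> avar_dual_set M p \<and> (LINT w|M. \<zeta> p w * g xh w) = avar M p (g xh)"
      by blast
    \<comment> \<open>With \<xi> = 0 the disintegration theorem reduces to the existence of some
      subgradient of \<open>g\<close> at \<open>xh\<close>.\<close>
    have "\<exists>S\<in>concave_op_subdifferential M m g xh. \<forall>e. 0 = (LINT w|M. 0 * S e w)"
      by (rule concave_op_subgradient_exists[OF m gL gc conc, where B=0]) (auto simp: linear_zero)
    then show ?thesis
      using AVaR_subdifferential_integralI(1)[OF m gL \<mu> \<alpha>(1,3) \<zeta>] True T0 by auto
  next
    case False
    with \<kappa> have k: "\<kappa> > 0" by simp
    have lin: "linear (\<lambda>e. T e / \<kappa>)"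
      by (rule linearI) (simp_all add: linear_add[OF T] linear_scale[OF T] add_divide_distrib)
    have "\<exists>\<zeta>. (\<lambda>(p, w). \<zeta> p w) \<in> borel_measurable (borel \<Otimes>\<^sub>M M) \<and> (\<forall>p w. \<bar>\<zeta> p w\<bar> \<le> 1 / \<alpha>) \<and>
      (\<forall>p\<in>{\<alpha>..\<beta>}. \<zeta> p \<in> avar_dual_set M p \<and> (LINT w|M. \<zeta> p w * g (xh + 0) w) = avar M p (g (xh + 0))) \<and>
      (\<forall>e. T e / \<kappa> \<le> (LINT w|M. (LINT p:{\<alpha>..\<beta>}|\<mu>. \<zeta> p w) * (g (xh + e) w - g (xh + 0) w)))"
    proof (rule avar_mixture_subgradient[OF \<mu> \<alpha>(1,3) gi _ lin])
      show "concave_on UNIV (\<lambda>e. g (xh + e) w)" if w: "w \<in> space M" for w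
        unfolding concave_on_iff
      proof (intro conjI ballI allI impI convex_UNIV)
        fix u v :: 'x and s t :: real assume st: "0 \<le> s" "0 \<le> t" "s + t = 1"
        have "s * g (xh + u) w + t * g (xh + v) w \<le> g (s *\<^sub>R (xh + u) + t *\<^sub>R (xh + v)) w"
          using conc[OF w] st by (auto simp: concave_on_iff)
        also have "s *\<^sub>R (xh + u) + t *\<^sub>R (xh + v) = (s + t) *\<^sub>R xh + (s *\<^sub>R u + t *\<^sub>R v)"
          by (simp add: algebra_simps)
        finally show "s * g (xh + u) w + t * g (xh + v) w \<le> g (xh + (s *\<^sub>R u + t *\<^sub>R v)) w"
          using st by simp
      qed
      show "T e / \<kappa> \<le> (LINT p:{\<alpha>..\<beta>}|\<mu>. avar M p (g (xh + e))) - (LINT p:{\<alpha>..\<beta>}|\<mu>. avar M p (g (xh + 0)))" for e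
        using Tle[of e] k by (simp add: field_simps)
    qed
    then obtain \<zeta> where \<zeta>: "(\<lambda>(p, w). \<zeta> p w) \<in> borel_measurable (borel \<Otimes>\<^sub>M M)" "\<And>p w. \<bar>\<zeta> p w\<bar> \<le> 1 / \<alpha>"
      "\<And>p. p \<in> {\<alpha>..\<beta>} \<Longrightarrow> \<zeta> p \<in> avar_dual_set M p \<and> (LINT w|M. \<zeta> p w * g xh w) = avar M p (g xh)"
      and T\<zeta>: "\<And>e. T e / \<kappa> \<le> (LINT w|M. (LINT p:{\<alpha>..\<beta>}|\<mu>. \<zeta> p w) * (g (xh + e) w - g xh w))"
      unfolding add_0_right by blast
    note \<xi> = AVaR_subdifferential_integralI[OF m gL \<mu> \<alpha>(1,3) \<zeta>]
    obtain S where "S \<in> concave_op_subdifferential M m g xh"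
      and "\<And>e. T e / \<kappa> = (LINT w|M. (LINT p:{\<alpha>..\<beta>}|\<mu>. \<zeta> p w) * S e w)"
      using concave_op_subgradient_exists[OF m gL gc conc \<xi>(2,3,4) lin T\<zeta>] by blast
    then show ?thesis
      using \<xi>(1) k by (intro bexI[OF _ \<xi>(1)] bexI[of _ S]) (auto simp: field_simps)
  qed
  then obtain \<xi> S where \<xi>: "\<xi> \<in> AVaR_subdifferential_integral M m \<mu> \<alpha> \<beta> (g xh)"
    and S: "S \<in> concave_op_subdifferential M m g xh" and TS: "\<And>e. T e = \<kappa> * (LINT w|M. \<xi> w * S e w)"
    by blast
  have \<xi>L: "\<xi> \<in> Lp_space M (conj_exponent m)" using \<xi> by (simp add: AVaR_subdifferential_integral_def)
  have Sc: "cont_linear_op M m S" using S by (simp add: concave_op_subdifferential_def)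
  define n where "n = - (f + \<kappa> *\<^sub>R op_adjoint M S \<xi>)"
  have "blinfun_apply n d = - (blinfun_apply f d + T d)" for d
    unfolding n_def TS
    by (simp only: uminus_blinfun.rep_eq plus_blinfun.rep_eq scaleR_blinfun.rep_eq
        op_adjoint_apply(2)[OF m \<xi>L Sc] real_scaleR_def)
  then have "n \<in> normal_cone C xh"
    unfolding normal_cone_def using cone by fastforce
  then have "f + \<kappa> *\<^sub>R op_adjoint M S \<xi> + n \<in> subdifferential \<phi> xh +
      (\<lambda>\<xi>. \<kappa> *\<^sub>R op_adjoint M S \<xi>) ` AVaR_subdifferential_integral M m \<mu> \<alpha> \<beta> (g xh) + normal_cone C xh"
    using f \<xi> by (intro set_plus_intro) auto
  then have "stationarity M m \<phi> g C \<alpha> \<beta> xh S \<mu> \<kappa>"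
    unfolding stationarity_def by (simp add: n_def)
  moreover have "complementarity M g Y \<alpha> \<beta> xh \<mu> \<kappa>"
  proof -
    have ext: "ext_integral \<mu> {\<alpha>..\<beta>} (\<lambda>p. AVaR M p Z) = ereal (LINT p:{\<alpha>..\<beta>}|\<mu>. avar M p Z)" if "integrable M Z" for Z
    proof (rule ext_integral_eq)
      show "set_integrable \<mu> {\<alpha>..\<beta>} (\<lambda>p. avar M p Z)"
        by (rule continuous_on_imp_set_integrable[OF _ _ continuous_on_avar[OF that \<alpha>(1,3)]])
          (use \<mu> in \<open>auto simp: prob_measure_on_def prob_space.finite_measure\<close>)
    qed (use \<alpha> in \<open>auto simp: AVaR_eq_avar\<close>)
    show ?thesis using compl by (simp add: complementarity_def ext gi Yi)
  qed
  ultimately show ?thesis using S \<mu> \<kappa> by blast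
qed

end

end

theorem theorem5p2:
  fixes M :: "'w measure"
    and \<phi> :: "'x::banach \<Rightarrow> real"
    and g :: "'x \<Rightarrow> 'w \<Rightarrow> real"
    and Y :: "'w \<Rightarrow> real"
    and C :: "'x set"
    and m :: real
  assumes "prob_space M"
    and "1 \<le> m"
    and "integrable M Y"
    and "convex_on UNIV \<phi>" and "continuous_on UNIV \<phi>"
    and "\<forall>x. g x \<in> Lp_space M (ereal m)" and "norm_continuous M m g"
    and "Caratheodory M g" and "\<forall>\<omega>\<in>space M. concave_on UNIV (\<lambda>x. g x \<omega>)"
    and "closed C" and "convex C"
  shows
    "(\<forall>\<alpha> \<beta> xh.
        0 < \<alpha> \<and> \<alpha> \<le> \<beta> \<and> \<beta> \<le> 1 \<and>
        (\<exists>xt\<in>C. (INF p\<in>{\<alpha>..\<beta>}. int_quantile M (g xt) p - int_quantile M Y p) > 0) \<and>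
        optimal_solution M \<phi> g Y C \<alpha> \<beta> xh \<longrightarrow>
        (\<exists>S\<in>concave_op_subdifferential M m g xh. \<exists>\<mu> \<kappa>.
           prob_measure_on \<alpha> \<beta> \<mu> \<and> \<kappa> \<ge> 0 \<and>
           stationarity M m \<phi> g C \<alpha> \<beta> xh S \<mu> \<kappa> \<and>
           complementarity M g Y \<alpha> \<beta> xh \<mu> \<kappa>))
     \<and>
     (\<forall>xh \<mu> \<kappa>. \<forall>S\<in>concave_op_subdifferential M m g xh.
        xh \<in> C \<and> prob_measure_on 0 1 \<mu> \<and> \<kappa> \<ge> 0 \<and>
        stationarity M m \<phi> g C 0 1 xh S \<mu> \<kappa> \<and>
        complementarity M g Y 0 1 xh \<mu> \<kappa> \<and>
        (\<forall>p\<in>{0..1}. int_quantile M (g xh) p \<ge> int_quantile M Y p) \<longrightarrow>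
        optimal_solution M \<phi> g Y C 0 1 xh)"
proof -
  interpret prob_space M by fact
  have gL: "g x \<in> Lp_space M (ereal m)" for x using assms(6) by blast
  have conc: "concave_on UNIV (\<lambda>x. g x \<omega>)" if "\<omega> \<in> space M" for \<omega> using assms(9) that by blast
  show ?thesis
  proof (intro conjI allI impI ballI)
    fix \<alpha> \<beta> xh
    assume "0 < \<alpha> \<and> \<alpha> \<le> \<beta> \<and> \<beta> \<le> 1 \<and>
        (\<exists>xt\<in>C. (INF p\<in>{\<alpha>..\<beta>}. int_quantile M (g xt) p - int_quantile M Y p) > 0) \<and>
        optimal_solution M \<phi> g Y C \<alpha> \<beta> xh"
    then obtain xt where "0 < \<alpha>" "\<alpha> \<le> \<beta>" "\<beta> \<le> 1" "xt \<in> C"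
      "(INF p\<in>{\<alpha>..\<beta>}. int_quantile M (g xt) p - int_quantile M Y p) > 0"
      "optimal_solution M \<phi> g Y C \<alpha> \<beta> xh" by blast
    from stationarity_necessary[OF assms(2-5) gL assms(7) conc assms(11) this]
    show "\<exists>S\<in>concave_op_subdifferential M m g xh. \<exists>\<mu> \<kappa>. prob_measure_on \<alpha> \<beta> \<mu> \<and> \<kappa> \<ge> 0 \<and>
        stationarity M m \<phi> g C \<alpha> \<beta> xh S \<mu> \<kappa> \<and> complementarity M g Y \<alpha> \<beta> xh \<mu> \<kappa>" .
  next
    fix xh \<mu> \<kappa> S
    assume S: "S \<in> concave_op_subdifferential M m g xh"
      and a: "xh \<in> C \<and> prob_measure_on 0 1 \<mu> \<and> \<kappa> \<ge> 0 \<and>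
        stationarity M m \<phi> g C 0 1 xh S \<mu> \<kappa> \<and> complementarity M g Y 0 1 xh \<mu> \<kappa> \<and>
        (\<forall>p\<in>{0..1}. int_quantile M (g xh) p \<ge> int_quantile M Y p)"
    have "\<phi> xh \<le> \<phi> y" if "y \<in> feasible_set M g Y C 0 1" for y
      by (rule stationarity_sufficient[OF assms(2,3) gL _ _ S _ _ that]) (use a in auto)
    then show "optimal_solution M \<phi> g Y C 0 1 xh"
      using a by (simp add: optimal_solution_def feasible_set_def)
  qed
qed

end
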